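(* Let $X\in S^1$ with $\operatorname{tr}(X)=0$, and let $\varepsilon>0$. Then there exists $\rho\in L^1(\mathbb{R}^2)$ such that $\hat\rho=1$ on a neighborhood of $(0,0)$ and $$\|\rho\cdot X\|_{S^1}<\varepsilon .$$
   Context: For $p\in[1,\infty)$, $S^p$ denotes the Schatten class of bounded operators $X$ on $L^2(\mathbb{R})$ with $\|X\|_{S^p}=(\operatorname{tr}|X|^p)^{1/p}<\infty$; $S^\infty$ denotes the compact operators on $L^2(\mathbb{R})$ with the operator norm. For $x,y\in\mathbb{R}$, $T_x$ and $M_y$ are the unitary operators on $L^2(\mathbb{R})$ given by $(T_xs)(t)=s(t-x)$ and $(M_ys)(t)=e^{-2\pi i yt}s(t)$. For $(x_1,y_1)\in\mathbb{R}^2$ and $X\in S^1$, set $(x_1,y_1)\cdot X=T_{y_1}M_{-x_1}XM_{x_1}T_{-y_1}$, and for $q\in L^1(\mathbb{R}^2)$, set $q\cdot X=\iint q(x_1,y_1)\,(x_1,y_1)\cdot X\,dx_1\,dy_1$ (an $S^1$-valued integral; this makes $S^1$ an $L^1(\mathbb{R}^2)$-module). The Fourier transform of $q\in L^1(\mathbb{R}^2)$ is $\hat q(x,y)=\iint q(x_1,y_1)e^{-2\pi i(xx_1+yy_1)}\,dx_1\,dy_1$. *)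

theory Defs
  imports "HOL-Analysis.Analysis"
begin

text \<open>Elements of L^2(R) are represented by complex-valued functions on the reals,
  modulo equality almost everywhere; operators are maps on such functions, and
  only their behaviour on square-integrable functions modulo a.e. equality matters.\<close>

type_synonym fn = "real \<Rightarrow> complex"
type_synonym op = "fn \<Rightarrow> fn"

definition L2 :: "fn set" where
  "L2 = {f. f \<in> borel_measurable lborel \<and> integrable lborel (\<lambda>t. (cmod (f t))\<^sup>2)}"

definition aeq :: "fn \<Rightarrow> fn \<Rightarrow> bool" where
  "aeq f g \<longleftrightarrow> (AE t in lborel. f t = g t)"

definition ip :: "fn \<Rightarrow> fn \<Rightarrow> complex" where
  "ip f g = (\<integral>t. f t * cnj (g t) \<partial>lborel)"

definition l2norm :: "fn \<Rightarrow> real" where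
  "l2norm f = sqrt (\<integral>t. (cmod (f t))\<^sup>2 \<partial>lborel)"

definition bounded_op :: "op \<Rightarrow> bool" where
  "bounded_op X \<longleftrightarrow>
     (\<forall>f\<in>L2. X f \<in> L2) \<and>
     (\<forall>f\<in>L2. \<forall>g\<in>L2. aeq f g \<longrightarrow> aeq (X f) (X g)) \<and>
     (\<forall>f\<in>L2. \<forall>g\<in>L2. \<forall>a::complex.
        aeq (X (\<lambda>t. a * f t + g t)) (\<lambda>t. a * X f t + X g t)) \<and>
     (\<exists>C. \<forall>f\<in>L2. l2norm (X f) \<le> C * l2norm f)"

definition positive_op :: "op \<Rightarrow> bool" where
  "positive_op P \<longleftrightarrow> bounded_op P \<and> (\<forall>f\<in>L2. ip (P f) f \<in> \<real> \<and> 0 \<le> Re (ip (P f) f))"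

text \<open>P is the absolute value |X| = (X^* X)^(1/2): P is positive and P^2 = X^* X,
  i.e. <P f, P g> = <X f, X g> for all f, g (P being self-adjoint).\<close>
definition is_abs :: "op \<Rightarrow> op \<Rightarrow> bool" where
  "is_abs X P \<longleftrightarrow> positive_op P \<and> (\<forall>f\<in>L2. \<forall>g\<in>L2. ip (P f) (P g) = ip (X f) (X g))"

definition abs_op :: "op \<Rightarrow> op" where
  "abs_op X = (SOME P. is_abs X P)"

definition onb :: "(nat \<Rightarrow> fn) \<Rightarrow> bool" where
  "onb e \<longleftrightarrow> (\<forall>n. e n \<in> L2) \<and> (\<forall>n m. ip (e n) (e m) = (if n = m then 1 else 0)) \<and>
     (\<forall>f\<in>L2. (\<forall>n. ip f (e n) = 0) \<longrightarrow> aeq f (\<lambda>_. 0))"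

definition the_onb :: "nat \<Rightarrow> fn" where
  "the_onb = (SOME e. onb e)"

text \<open>Trace of a positive operator (basis independent, value in [0,\<infinity>]).\<close>
definition trace_pos :: "op \<Rightarrow> ennreal" where
  "trace_pos P = (\<Sum>n. ennreal (Re (ip (P (the_onb n)) (the_onb n))))"

definition trace_norm :: "op \<Rightarrow> ennreal" where
  "trace_norm X = trace_pos (abs_op X)"

definition S1 :: "op set" where
  "S1 = {X. bounded_op X \<and> trace_norm X < \<infinity>}"

definition trace :: "op \<Rightarrow> complex" where
  "trace X = (\<Sum>n. ip (X (the_onb n)) (the_onb n))"

definition Tr :: "real \<Rightarrow> op" where
  "Tr x s = (\<lambda>t. s (t - x))"

definition Mod :: "real \<Rightarrow> op" where
  "Mod y s = (\<lambda>t. exp (- 2 * complex_of_real pi * \<i> * complex_of_real (y * t)) * s t)"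

definition pt_act :: "real \<times> real \<Rightarrow> op \<Rightarrow> op" where
  "pt_act z X = (case z of (x1, y1) \<Rightarrow> Tr y1 \<circ> Mod (- x1) \<circ> X \<circ> Mod x1 \<circ> Tr (- y1))"

text \<open>q . X = \<integral>\<integral> q(x1,y1) (x1,y1).X dx1 dy1, an S^1-valued integral; it is
  characterised (uniquely, as an operator on L^2) by its matrix coefficients
  <(q . X) s, g> = \<integral>\<integral> q(x1,y1) <((x1,y1).X) s, g>.\<close>
definition is_mod_act :: "((real \<times> real) \<Rightarrow> complex) \<Rightarrow> op \<Rightarrow> op \<Rightarrow> bool" where
  "is_mod_act q X Y \<longleftrightarrow> bounded_op Y \<and>
     (\<forall>s\<in>L2. \<forall>g\<in>L2. ip (Y s) g = (\<integral>z. q z * ip (pt_act z X s) g \<partial>lborel))"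

definition mod_act :: "((real \<times> real) \<Rightarrow> complex) \<Rightarrow> op \<Rightarrow> op" where
  "mod_act q X = (SOME Y. is_mod_act q X Y)"

definition fourier2 :: "((real \<times> real) \<Rightarrow> complex) \<Rightarrow> real \<times> real \<Rightarrow> complex" where
  "fourier2 q w = (case w of (x, y) \<Rightarrow>
     (\<integral>z. q z * exp (- 2 * complex_of_real pi * \<i> * complex_of_real (x * fst z + y * snd z)) \<partial>lborel))"

end

theory Submission
  imports Defs "HOL-Probability.Sinc_Integral"
begin

text \<open>The trace norm of \<open>Y\<close> is the supremum of \<open>|\<Sum>\<^sub>m \<langle>Y e\<^sub>m, u\<^sub>m\<rangle>|\<close> over finite families \<open>u\<close> that satisfy
  Bessel's inequality; hence \<open>\<parallel>q \<cdot> X\<parallel> \<le> \<parallel>q\<parallel>\<^sub>1 \<parallel>X\<parallel>\<close>. Let \<open>\<rho>\<^sub>n(z) = \<rho>(z/n)/n\<^sup>2\<close>, where the Fourier transform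
  of \<open>\<rho>\<close> is 1 near the origin and has compact support. The norms \<open>\<parallel>\<rho>\<^sub>n\<parallel>\<^sub>1\<close> do not depend on \<open>n\<close>, so it suffices
  that \<open>\<rho>\<^sub>n \<cdot> (F \<otimes> G)\<close> is asymptotically \<open>\<langle>F, G\<rangle> \<rho>\<^sub>n \<cdot> E\<close> for one fixed rank one operator \<open>E\<close> and for \<open>F\<close>, \<open>G\<close> in a
  total set: by the nuclear expansion of \<open>X\<close>, then \<open>\<rho>\<^sub>n \<cdot> X\<close> is asymptotically \<open>tr X\<close> times \<open>\<rho>\<^sub>n \<cdot> E\<close>.
  Take \<open>F\<close>, \<open>G\<close> to be indicators of dyadic intervals. If the intervals have positive distance, averaging over
  modulations multiplies the kernel by the Fourier transform at \<open>t - s\<close>, which vanishes for large \<open>n\<close>.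
  If they coincide, then \<open>\<rho>\<^sub>n\<close> is asymptotically translation invariant in \<open>L\<^sup>1\<close>, so only the
  length of the interval matters, and halving the interval compares different lengths.\<close>

subsection \<open>Operators on real Hilbert spaces\<close>

text \<open>\<open>abs_op\<close>, \<open>the_onb\<close> and \<open>mod_act\<close> are choices, so
  each of these objects must be shown to exist before anything can be read off from it; hence the
  functional analysis before the averages. It is done over the reals, and complex linearity is
  recovered as commutation with multiplication by i. The obstacle: averaging against a kernel whose
  Fourier transform is 1 at the origin preserves the trace, so the average of an operator of trace 1
  keeps trace norm at least 1 and cannot be made small. Smallness for X comes only from cancellation
  between the terms of its expansion. All averages are therefore compared with one reference, whose
  own behaviour never has to be found, and the comparison is uniform over the test families because
  the supremum is taken afterwards. The expansion is cut off before n is chosen; this is legitimate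
  because the tail is multiplied by an L1 norm independent of n. The kernel has two duties: a
  Fourier transform equal to 1 near the origin, as the claim demands, and equal to 0 far out, to
  remove off-diagonal terms.\<close>

lemma closed_subspace_projection:
  fixes V :: "'a::{real_inner,banach} set"
  assumes V: "subspace V" "closed V"
  shows "\<exists>p\<in>V. \<forall>v\<in>V. inner (x - p) v = 0"
proof -
  define D where "D = (INF v\<in>V. (norm (x - v))\<^sup>2)"
  have bdd: "bdd_below ((\<lambda>v. (norm (x - v))\<^sup>2) ` V)"
    by (rule bdd_belowI[of _ 0]) auto
  have V0: "0 \<in> V" using V by (simp add: subspace_0)
  have D_le: "D \<le> (norm (x - v))\<^sup>2" if "v \<in> V" for v
    unfolding D_def using bdd that by (rule cINF_lower)
  have ex: "\<exists>v\<in>V. (norm (x - v))\<^sup>2 < D + e" if "e > 0" for e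
    using cINF_less_iff[OF _ bdd, of "D + e"] V0 that unfolding D_def by auto
  have "\<exists>w. w \<in> V \<and> (norm (x - w))\<^sup>2 < D + inverse (real (Suc n))" for n
    using ex[of "inverse (real (Suc n))"] by auto
  then obtain v where v: "\<And>n. v n \<in> V" "\<And>n. (norm (x - v n))\<^sup>2 < D + inverse (real (Suc n))"
    by metis
  \<comment> \<open>Parallelogram law: the midpoint of a and b lies in V, so its squared distance to
    x is at least D. This makes a minimising sequence Cauchy.\<close>
  have par: "(norm (a - b))\<^sup>2 \<le> 2 * (norm (x - a))\<^sup>2 + 2 * (norm (x - b))\<^sup>2 - 4 * D" if "a \<in> V" "b \<in> V" for a b
  proof -
    have "(1/2) *\<^sub>R (a + b) \<in> V" using V that by (simp add: subspace_add subspace_scale)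
    then have "D \<le> (norm (x - (1/2) *\<^sub>R (a + b)))\<^sup>2" by (rule D_le)
    moreover have "4 * (norm (x - (1/2) *\<^sub>R (a + b)))\<^sup>2 + (norm (a - b))\<^sup>2
         = 2 * (norm (x - a))\<^sup>2 + 2 * (norm (x - b))\<^sup>2"
      by (simp add: power2_norm_eq_inner inner_simps algebra_simps inner_commute)
    ultimately show ?thesis by linarith
  qed
  have "Cauchy v"
  proof (rule metric_CauchyI)
    fix e :: real assume "e > 0"
    then obtain N where N: "inverse (real (Suc N)) < e\<^sup>2 / 4"
      using reals_Archimedean[of "e\<^sup>2/4"] by auto
    show "\<exists>M. \<forall>m\<ge>M. \<forall>n\<ge>M. dist (v m) (v n) < e"
    proof (intro exI[of _ N] allI impI)
      fix m n assume mn: "N \<le> m" "N \<le> n"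
      have i: "inverse (real (Suc k)) \<le> inverse (real (Suc N))" if "N \<le> k" for k
        using that by (simp add: divide_simps)
      have "(norm (v m - v n))\<^sup>2 < e\<^sup>2"
        using par[OF v(1)[of m] v(1)[of n]] v(2)[of m] v(2)[of n] i[OF mn(1)] i[OF mn(2)] N by linarith
      then show "dist (v m) (v n) < e"
        using \<open>e > 0\<close> by (simp add: dist_norm power_less_imp_less_base)
    qed
  qed
  then obtain p where p: "v \<longlonglongrightarrow> p" using Cauchy_convergent convergent_def by blast
  have pV: "p \<in> V" using closed_sequentially[OF V(2)] v(1) p by blast
  have "(\<lambda>n. (norm (x - v n))\<^sup>2) \<longlonglongrightarrow> (norm (x - p))\<^sup>2" by (intro tendsto_intros p)
  moreover have "(\<lambda>n. D + inverse (real (Suc n))) \<longlonglongrightarrow> D + 0"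
    by (intro tendsto_intros LIMSEQ_inverse_real_of_nat)
  ultimately have Dp: "(norm (x - p))\<^sup>2 \<le> D"
    using LIMSEQ_le less_imp_le[OF v(2)] by (metis (no_types, lifting) add.right_neutral)
  have "inner (x - p) w = 0" if w: "w \<in> V" for w
  proof (cases "w = 0")
    case False
    define t where "t = inner (x - p) w / inner w w"
    have ww: "inner w w > 0" using False by simp
    have "p + t *\<^sub>R w \<in> V" using V w pV by (simp add: subspace_add subspace_scale)
    then have "(norm (x - p))\<^sup>2 \<le> (norm (x - (p + t *\<^sub>R w)))\<^sup>2" using D_le Dp by (meson order_trans)
    also have "\<dots> = (norm (x - p))\<^sup>2 - 2 * t * inner (x - p) w + t\<^sup>2 * inner w w"
      unfolding power2_norm_eq_inner by (simp add: inner_simps algebra_simps inner_commute power2_eq_square)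
    also have "\<dots> = (norm (x - p))\<^sup>2 - (inner (x - p) w)\<^sup>2 / inner w w"
      using ww by (simp add: t_def power2_eq_square field_simps)
    finally have "(inner (x - p) w)\<^sup>2 / inner w w \<le> 0" by simp
    then show ?thesis using ww by (simp add: divide_le_0_iff)
  qed simp
  then show ?thesis using pV by blast
qed

lemma riesz_representation:
  fixes f :: "'a::{real_inner,banach} \<Rightarrow> real"
  assumes "bounded_linear f"
  shows "\<exists>w. \<forall>x. f x = inner x w"
proof (cases "\<forall>x. f x = 0")
  case True
  then show ?thesis by (intro exI[of _ 0]) simp
next
  case False
  interpret f: bounded_linear f by fact
  obtain x where x: "f x \<noteq> 0" using False by blast
  define V where "V = {y. f y = 0}"
  have "subspace V" unfolding V_def subspace_def by (auto simp: f.add f.scaleR f.zero)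
  moreover have "closed V" unfolding V_def
    by (intro closed_Collect_eq continuous_intros linear_continuous_on assms)
  ultimately obtain p where p: "p \<in> V" "\<forall>v\<in>V. inner (x - p) v = 0"
    using closed_subspace_projection[of V x] by blast
  define z where "z = x - p"
  have fz: "f z \<noteq> 0" using p x by (simp add: z_def V_def f.diff)
  have zz: "inner z z \<noteq> 0" using fz by (auto simp: f.zero)
  show ?thesis
  proof (intro exI[of _ "(f z / inner z z) *\<^sub>R z"] allI)
    fix y
    have "y - (f y / f z) *\<^sub>R z \<in> V" using fz by (simp add: V_def f.diff f.scaleR)
    then have "inner z (y - (f y / f z) *\<^sub>R z) = 0" using p(2) by (simp add: z_def)
    then have "inner z y = f y / f z * inner z z" by (simp add: inner_simps)
    then show "f y = inner y ((f z / inner z z) *\<^sub>R z)"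
      using fz zz by (simp add: inner_commute field_simps)
  qed
qed

lemma inner_left_eqI: "(\<And>g. inner a g = inner b g) \<Longrightarrow> a = b"
  by (metis inner_commute vector_eq_ldot)

text \<open>Riesz representation in the second argument, for each fixed first argument. Adjoints,
  the operator A*A and the average q . X are all obtained from their forms in this way.\<close>

lemma riesz_bilinear:
  fixes b :: "'a::{real_inner,banach} \<Rightarrow> 'a \<Rightarrow> real"
  assumes "bounded_bilinear b"
  shows "\<exists>Y :: 'a \<Rightarrow>\<^sub>L 'a. \<forall>s g. b s g = inner (Y s) g"
proof -
  interpret b: bounded_bilinear b by fact
  have "\<exists>w. \<forall>g. b s g = inner g w" for s
    by (rule riesz_representation) (rule b.bounded_linear_right)
  then obtain y where y: "\<And>s g. b s g = inner g (y s)" by metis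
  obtain K where K: "K > 0" "\<And>s g. \<bar>b s g\<bar> \<le> norm s * norm g * K"
    using b.pos_bounded by auto
  have "bounded_linear y"
  proof (rule bounded_linear_intro[where K=K])
    show "y (s + t) = y s + y t" for s t
      by (rule inner_left_eqI) (metis b.add_left inner_add_left inner_commute y)
    show "y (r *\<^sub>R s) = r *\<^sub>R y s" for r s
      by (rule inner_left_eqI) (metis b.scaleR_left inner_scaleR_left inner_commute y real_scaleR_def)
    show "norm (y s) \<le> norm s * K" for s
    proof (cases "y s = 0")
      case False
      have "norm (y s) * norm (y s) = b s (y s)"
        by (simp add: y power2_norm_eq_inner[symmetric] power2_eq_square)
      also have "\<dots> \<le> norm s * norm (y s) * K" using K(2)[of s "y s"] by simp
      finally show ?thesis using False by (simp add: mult.commute mult.left_commute)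
    qed (use K in simp)
  qed
  then have "b s g = inner (Blinfun y s) g" for s g
    by (simp add: y bounded_linear_Blinfun_apply inner_commute)
  then show ?thesis by blast
qed

lemma blinfun_adjoint:
  fixes A :: "'a::{real_inner,banach} \<Rightarrow>\<^sub>L 'a"
  shows "\<exists>B :: 'a \<Rightarrow>\<^sub>L 'a. (\<forall>x y. inner (blinfun_apply B x) y = inner x (blinfun_apply A y)) \<and> norm B \<le> norm A"
proof -
  have "bounded_bilinear (\<lambda>x y. inner x (A y))"
    by (rule bounded_bilinear.comp[OF bounded_bilinear_inner bounded_linear_ident])
       (rule blinfun.bounded_linear_right)
  then obtain B :: "'a \<Rightarrow>\<^sub>L 'a" where B: "\<And>x y. inner x (A y) = inner (B x) y"
    using riesz_bilinear by blast
  have "norm B \<le> norm A"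
  proof (rule norm_blinfun_bound)
    fix x
    show "norm (B x) \<le> norm A * norm x"
    proof (cases "B x = 0")
      case False
      have "norm (B x) * norm (B x) = inner x (A (B x))"
        by (simp add: B power2_norm_eq_inner[symmetric] power2_eq_square)
      also have "\<dots> \<le> norm x * norm (A (B x))" by (rule norm_cauchy_schwarz)
      also have "\<dots> \<le> norm x * (norm A * norm (B x))" by (intro mult_left_mono norm_blinfun) simp
      finally show ?thesis using False by (simp add: mult.commute mult.left_commute)
    qed simp
  qed simp
  then show ?thesis using B by metis
qed

section \<open>Square roots of positive operators\<close>

lemma positive_symmetric_norm_le_1:
  fixes A :: "'a::{real_inner,banach} \<Rightarrow>\<^sub>L 'a"
  assumes sym: "\<And>x y. inner (A x) y = inner x (A y)"
    and pos: "\<And>x. 0 \<le> inner (A x) x" and le: "\<And>x. inner (A x) x \<le> inner x x"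
  shows "norm A \<le> 1"
proof (rule norm_blinfun_bound)
  fix x
  define y where "y = A x"
  \<comment> \<open>Cauchy-Schwarz for the positive form A, applied to \<open>x\<close> and \<open>A x\<close>\<close>
  have cs: "(inner (A x) y)\<^sup>2 \<le> inner (A x) x * inner (A y) y"
  proof (cases "inner (A y) y = 0")
    case False
    then have p: "inner (A y) y > 0" using pos[of y] by simp
    define t where "t = inner (A x) y / inner (A y) y"
    have "0 \<le> inner (A (x - t *\<^sub>R y)) (x - t *\<^sub>R y)" by (rule pos)
    also have "\<dots> = inner (A x) x - 2 * t * inner (A x) y + t\<^sup>2 * inner (A y) y"
      using sym[of y x] by (simp add: blinfun.diff_right blinfun.scaleR_right inner_simps
          inner_commute power2_eq_square algebra_simps)
    also have "\<dots> = inner (A x) x - (inner (A x) y)\<^sup>2 / inner (A y) y"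
      using p by (simp add: t_def power2_eq_square field_simps)
    finally show ?thesis using p by (simp add: field_simps)
  next
    case True
    have "inner (A x) y = 0"
    proof (rule ccontr)
      assume n: "inner (A x) y \<noteq> 0"
      \<comment> \<open>Since \<open>inner (A y) y = 0\<close>, the form is affine in t; with
        nonzero slope it takes negative values, and this t gives -1.\<close>
      define t where "t = (inner (A x) x + 1) / (2 * inner (A x) y)"
      have "0 \<le> inner (A (x - t *\<^sub>R y)) (x - t *\<^sub>R y)" by (rule pos)
      also have "\<dots> = inner (A x) x - 2 * t * inner (A x) y"
        using sym[of y x] True by (simp add: blinfun.diff_right blinfun.scaleR_right inner_simps
            inner_commute power2_eq_square algebra_simps)
      also have "\<dots> = -1" using n by (simp add: t_def field_simps)
      finally show False by simp
    qed
    then show ?thesis using True by simp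
  qed
  have "(inner y y)\<^sup>2 \<le> inner x x * inner y y"
  proof -
    have "inner (A x) x * inner (A y) y \<le> inner x x * inner y y"
      by (intro mult_mono le pos) auto
    then show ?thesis using cs by (simp add: y_def)
  qed
  then have "inner y y \<le> inner x x"
    by (cases "inner y y = 0") (auto simp: power2_eq_square mult_le_cancel_right)
  then show "norm (A x) \<le> 1 * norm x" by (simp add: y_def norm_le)
qed simp

lemma subspace_closure:
  fixes S :: "'a::real_normed_vector set"
  assumes "subspace S"
  shows "subspace (closure S)"
proof (rule subspaceI)
  show "0 \<in> closure S" using subspace_0[OF assms] closure_subset by blast
next
  fix x y assume "x \<in> closure S" "y \<in> closure S"
  then obtain a b where ab: "\<And>n. a n \<in> S" "a \<longlonglongrightarrow> x" "\<And>n. b n \<in> S" "b \<longlonglongrightarrow> y"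
    unfolding closure_sequential by blast
  show "x + y \<in> closure S" unfolding closure_sequential
    by (rule exI[of _ "\<lambda>n. a n + b n"]) (simp add: subspace_add[OF assms] tendsto_add ab)
next
  fix c x assume "x \<in> closure S"
  then obtain a where a: "\<And>n. a n \<in> S" "a \<longlonglongrightarrow> x"
    unfolding closure_sequential by blast
  show "c *\<^sub>R x \<in> closure S" unfolding closure_sequential
    by (rule exI[of _ "\<lambda>n. c *\<^sub>R a n"]) (simp add: subspace_scale[OF assms] tendsto_scaleR a)
qed

text \<open>A limit \<open>B\<close> of this iteration satisfies \<open>(1 - B)\<^sup>2 = 1 - A\<close>. The scalar iteration for \<open>A = 1\<close>
  dominates the increments in norm, so convergence takes place in the operator norm.\<close>
fun sqrt_iter :: "('a::real_normed_vector \<Rightarrow>\<^sub>L 'a) \<Rightarrow> nat \<Rightarrow> ('a \<Rightarrow>\<^sub>L 'a)" where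
  "sqrt_iter A 0 = 0"
| "sqrt_iter A (Suc n) = (1/2) *\<^sub>R (A + (sqrt_iter A n o\<^sub>L sqrt_iter A n))"

fun sqrt_majorant :: "nat \<Rightarrow> real" where
  "sqrt_majorant 0 = 0"
| "sqrt_majorant (Suc n) = (1 + (sqrt_majorant n)\<^sup>2) / 2"

lemma sqrt_majorant_bounds: "0 \<le> sqrt_majorant n \<and> sqrt_majorant n \<le> 1"
  by (induction n) (auto simp: power_le_one)

lemma sqrt_majorant_Suc: "sqrt_majorant n \<le> sqrt_majorant (Suc n)"
proof -
  have "0 \<le> (1 - sqrt_majorant n)\<^sup>2" by simp
  then show ?thesis by (simp add: power2_eq_square algebra_simps)
qed

text \<open>The increments of \<open>sqrt_majorant\<close> satisfy with equality the recursion that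
  the norms of the increments of \<open>sqrt_iter\<close> satisfy as an inequality.\<close>

lemma sqrt_iter_bounds:
  assumes A: "norm A \<le> 1"
  shows "norm (sqrt_iter A n) \<le> sqrt_majorant n"
    and "norm (sqrt_iter A (Suc n) - sqrt_iter A n) \<le> sqrt_majorant (Suc n) - sqrt_majorant n"
proof -
  show *: "norm (sqrt_iter A n) \<le> sqrt_majorant n" for n
  proof (induction n)
    case (Suc n)
    have "norm (A + (sqrt_iter A n o\<^sub>L sqrt_iter A n))
        \<le> norm A + norm (sqrt_iter A n) * norm (sqrt_iter A n)"
      by (meson norm_triangle_mono norm_blinfun_compose order_refl)
    also have "\<dots> \<le> 1 + sqrt_majorant n * sqrt_majorant n"
      using A Suc sqrt_majorant_bounds[of n] by (intro add_mono mult_mono) auto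
    finally show ?case by (simp add: power2_eq_square)
  qed simp
  show "norm (sqrt_iter A (Suc n) - sqrt_iter A n) \<le> sqrt_majorant (Suc n) - sqrt_majorant n"
  proof (induction n)
    case 0
    show ?case using A by simp
  next
    case (Suc n)
    let ?B = "sqrt_iter A" and ?b = sqrt_majorant
    define D where "D = ?B (Suc n) - ?B n"
    have "?B (Suc (Suc n)) - ?B (Suc n)
        = (1/2) *\<^sub>R (A + (?B (Suc n) o\<^sub>L ?B (Suc n))) - (1/2) *\<^sub>R (A + (?B n o\<^sub>L ?B n))"
      by (rule arg_cong2[where f="(-)"]) (rule sqrt_iter.simps)+
    \<comment> \<open>A difference of squares as (S - T) S + T (S - T), an order of factors valid
      without commutativity.\<close>
    also have "\<dots> = (1/2) *\<^sub>R ((D o\<^sub>L ?B (Suc n)) + (?B n o\<^sub>L D))"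
      by (simp add: D_def bounded_bilinear.diff_left[OF bounded_bilinear_blinfun_compose]
            bounded_bilinear.diff_right[OF bounded_bilinear_blinfun_compose]
            scaleR_add_right scaleR_diff_right del: sqrt_iter.simps)
    also have "norm \<dots> \<le> (norm D * norm (?B (Suc n)) + norm (?B n) * norm D) / 2"
    proof -
      have "norm ((D o\<^sub>L ?B (Suc n)) + (?B n o\<^sub>L D)) \<le> norm D * norm (?B (Suc n)) + norm (?B n) * norm D"
        by (meson norm_triangle_mono norm_blinfun_compose)
      then show ?thesis by simp
    qed
    also have "\<dots> \<le> ((?b (Suc n) - ?b n) * ?b (Suc n) + ?b n * (?b (Suc n) - ?b n)) / 2"
      using Suc *[of n] *[of "Suc n"] sqrt_majorant_bounds[of n] sqrt_majorant_Suc[of n]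
      unfolding D_def by (intro divide_right_mono add_mono mult_mono) (auto simp del: sqrt_iter.simps sqrt_majorant.simps)
    also have "\<dots> = ?b (Suc (Suc n)) - ?b (Suc n)"
      unfolding sqrt_majorant.simps(2)[of "Suc n"]
      by (subst (5) sqrt_majorant.simps(2)) (simp add: power2_eq_square field_simps del: sqrt_majorant.simps)
    finally show ?case .
  qed
qed

text \<open>The increments telescope against a bounded increasing real sequence. As
  \<open>norm A\<close> may equal 1, the iteration has no contraction factor, so monotonicity takes
  the place of a geometric bound.\<close>

lemma sqrt_iter_convergent:
  fixes A :: "'a::{real_inner,banach} \<Rightarrow>\<^sub>L 'a"
  assumes A: "norm A \<le> 1"
  shows "\<exists>B. sqrt_iter A \<longlonglongrightarrow> B"
proof -
  have "incseq sqrt_majorant" by (rule incseq_SucI) (rule sqrt_majorant_Suc)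
  then have "convergent sqrt_majorant"
    by (rule incseq_convergent[of _ 1]) (auto simp: sqrt_majorant_bounds convergent_def)
  then have C: "Cauchy sqrt_majorant" by (rule convergent_Cauchy)
  have diff: "norm (sqrt_iter A (n + k) - sqrt_iter A n) \<le> sqrt_majorant (n + k) - sqrt_majorant n" for n k
  proof (induction k)
    case (Suc k)
    have "norm (sqrt_iter A (n + Suc k) - sqrt_iter A n)
      \<le> norm (sqrt_iter A (Suc (n + k)) - sqrt_iter A (n + k)) + norm (sqrt_iter A (n + k) - sqrt_iter A n)"
      by (metis add_Suc_right norm_triangle_ineq diff_add_cancel add_diff_eq)
    then show ?case using sqrt_iter_bounds(2)[OF A, of "n + k"] Suc
      by (simp del: sqrt_iter.simps sqrt_majorant.simps)
  qed simp
  have "Cauchy (sqrt_iter A)"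
  proof (rule CauchyI')
    fix e :: real assume "e > 0"
    then obtain M where M: "\<And>m n. m \<ge> M \<Longrightarrow> n \<ge> M \<Longrightarrow> norm (sqrt_majorant m - sqrt_majorant n) < e"
      using CauchyD[OF C] by blast
    have "dist (sqrt_iter A m) (sqrt_iter A n) < e" if "m \<ge> M" "n > m" for m n
      using diff[of m "n - m"] M[of n m] that by (simp add: norm_minus_commute dist_norm)
    then show "\<exists>M. \<forall>m\<ge>M. \<forall>n>m. dist (sqrt_iter A m) (sqrt_iter A n) < e" by blast
  qed
  then show ?thesis using Cauchy_convergent convergent_def by blast
qed

text \<open>The root is sqrt c times 1 - B for the limit B of the iteration started from 1 - M/c; it
  is positive because B has norm at most 1. The commutation clause passes through the iterates to
  the limit. Its purpose is the case where C is multiplication by i: the root of a complex-linear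
  operator is complex linear.\<close>

lemma positive_sqrt:
  fixes M :: "'a::{real_inner,banach} \<Rightarrow>\<^sub>L 'a"
  assumes sym: "\<And>x y. inner (M x) y = inner x (M y)" and pos: "\<And>x. 0 \<le> inner (M x) x"
  shows "\<exists>R :: 'a \<Rightarrow>\<^sub>L 'a. (\<forall>x y. inner (R x) y = inner x (R y)) \<and> (\<forall>x. 0 \<le> inner (R x) x) \<and>
    (\<forall>x. R (R x) = M x) \<and>
    (\<forall>C :: 'a \<Rightarrow>\<^sub>L 'a. (\<forall>x. C (M x) = M (C x)) \<longrightarrow> (\<forall>x. C (R x) = R (C x)))"
proof -
  \<comment> \<open>Scaling by c places the form of 1 - M/c between 0 and that of the identity; the
    summand 1 keeps c positive for M = 0.\<close>
  define c where "c = norm M + 1"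
  have c: "c > 0" by (simp add: c_def add_nonneg_pos)
  define A where "A = id_blinfun - (1/c) *\<^sub>R M"
  have A: "A x = x - (1/c) *\<^sub>R M x" for x
    by (simp add: A_def blinfun.diff_left blinfun.scaleR_left)
  have Mle: "inner (M x) x \<le> c * inner x x" for x
  proof -
    have "inner (M x) x \<le> norm (M x) * norm x" by (rule norm_cauchy_schwarz)
    also have "\<dots> \<le> norm M * norm x * norm x" by (intro mult_right_mono norm_blinfun) simp
    also have "\<dots> \<le> c * (norm x * norm x)" by (simp add: c_def algebra_simps)
    finally show ?thesis by (simp add: power2_norm_eq_inner[symmetric] power2_eq_square)
  qed
  have Asym: "inner (A x) y = inner x (A y)" for x y by (simp add: A inner_simps sym)
  have nA: "norm A \<le> 1"
  proof (rule positive_symmetric_norm_le_1[OF Asym])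
    show "0 \<le> inner (A x) x" for x using Mle[of x] c by (simp add: A inner_simps field_simps)
    show "inner (A x) x \<le> inner x x" for x using pos[of x] c by (simp add: A inner_simps)
  qed
  obtain B where B: "sqrt_iter A \<longlonglongrightarrow> B" using sqrt_iter_convergent[OF nA] by blast
  have Bx: "(\<lambda>n. sqrt_iter A n x) \<longlonglongrightarrow> B x" for x by (intro tendsto_intros B)
  have "(\<lambda>n. (1/2) *\<^sub>R (A + (sqrt_iter A n o\<^sub>L sqrt_iter A n))) \<longlonglongrightarrow> (1/2) *\<^sub>R (A + (B o\<^sub>L B))"
    by (intro tendsto_intros B bounded_bilinear.tendsto[OF bounded_bilinear_blinfun_compose])
  then have "(\<lambda>n. sqrt_iter A (Suc n)) \<longlonglongrightarrow> (1/2) *\<^sub>R (A + (B o\<^sub>L B))" by simp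
  then have B1: "B = (1/2) *\<^sub>R (A + (B o\<^sub>L B))"
    using LIMSEQ_unique[OF LIMSEQ_Suc[OF B]] by blast
  have B2: "2 *\<^sub>R B = A + (B o\<^sub>L B)" by (subst B1) simp
  have BB: "B (B x) = 2 *\<^sub>R B x - A x" for x
    using arg_cong[OF B2, of "\<lambda>T. blinfun_apply T x"] by (simp add: blinfun.add_left blinfun.scaleR_left)
  have nB: "norm B \<le> 1"
    by (rule LIMSEQ_le_const2[OF tendsto_norm[OF B]])
       (meson sqrt_iter_bounds(1)[OF nA] sqrt_majorant_bounds order_trans)
  have Bsym: "inner (B x) y = inner x (B y)" for x y
  proof -
    have "inner (sqrt_iter A n x) y = inner x (sqrt_iter A n y)" for n x y
      by (induction n arbitrary: x y)
         (simp_all add: blinfun.add_left blinfun.scaleR_left inner_simps Asym)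
    then have "(\<lambda>n. inner (sqrt_iter A n x) y) \<longlonglongrightarrow> inner x (B y)"
      by (simp add: tendsto_inner[OF tendsto_const Bx])
    then show ?thesis using LIMSEQ_unique[OF tendsto_inner[OF Bx tendsto_const]] by blast
  qed
  define R where "R = sqrt c *\<^sub>R (id_blinfun - B)"
  have R: "R x = sqrt c *\<^sub>R (x - B x)" for x
    by (simp add: R_def blinfun.diff_left blinfun.scaleR_left)
  show ?thesis
  proof (intro exI[of _ R] conjI allI impI)
    show "inner (R x) y = inner x (R y)" for x y by (simp add: R inner_simps Bsym)
    show "0 \<le> inner (R x) x" for x
    proof -
      have "inner (B x) x \<le> norm (B x) * norm x" by (rule norm_cauchy_schwarz)
      also have "\<dots> \<le> 1 * norm x * norm x"
        by (intro mult_right_mono order_trans[OF norm_blinfun]) (use nB in \<open>auto simp: mult_right_mono\<close>)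
      finally have "inner (B x) x \<le> inner x x" by (simp add: power2_norm_eq_inner[symmetric] power2_eq_square)
      then show ?thesis using c by (simp add: R inner_simps)
    qed
    show "R (R x) = M x" for x
    proof -
      have "R (R x) = (sqrt c * sqrt c) *\<^sub>R (x - 2 *\<^sub>R B x + B (B x))"
        by (simp add: R blinfun.scaleR_right blinfun.diff_right scaleR_diff_right scaleR_2 algebra_simps)
      also have "\<dots> = c *\<^sub>R ((1/c) *\<^sub>R M x)" using c by (simp add: BB A)
      finally show ?thesis using c by simp
    qed
    fix C :: "'a \<Rightarrow>\<^sub>L 'a" and x
    assume comm: "\<forall>x. C (M x) = M (C x)"
    have AC: "C (A x) = A (C x)" for x
      by (simp add: A blinfun.diff_right blinfun.scaleR_right comm)
    have "C (sqrt_iter A n x) = sqrt_iter A n (C x)" for n x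
      by (induction n arbitrary: x)
         (simp_all add: blinfun.add_left blinfun.scaleR_left blinfun.add_right blinfun.scaleR_right AC)
    then have "(\<lambda>n. sqrt_iter A n (C x)) \<longlonglongrightarrow> C (B x)"
      using blinfun.tendsto[OF tendsto_const Bx[of x], of C] by simp
    then have "C (B x) = B (C x)" using LIMSEQ_unique Bx by blast
    then show "C (R x) = R (C x)" by (simp add: R blinfun.diff_right blinfun.scaleR_right)
  qed
qed

text \<open>\<open>W\<close> is the adjoint of the partial isometry in the polar decomposition \<open>X = U P\<close>. Its value at \<open>g\<close> is
  the limit of \<open>P (y n)\<close> when \<open>X (y n)\<close> tends to the projection of \<open>g\<close> onto the closed range of \<open>X\<close>.\<close>
lemma polar_coisometry:
  fixes X P :: "'a::{real_inner,banach} \<Rightarrow>\<^sub>L 'a"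
  assumes XP: "\<And>f g. inner (P f) (P g) = inner (X f) (X g)"
  shows "\<exists>W :: 'a \<Rightarrow>\<^sub>L 'a. (\<forall>g. norm (blinfun_apply W g) \<le> norm g) \<and> (\<forall>x. blinfun_apply W (X x) = P x) \<and>
    (\<forall>x g. inner (P x) (blinfun_apply W g) = inner (X x) g) \<and>
    (\<forall>J :: 'a \<Rightarrow>\<^sub>L 'a. (\<forall>x y. inner (J x) y = - inner x (J y)) \<and> (\<forall>x. J (X x) = X (J x)) \<and> (\<forall>x. J (P x) = P (J x))
       \<longrightarrow> (\<forall>x. J (W x) = W (J x)))"
proof -
  define V where "V = closure (range P)"
  have sub: "subspace (range (blinfun_apply T))" for T :: "'a \<Rightarrow>\<^sub>L 'a"
    by (intro linear_subspace_image subspace_UNIV bounded_linear.linear blinfun.bounded_linear_right)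
  have sV: "subspace V" "closed V" unfolding V_def by (auto intro: subspace_closure sub)
  have iso: "norm (P x - P y) = norm (X x - X y)" for x y
    using XP[of "x - y" "x - y"] by (simp add: blinfun.diff_right norm_eq_sqrt_inner)
  have "\<exists>w\<in>V. norm w \<le> norm g \<and> (\<forall>x. inner (P x) w = inner (X x) g)" for g
  proof -
    obtain p where p: "p \<in> closure (range X)" "\<And>v. v \<in> closure (range X) \<Longrightarrow> inner (g - p) v = 0"
      using closed_subspace_projection[OF subspace_closure[OF sub[of X]] closed_closure, of g] by blast
    obtain xs where xs: "\<And>n. xs n \<in> range X" "xs \<longlonglongrightarrow> p"
      using p(1) unfolding closure_sequential by blast
    then have "\<exists>y. \<forall>n. xs n = X (y n)" by (intro choice) auto
    then obtain y where y: "\<And>n. xs n = X (y n)" by blast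
    have Xy: "(\<lambda>n. X (y n)) \<longlonglongrightarrow> p" using xs(2) by (simp add: y[symmetric])
    have "Cauchy (\<lambda>n. X (y n))" using Xy by (rule LIMSEQ_imp_Cauchy)
    then have "Cauchy (\<lambda>n. P (y n))" by (simp add: Cauchy_def dist_norm iso)
    then obtain w where w: "(\<lambda>n. P (y n)) \<longlonglongrightarrow> w" using Cauchy_convergent convergent_def by blast
    have "w \<in> V" unfolding V_def closure_sequential
      by (rule exI[of _ "\<lambda>n. P (y n)"]) (simp add: w)
    moreover have "inner (P x) w = inner (X x) g" for x
    proof -
      have "(\<lambda>n. inner (P x) (P (y n))) \<longlonglongrightarrow> inner (P x) w" by (intro tendsto_intros w)
      moreover have "(\<lambda>n. inner (P x) (P (y n))) \<longlonglongrightarrow> inner (X x) p" unfolding XP by (intro tendsto_intros Xy)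
      ultimately have "inner (P x) w = inner (X x) p" by (rule LIMSEQ_unique)
      moreover have "inner (g - p) (X x) = 0" by (intro p(2) subsetD[OF closure_subset]) simp
      ultimately show ?thesis by (simp add: inner_simps inner_commute)
    qed
    moreover have "norm w \<le> norm g"
    proof -
      have "(\<lambda>n. norm (P (y n))) \<longlonglongrightarrow> norm p"
        using iso[of _ 0] tendsto_norm[OF Xy] by (simp add: blinfun.zero_right)
      then have "norm w = norm p" using LIMSEQ_unique[OF tendsto_norm[OF w]] by blast
      moreover have "norm p * norm p \<le> norm g * norm p"
      proof -
        have "inner p p = inner g p" using p(2)[OF p(1)] by (simp add: inner_simps)
        then show ?thesis using norm_cauchy_schwarz[of g p] by (simp add: power2_norm_eq_inner[symmetric] power2_eq_square)
      qed
      ultimately show ?thesis by (cases "p = 0") auto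
    qed
    ultimately show ?thesis by blast
  qed
  then obtain w where w: "\<And>g. w g \<in> V" "\<And>g. norm (w g) \<le> norm g" "\<And>g x. inner (P x) (w g) = inner (X x) g"
    by metis
  \<comment> \<open>An element of V orthogonal to the range of P is orthogonal to itself. Linearity
    of w, its values on the range of X and its commutation with J are all checked through pairings
    with that range.\<close>
  have uniq: "a = b" if "a \<in> V" "b \<in> V" "\<And>x. inner (P x) a = inner (P x) b" for a b
  proof -
    have d: "a - b \<in> V" using that sV by (simp add: subspace_diff)
    have "closed {v. inner v (a - b) = 0}" by (intro closed_Collect_eq continuous_intros)
    moreover have "range P \<subseteq> {v. inner v (a - b) = 0}" using that(3) by (auto simp: inner_simps)
    ultimately have "V \<subseteq> {v. inner v (a - b) = 0}" unfolding V_def by (rule closure_minimal[rotated])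
    then show ?thesis using d by auto
  qed
  have "bounded_linear w"
  proof (rule bounded_linear_intro[where K=1])
    show "w (a + b) = w a + w b" for a b
      by (rule uniq) (simp_all add: w subspace_add[OF sV(1)] inner_simps)
    show "w (r *\<^sub>R a) = r *\<^sub>R w a" for r a
      by (rule uniq) (simp_all add: w subspace_scale[OF sV(1)] inner_simps)
  qed (simp add: w)
  then have W: "Blinfun w x = w x" for x by (simp add: bounded_linear_Blinfun_apply)
  have wX: "w (X x) = P x" for x
  proof (rule uniq)
    show "P x \<in> V" unfolding V_def by (intro subsetD[OF closure_subset]) simp
  qed (simp_all add: w XP)
  \<comment> \<open>J plays the role of multiplication by i, which is skew for the real inner
    product. It is moved across the pairing with P, past P and X, and back.\<close>
  have JW: "J (w x) = w (J x)" if J: "\<forall>x y. inner (J x) y = - inner x (J y)" "\<forall>x. J (X x) = X (J x)"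
     "\<forall>x. J (P x) = P (J x)" for J :: "'a \<Rightarrow>\<^sub>L 'a" and x
  proof (rule uniq)
    have "J ` range P \<subseteq> range P" using J(3) by auto
    moreover have "J ` closure (range P) \<subseteq> closure (J ` range P)"
      by (rule continuous_image_closure_subset[of UNIV])
         (auto intro: linear_continuous_on blinfun.bounded_linear_right)
    ultimately have "J ` V \<subseteq> V" using closure_mono[of "J ` range P" "range P"] unfolding V_def by blast
    then show "J (w x) \<in> V" using w(1)[of x] by blast
    fix y
    have "inner (P y) (J (w x)) = - inner (P (J y)) (w x)" using J(1)[rule_format, of "P y" "w x"] J(3) by simp
    also have "\<dots> = inner (X y) (J x)" using J(1)[rule_format, of "X y" x] J(2) by (simp add: w)
    finally show "inner (P y) (J (w x)) = inner (P y) (w (J x))" by (simp add: w)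
  qed (rule w)
  show ?thesis
  proof (intro exI[of _ "Blinfun w"] conjI allI impI, goal_cases)
    case (4 J x)
    then show ?case unfolding W by (intro JW) auto
  qed (simp_all add: W w wX)
qed

subsection \<open>The Hilbert space of square-integrable functions modulo null sets\<close>

lemma borel_measurable_cnj [measurable (raw)]:
  "f \<in> borel_measurable M \<Longrightarrow> (\<lambda>x. cnj (f x)) \<in> borel_measurable M"
  by (rule measurable_compose[where N=borel]) (auto intro!: borel_measurable_continuous_onI continuous_intros)

lemma L2_measurable [measurable_dest]: "f \<in> L2 \<Longrightarrow> f \<in> borel_measurable borel"
  by (simp add: L2_def)

lemma L2_integrable: "f \<in> L2 \<Longrightarrow> integrable lborel (\<lambda>t. (cmod (f t))\<^sup>2)"
  by (simp add: L2_def)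

lemma L2I: "f \<in> borel_measurable borel \<Longrightarrow> integrable lborel (\<lambda>t. (cmod (f t))\<^sup>2) \<Longrightarrow> f \<in> L2"
  by (simp add: L2_def)

lemma L2_bound:
  assumes "f \<in> borel_measurable borel" "integrable lborel h" "\<And>t. (cmod (f t))\<^sup>2 \<le> h t"
  shows "f \<in> L2"
  by (rule L2I[OF assms(1)], rule Bochner_Integration.integrable_bound[OF assms(2)])
     (use assms in \<open>auto intro: order_trans[OF _ abs_ge_self]\<close>)

lemma L2_scale: "f \<in> L2 \<Longrightarrow> (\<lambda>t. a * f t) \<in> L2"
  by (rule L2_bound[where h="\<lambda>t. (cmod a)\<^sup>2 * (cmod (f t))\<^sup>2"])
     (auto simp: norm_mult power_mult_distrib intro!: L2_integrable dest: L2_measurable)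

lemma L2_add:
  assumes "f \<in> L2" "g \<in> L2" shows "(\<lambda>t. f t + g t) \<in> L2"
proof (rule L2_bound[where h="\<lambda>t. 2 * (cmod (f t))\<^sup>2 + 2 * (cmod (g t))\<^sup>2"])
  fix t
  have "(cmod (f t + g t))\<^sup>2 \<le> (cmod (f t) + cmod (g t))\<^sup>2" by (simp add: norm_triangle_ineq power_mono)
  also have "\<dots> \<le> 2 * (cmod (f t))\<^sup>2 + 2 * (cmod (g t))\<^sup>2"
    using sum_squares_bound[of "cmod (f t)" "cmod (g t)"] by (simp add: power2_sum)
  finally show "(cmod (f t + g t))\<^sup>2 \<le> 2 * (cmod (f t))\<^sup>2 + 2 * (cmod (g t))\<^sup>2" .
qed (use assms in \<open>auto intro!: L2_integrable dest: L2_measurable\<close>)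

lemma L2_zero: "(\<lambda>t. 0) \<in> L2" by (simp add: L2_def)

lemma L2_scaleR: "f \<in> L2 \<Longrightarrow> (\<lambda>t. r *\<^sub>R f t) \<in> L2"
  using L2_scale[of f "complex_of_real r"] by (simp add: scaleR_conv_of_real)

lemma L2_uminus: "f \<in> L2 \<Longrightarrow> (\<lambda>t. - f t) \<in> L2"
  using L2_scale[of f "-1"] by simp

lemma L2_diff: "f \<in> L2 \<Longrightarrow> g \<in> L2 \<Longrightarrow> (\<lambda>t. f t - g t) \<in> L2"
  using L2_add[of f "\<lambda>t. - g t"] by (simp add: L2_uminus)

lemma L2_mult_integrable:
  assumes "f \<in> L2" "g \<in> L2" shows "integrable lborel (\<lambda>t. f t * cnj (g t))"
proof (rule Bochner_Integration.integrable_bound[where f="\<lambda>t. (cmod (f t))\<^sup>2 + (cmod (g t))\<^sup>2"])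
  show "AE t in lborel. norm (f t * cnj (g t)) \<le> norm ((cmod (f t))\<^sup>2 + (cmod (g t))\<^sup>2)"
  proof (rule AE_I2)
    fix t
    show "norm (f t * cnj (g t)) \<le> norm ((cmod (f t))\<^sup>2 + (cmod (g t))\<^sup>2)"
      using sum_squares_bound[of "cmod (f t)" "cmod (g t)"]
        mult_nonneg_nonneg[of "cmod (f t)" "cmod (g t)"]
      by (simp add: norm_mult del: mult_nonneg_nonneg)
  qed
qed (use assms in \<open>auto intro!: L2_integrable borel_measurable_times borel_measurable_cnj dest: L2_measurable\<close>)

lemma ip_cong_aeq:
  assumes "f \<in> L2" "f' \<in> L2" "g \<in> L2" "g' \<in> L2" "aeq f f'" "aeq g g'"
  shows "ip f g = ip f' g'"
  unfolding ip_def
proof (rule integral_cong_AE)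
  show "AE t in lborel. f t * cnj (g t) = f' t * cnj (g' t)"
    using assms(5,6) unfolding aeq_def by eventually_elim simp
qed (use assms in \<open>auto intro!: borel_measurable_times borel_measurable_cnj dest: L2_measurable\<close>)

lemma ip_add_left: "f \<in> L2 \<Longrightarrow> g \<in> L2 \<Longrightarrow> h \<in> L2 \<Longrightarrow> ip (\<lambda>t. f t + g t) h = ip f h + ip g h"
  by (simp add: ip_def distrib_right L2_mult_integrable)

lemma ip_scale_left: "ip (\<lambda>t. a * f t) h = a * ip f h"
  by (simp add: ip_def mult.assoc)

lemma ip_commute: "ip g f = cnj (ip f g)"
proof -
  have "ip g f = (\<integral>t. cnj (f t * cnj (g t)) \<partial>lborel)"
    unfolding ip_def by (rule Bochner_Integration.integral_cong) simp_all
  also have "\<dots> = cnj (ip f g)" unfolding ip_def by (rule Bochner_Integration.integral_cnj)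
  finally show ?thesis .
qed

lemma ip_self: "ip f f = complex_of_real (\<integral>t. (cmod (f t))\<^sup>2 \<partial>lborel)"
  unfolding ip_def by (simp add: complex_norm_square[symmetric] del: of_real_power)

\<comment> \<open>A partial quotient: functions outside \<open>L2\<close> are not related even to
  themselves, so the type consists exactly of the a.e. classes of square-integrable functions and
  can carry the Hilbert space structure as class instances.\<close>
quotient_type l2 = "real \<Rightarrow> complex" / partial: "\<lambda>f g. f \<in> L2 \<and> g \<in> L2 \<and> aeq f g"
proof (rule part_equivpI)
  show "\<exists>f. f \<in> L2 \<and> f \<in> L2 \<and> aeq f f" by (intro exI[of _ "\<lambda>_. 0"]) (simp add: L2_zero aeq_def)
  show "symp (\<lambda>f g. f \<in> L2 \<and> g \<in> L2 \<and> aeq f g)"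
    by (auto intro!: sympI simp: aeq_def elim: eventually_mono)
  show "transp (\<lambda>f g. f \<in> L2 \<and> g \<in> L2 \<and> aeq f g)"
    by (auto intro!: transpI simp: aeq_def elim: eventually_elim2)
qed

lemma rep_l2_L2 [simp]: "rep_l2 F \<in> L2"
  using Quotient3_rep_reflp[OF Quotient3_l2] by blast

lemma abs_rep_l2 [simp]: "abs_l2 (rep_l2 F) = F"
  by (rule Quotient3_abs_rep[OF Quotient3_l2])

lemma abs_l2_eq_iff: "f \<in> L2 \<Longrightarrow> g \<in> L2 \<Longrightarrow> abs_l2 f = abs_l2 g \<longleftrightarrow> aeq f g"
  using Quotient3_rel[OF Quotient3_l2, of f g] by (auto simp: aeq_def)

lemma aeq_rep_abs: "f \<in> L2 \<Longrightarrow> aeq (rep_l2 (abs_l2 f)) f"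
  by (simp flip: abs_l2_eq_iff)

lemma abs_l2_cases: obtains f where "f \<in> L2" "F = abs_l2 f"
  using that[of "rep_l2 F"] by simp

instantiation l2 :: real_vector
begin

lift_definition zero_l2 :: l2 is "\<lambda>_. 0" by (simp add: L2_zero aeq_def)

lift_definition plus_l2 :: "l2 \<Rightarrow> l2 \<Rightarrow> l2" is "\<lambda>f g t. f t + g t"
  by (auto simp: L2_add aeq_def)

lift_definition minus_l2 :: "l2 \<Rightarrow> l2 \<Rightarrow> l2" is "\<lambda>f g t. f t - g t"
  by (auto simp: L2_diff aeq_def)

lift_definition uminus_l2 :: "l2 \<Rightarrow> l2" is "\<lambda>f t. - f t"
  by (auto simp: L2_uminus aeq_def)

lift_definition scaleR_l2 :: "real \<Rightarrow> l2 \<Rightarrow> l2" is "\<lambda>r f t. r *\<^sub>R f t"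
  by (auto simp: L2_scaleR aeq_def)

instance
  by standard (transfer, auto simp: aeq_def L2_add L2_zero L2_scaleR L2_diff L2_uminus algebra_simps)+

end

lift_definition cscale :: "complex \<Rightarrow> l2 \<Rightarrow> l2" is "\<lambda>a f t. a * f t"
  by (auto simp: L2_scale aeq_def)

lift_definition cinner :: "l2 \<Rightarrow> l2 \<Rightarrow> complex" is ip
  by (auto intro: ip_cong_aeq)

lemma cinner_add_left: "cinner (F + G) H = cinner F H + cinner G H"
  by transfer (simp add: ip_add_left)

lemma cinner_cscale_left: "cinner (cscale a F) H = a * cinner F H"
  by transfer (simp add: ip_scale_left)

lemma cinner_commute: "cinner G F = cnj (cinner F G)"
  by transfer (rule ip_commute)

lemma scaleR_eq_cscale: "r *\<^sub>R F = cscale (of_real r) F"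
  by transfer (simp add: scaleR_conv_of_real L2_scale aeq_def)

lemma cinner_self_real: "Im (cinner F F) = 0" and cinner_self_nonneg: "0 \<le> Re (cinner F F)"
  by (transfer, simp add: ip_self)+

lemma cinner_eq_zero_iff: "cinner F F = 0 \<longleftrightarrow> F = 0"
proof transfer
  fix f assume "f \<in> L2 \<and> f \<in> L2 \<and> aeq f f"
  then have f: "f \<in> L2" by simp
  have "ip f f = 0 \<longleftrightarrow> (AE t in lborel. (cmod (f t))\<^sup>2 = 0)"
    using integral_nonneg_eq_0_iff_AE[OF L2_integrable[OF f]] by (simp add: ip_self)
  then show "ip f f = 0 \<longleftrightarrow> (f \<in> L2 \<and> (\<lambda>_. 0) \<in> L2 \<and> aeq f (\<lambda>_. 0))"
    using f by (simp add: aeq_def L2_zero)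
qed

text \<open>The class instance only sees the real Hilbert space with inner product \<open>Re (cinner F G)\<close>;
  complex linearity of an operator is imposed separately, as commutation with \<open>cscale\<close>.\<close>
instantiation l2 :: real_inner
begin

definition inner_l2 :: "l2 \<Rightarrow> l2 \<Rightarrow> real" where "inner_l2 F G = Re (cinner F G)"
definition norm_l2 :: "l2 \<Rightarrow> real" where "norm_l2 F = sqrt (inner F F)"
definition dist_l2 :: "l2 \<Rightarrow> l2 \<Rightarrow> real" where "dist_l2 F G = norm (F - G)"
definition sgn_l2 :: "l2 \<Rightarrow> l2" where "sgn_l2 F = inverse (norm F) *\<^sub>R F"
definition uniformity_l2 :: "(l2 \<times> l2) filter" where
  "uniformity_l2 = (INF e\<in>{0<..}. principal {(F, G). dist F G < e})"
definition open_l2 :: "l2 set \<Rightarrow> bool" where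
  "open_l2 U = (\<forall>F\<in>U. \<forall>\<^sub>F (F', G) in uniformity. F' = F \<longrightarrow> G \<in> U)"

instance
proof
  fix F G H :: l2 and r :: real and U :: "l2 set"
  show "dist F G = norm (F - G)" by (rule dist_l2_def)
  show "sgn F = inverse (norm F) *\<^sub>R F" by (rule sgn_l2_def)
  show "(uniformity :: (l2 \<times> l2) filter) = (INF e\<in>{0<..}. principal {(F, G). dist F G < e})"
    by (rule uniformity_l2_def)
  show "open U = (\<forall>F\<in>U. \<forall>\<^sub>F (F', G) in uniformity. F' = F \<longrightarrow> G \<in> U)" by (rule open_l2_def)
  show "inner F G = inner G F"
    unfolding inner_l2_def by (subst cinner_commute) simp
  show "inner (F + G) H = inner F H + inner G H" by (simp add: inner_l2_def cinner_add_left)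
  show "inner (r *\<^sub>R F) G = r * inner F G" by (simp add: inner_l2_def scaleR_eq_cscale cinner_cscale_left)
  show "0 \<le> inner F F" by (simp add: inner_l2_def cinner_self_nonneg)
  show "inner F F = 0 \<longleftrightarrow> F = 0"
    unfolding inner_l2_def cinner_eq_zero_iff[symmetric] by (simp add: complex_eq_iff cinner_self_real)
  show "norm F = sqrt (inner F F)" by (rule norm_l2_def)
qed

end

lemma l2_abs_simps:
  "f \<in> L2 \<Longrightarrow> g \<in> L2 \<Longrightarrow> abs_l2 f + abs_l2 g = abs_l2 (\<lambda>t. f t + g t)"
  "f \<in> L2 \<Longrightarrow> g \<in> L2 \<Longrightarrow> abs_l2 f - abs_l2 g = abs_l2 (\<lambda>t. f t - g t)"
  "f \<in> L2 \<Longrightarrow> cscale a (abs_l2 f) = abs_l2 (\<lambda>t. a * f t)"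
  "f \<in> L2 \<Longrightarrow> g \<in> L2 \<Longrightarrow> cinner (abs_l2 f) (abs_l2 g) = ip f g"
  by (simp_all add: plus_l2.abs_eq minus_l2.abs_eq cscale.abs_eq cinner.abs_eq aeq_def)

lemma norm_abs_l2: "f \<in> L2 \<Longrightarrow> (norm (abs_l2 f))\<^sup>2 = (\<integral>t. (cmod (f t))\<^sup>2 \<partial>lborel)"
  by (simp add: power2_norm_eq_inner inner_l2_def l2_abs_simps ip_self)

lemma l2norm_eq_norm: "f \<in> L2 \<Longrightarrow> l2norm f = norm (abs_l2 f)"
  by (simp add: l2norm_def flip: norm_abs_l2)

lemma nn_integral_norm_l2:
  "f \<in> L2 \<Longrightarrow> (\<integral>\<^sup>+ t. ennreal ((cmod (f t))\<^sup>2) \<partial>lborel) = ennreal ((norm (abs_l2 f))\<^sup>2)"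
  by (simp add: norm_abs_l2 nn_integral_eq_integral L2_integrable)

text \<open>Riesz-Fischer: a subsequence with geometrically small increments converges almost
  everywhere, and Fatou identifies its pointwise limit as the limit in norm.\<close>

instance l2 :: banach
proof
  fix X :: "nat \<Rightarrow> l2" assume "Cauchy X"
  then have "\<exists>N. \<forall>m\<ge>N. \<forall>n\<ge>N. norm (X m - X n) < (1/2)^k" for k :: nat
    using CauchyD[of X "(1/2)^k"] by simp
  then obtain N where N: "\<And>k m n. m \<ge> N k \<Longrightarrow> n \<ge> N k \<Longrightarrow> norm (X m - X n) < (1/2)^k"
    by metis
  \<comment> \<open>The sum dominates every \<open>N i\<close> with i at most k, so all later
    indices stay beyond \<open>N k\<close>.\<close>
  define r where "r k = sum N {..k}" for k
  have r: "N k \<le> r j" if "k \<le> j" for k j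
    unfolding r_def using that by (intro member_le_sum) auto
  define f where "f k = rep_l2 (X (r k))" for k
  have f: "f k \<in> L2" "abs_l2 (f k) = X (r k)" for k by (simp_all add: f_def)
  have fm [measurable]: "f k \<in> borel_measurable borel" for k using f(1) by (rule L2_measurable)
  define d where "d k t = f (Suc k) t - f k t" for k t
  have dL: "d k \<in> L2" for k unfolding d_def by (intro L2_diff f)
  have dm [measurable]: "d k \<in> borel_measurable borel" for k using dL by (rule L2_measurable)
  have dnorm: "(norm (abs_l2 (d k)))\<^sup>2 \<le> (1/4)^k" for k
  proof -
    have "abs_l2 (d k) = X (r (Suc k)) - X (r k)"
      unfolding d_def by (simp add: f flip: l2_abs_simps)
    then have "norm (abs_l2 (d k)) \<le> (1/2)^k"
      using N[of k "r (Suc k)" "r k"] r[of k "Suc k"] r[of k k] by simp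
    then have "(norm (abs_l2 (d k)))\<^sup>2 \<le> ((1/2)^k)\<^sup>2" by (intro power_mono) auto
    also have "\<dots> = (1/4)^k" by (simp add: power2_eq_square flip: power_mult_distrib)
    finally show ?thesis .
  qed
  have "(\<integral>\<^sup>+ t. (\<Sum>k. ennreal (2^k * (cmod (d k t))\<^sup>2)) \<partial>lborel)
      = (\<Sum>k. \<integral>\<^sup>+ t. ennreal (2^k * (cmod (d k t))\<^sup>2) \<partial>lborel)"
    by (rule nn_integral_suminf) simp
  also have "\<dots> = (\<Sum>k. ennreal (2^k * (norm (abs_l2 (d k)))\<^sup>2))"
  proof (rule suminf_cong)
    fix k
    have "(\<integral>\<^sup>+ t. ennreal (2^k * (cmod (d k t))\<^sup>2) \<partial>lborel) = (\<integral>\<^sup>+ t. ennreal (2^k) * ennreal ((cmod (d k t))\<^sup>2) \<partial>lborel)"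
      by (simp add: ennreal_mult)
    also have "\<dots> = ennreal (2^k) * ennreal ((norm (abs_l2 (d k)))\<^sup>2)"
      by (simp add: nn_integral_cmult nn_integral_norm_l2[OF dL])
    finally show "(\<integral>\<^sup>+ t. ennreal (2^k * (cmod (d k t))\<^sup>2) \<partial>lborel) = ennreal (2^k * (norm (abs_l2 (d k)))\<^sup>2)"
      by (simp add: ennreal_mult)
  qed
  also have "\<dots> \<le> (\<Sum>k. ennreal ((1/2)^k))"
  proof (rule suminf_le)
    fix k
    have "2^k * (norm (abs_l2 (d k)))\<^sup>2 \<le> 2^k * (1/4)^k" by (intro mult_left_mono dnorm) simp
    also have "\<dots> = ((1/2)::real)^k" by (simp flip: power_mult_distrib)
    finally show "ennreal (2^k * (norm (abs_l2 (d k)))\<^sup>2) \<le> ennreal ((1/2)^k)" by (rule ennreal_leI)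
  qed auto
  also have "\<dots> < \<infinity>"
    by (simp add: suminf_ennreal2 complete_algebra_summable_geometric less_top)
  finally have "(\<integral>\<^sup>+ t. (\<Sum>k. ennreal (2^k * (cmod (d k t))\<^sup>2)) \<partial>lborel) \<noteq> \<infinity>" by simp
  then have "AE t in lborel. (\<Sum>k. ennreal (2^k * (cmod (d k t))\<^sup>2)) \<noteq> \<infinity>"
    by (intro nn_integral_PInf_AE) auto
  then have conv: "AE t in lborel. convergent (\<lambda>k. f k t)"
  proof eventually_elim
    fix t assume "(\<Sum>k. ennreal (2^k * (cmod (d k t))\<^sup>2)) \<noteq> \<infinity>"
    then have s1: "summable (\<lambda>k. 2^k * (cmod (d k t))\<^sup>2)"
      by (intro summable_suminf_not_top) (auto simp: top_ennreal_def)
    \<comment> \<open>From a \<le> 1 + a^2 with a = 2^k |d| one gets |d| \<le> 2^-k + 2^k |d|^2.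
      This is why the integrated series carries the weight 2^k, for which the squares of the norms
      are still summable.\<close>
    have "summable (\<lambda>k. cmod (d k t))"
    proof (rule summable_comparison_test'[where N=0])
      show "summable (\<lambda>k. (1/2)^k + 2^k * (cmod (d k t))\<^sup>2)"
        by (intro summable_add s1 complete_algebra_summable_geometric) auto
      show "norm (cmod (d k t)) \<le> (1/2)^k + 2^k * (cmod (d k t))\<^sup>2" for k
      proof -
        define a where "a = (2::real)^k * cmod (d k t)"
        have "a \<le> 1 + a\<^sup>2" using zero_le_power2[of "a - 1/2"] by (simp add: power2_eq_square algebra_simps)
        then have "(1/2)^k * a \<le> (1/2)^k * (1 + a\<^sup>2)" by (intro mult_left_mono) auto
        moreover have "(1/2)^k * a = cmod (d k t)" by (simp add: a_def power_one_over)
        moreover have "(1/2)^k * (1 + a\<^sup>2) = (1/2)^k + 2^k * (cmod (d k t))\<^sup>2"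
          by (simp add: a_def power_one_over power2_eq_square distrib_left)
        ultimately show ?thesis by simp
      qed
    qed
    then have "summable (\<lambda>k. d k t)" by (rule summable_norm_cancel)
    then have "convergent (\<lambda>n. \<Sum>k<n. d k t)" by (simp add: summable_iff_convergent)
    then have "convergent (\<lambda>n. f n t - f 0 t)"
      by (simp add: d_def sum_lessThan_telescope[of "\<lambda>n. f n t"])
    then show "convergent (\<lambda>k. f k t)" by (simp add: convergent_diff_const_right_iff)
  qed
  define g where "g t = lim (\<lambda>k. f k t)" for t
  have gm [measurable]: "g \<in> borel_measurable borel" unfolding g_def by (rule borel_measurable_lim_metric) simp
  have gl: "AE t in lborel. (\<lambda>k. f k t) \<longlonglongrightarrow> g t"
    using conv unfolding g_def by eventually_elim (simp add: convergent_LIMSEQ_iff)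
  \<comment> \<open>Fatou along the subsequence with m fixed. It yields the rate and, through the
    difference with \<open>X m\<close>, the square integrability of g.\<close>
  have key: "(\<lambda>t. rep_l2 (X m) t - g t) \<in> L2 \<and> norm (abs_l2 (\<lambda>t. rep_l2 (X m) t - g t)) \<le> (1/2)^k"
    if m: "m \<ge> N k" for m k
  proof -
    have [measurable]: "rep_l2 (X m) \<in> borel_measurable borel" by (rule L2_measurable) simp
    have "(\<integral>\<^sup>+ t. ennreal ((cmod (rep_l2 (X m) t - g t))\<^sup>2) \<partial>lborel)
       \<le> (\<integral>\<^sup>+ t. liminf (\<lambda>j. ennreal ((cmod (rep_l2 (X m) t - f j t))\<^sup>2)) \<partial>lborel)"
    proof (rule nn_integral_mono_AE, use gl in eventually_elim)
      fix t assume "(\<lambda>k. f k t) \<longlonglongrightarrow> g t"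
      then have "(\<lambda>j. ennreal ((cmod (rep_l2 (X m) t - f j t))\<^sup>2)) \<longlonglongrightarrow> ennreal ((cmod (rep_l2 (X m) t - g t))\<^sup>2)"
        by (intro tendsto_intros)
      then show "ennreal ((cmod (rep_l2 (X m) t - g t))\<^sup>2) \<le> liminf (\<lambda>j. ennreal ((cmod (rep_l2 (X m) t - f j t))\<^sup>2))"
        by (simp only: lim_imp_Liminf[OF sequentially_bot] order_refl)
    qed
    also have "\<dots> \<le> liminf (\<lambda>j. \<integral>\<^sup>+ t. ennreal ((cmod (rep_l2 (X m) t - f j t))\<^sup>2) \<partial>lborel)"
      by (rule nn_integral_liminf) simp
    also have "\<dots> \<le> ennreal (((1/2)^k)\<^sup>2)"
    proof (rule Liminf_le)
      show "eventually (\<lambda>j. (\<integral>\<^sup>+ t. ennreal ((cmod (rep_l2 (X m) t - f j t))\<^sup>2) \<partial>lborel) \<le> ennreal (((1/2)^k)\<^sup>2)) sequentially"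
        using eventually_ge_at_top[of k]
      proof eventually_elim
        fix j assume "j \<ge> k"
        have "abs_l2 (\<lambda>t. rep_l2 (X m) t - f j t) = X m - X (r j)"
          by (simp add: f flip: l2_abs_simps)
        then have "norm (abs_l2 (\<lambda>t. rep_l2 (X m) t - f j t)) \<le> (1/2)^k"
          using N[OF m r[OF \<open>j \<ge> k\<close>]] by simp
        then show "(\<integral>\<^sup>+ t. ennreal ((cmod (rep_l2 (X m) t - f j t))\<^sup>2) \<partial>lborel) \<le> ennreal (((1/2)^k)\<^sup>2)"
          by (subst nn_integral_norm_l2) (auto intro!: L2_diff f ennreal_leI power_mono)
      qed
    qed simp
    finally have le: "(\<integral>\<^sup>+ t. ennreal ((cmod (rep_l2 (X m) t - g t))\<^sup>2) \<partial>lborel) \<le> ennreal (((1/2)^k)\<^sup>2)" .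
    have L: "(\<lambda>t. rep_l2 (X m) t - g t) \<in> L2"
    proof (rule L2I)
      show "integrable lborel (\<lambda>t. (cmod (rep_l2 (X m) t - g t))\<^sup>2)"
        by (rule integrableI_nonneg) (use le_less_trans[OF le ennreal_less_top] in simp_all)
    qed simp
    have "ennreal ((norm (abs_l2 (\<lambda>t. rep_l2 (X m) t - g t)))\<^sup>2) \<le> ennreal (((1/2)^k)\<^sup>2)"
      using le by (simp add: nn_integral_norm_l2[OF L])
    then have "(norm (abs_l2 (\<lambda>t. rep_l2 (X m) t - g t)))\<^sup>2 \<le> ((1/2)^k)\<^sup>2"
      by (subst (asm) ennreal_le_iff) simp_all
    then have "norm (abs_l2 (\<lambda>t. rep_l2 (X m) t - g t)) \<le> (1/2)^k"
      by (rule power2_le_imp_le) simp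
    then show ?thesis using L by simp
  qed
  have gL: "g \<in> L2"
    using L2_diff[OF rep_l2_L2[of "X (N 0)"] conjunct1[OF key[OF order_refl[of "N 0"]]]] by simp
  have "X \<longlonglongrightarrow> abs_l2 g"
  proof (rule LIMSEQ_I)
    fix e :: real assume "e > 0"
    then obtain k where k: "(1/2)^k < e" using real_arch_pow_inv[of e "1/2"] by auto
    have "norm (X m - abs_l2 g) < e" if "m \<ge> N k" for m
    proof -
      have "X m - abs_l2 g = abs_l2 (\<lambda>t. rep_l2 (X m) t - g t)"
        using l2_abs_simps(2)[OF rep_l2_L2 gL] by (simp only: abs_rep_l2)
      then show ?thesis using le_less_trans[OF conjunct2[OF key[OF that]] k] by simp
    qed
    then show "\<exists>no. \<forall>n\<ge>no. norm (X n - abs_l2 g) < e" by blast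
  qed
  then show "convergent X" by (rule convergentI)
qed

lemma cscale_simps:
  "cscale a (F + G) = cscale a F + cscale a G" "cscale (a + b) F = cscale a F + cscale b F"
  "cscale a (cscale b F) = cscale (a * b) F" "cscale 1 F = F"
  "cscale a (r *\<^sub>R F) = r *\<^sub>R cscale a F" "cscale a 0 = 0" "cscale 0 F = 0"
  by (transfer, auto simp: L2_scale L2_add L2_scaleR L2_zero aeq_def algebra_simps)+

lemma cinner_add_right: "cinner H (F + G) = cinner H F + cinner H G"
  by (metis cinner_add_left cinner_commute complex_cnj_add)

lemma cinner_cscale_right: "cinner F (cscale a G) = cnj a * cinner F G"
  by (metis cinner_cscale_left cinner_commute complex_cnj_mult)

lemma inner_eq_Re_cinner: "inner F G = Re (cinner F G)"
  by (rule inner_l2_def)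

lemma cinner_eq_inner: "cinner F G = Complex (inner F G) (inner F (cscale \<i> G))"
  by (simp add: inner_eq_Re_cinner cinner_cscale_right complex_eq_iff)

lemma cinner_self: "cinner F F = of_real ((norm F)\<^sup>2)"
  by (simp add: power2_norm_eq_inner inner_eq_Re_cinner complex_eq_iff cinner_self_real)

lemma norm_cscale: "norm (cscale a F) = cmod a * norm F"
proof -
  have "complex_of_real ((norm (cscale a F))\<^sup>2) = of_real ((cmod a * norm F)\<^sup>2)"
    unfolding cinner_self[symmetric] cinner_cscale_left cinner_cscale_right
    using complex_norm_square[of a] by (simp add: cinner_self power_mult_distrib mult.assoc[symmetric])
  then show ?thesis by (simp only: of_real_eq_iff) (simp add: power2_eq_iff_nonneg)
qed

lemma norm_cinner_le: "cmod (cinner F G) \<le> norm F * norm G"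
proof (cases "cinner F G = 0")
  case False
  define a where "a = cnj (cinner F G) / of_real (cmod (cinner F G))"
  have a: "cmod a = 1" using False by (simp add: a_def norm_divide)
  have "cinner (cscale a F) G = of_real (cmod (cinner F G))"
    using False by (simp add: cinner_cscale_left a_def complex_norm_square[symmetric] power2_eq_square mult.commute
        flip: of_real_mult)
      (metis (no_types, lifting) complex_norm_square mult.commute nonzero_mult_div_cancel_right
        norm_eq_zero of_real_eq_0_iff power2_eq_square of_real_mult)
  then have "cmod (cinner F G) = inner (cscale a F) G" by (simp add: inner_eq_Re_cinner)
  also have "\<dots> \<le> norm (cscale a F) * norm G" by (rule norm_cauchy_schwarz)
  finally show ?thesis by (simp add: norm_cscale a)
qed simp

interpretation cinner: bounded_bilinear cinner
proof
  show "\<exists>K. \<forall>a b. cmod (cinner a b) \<le> norm a * norm b * K"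
    by (intro exI[of _ 1]) (simp add: norm_cinner_le)
qed (simp_all add: cinner_add_left cinner_add_right scaleR_eq_cscale cinner_cscale_left cinner_cscale_right
      scaleR_conv_of_real)

lemma bounded_linear_cscale: "bounded_linear (cscale a)"
  by (rule bounded_linear_intro[where K="cmod a"]) (simp_all add: cscale_simps norm_cscale)

lemma cinner_eqI: "(\<And>G. cinner A G = cinner B G) \<Longrightarrow> A = B"
  by (rule inner_left_eqI) (simp add: inner_eq_Re_cinner)

lemma cscale_eq_Re_Im: "cscale a F = Re a *\<^sub>R F + Im a *\<^sub>R cscale \<i> F"
  by (metis complex_eq cscale_simps(2,3) mult.commute scaleR_eq_cscale)

section \<open>Complex-linear operators and their link with the operators of the definitions\<close>

definition clin :: "(l2 \<Rightarrow>\<^sub>L l2) \<Rightarrow> bool" where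
  "clin A \<longleftrightarrow> (\<forall>a F. A (cscale a F) = cscale a (A F))"

definition imul :: "l2 \<Rightarrow>\<^sub>L l2" where "imul = Blinfun (cscale \<i>)"

lemma imul_apply [simp]: "blinfun_apply imul F = cscale \<i> F"
  by (simp add: imul_def bounded_linear_Blinfun_apply bounded_linear_cscale)

text \<open>Real linearity is built into the operator type, so only the factor i is left to check.
  Complex linearity thus becomes commutation with one skew operator, the form in which the square
  root and the polar decomposition preserve it.\<close>

lemma clin_iff_imul: "clin A \<longleftrightarrow> (\<forall>F. imul (A F) = A (imul F))"
proof
  assume *: "\<forall>F. imul (A F) = A (imul F)"
  show "clin A" unfolding clin_def
    by (subst (1 2) cscale_eq_Re_Im) (use * in \<open>simp add: blinfun.add_right blinfun.scaleR_right\<close>)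
qed (simp add: clin_def)

lemma inner_imul: "inner (imul F) G = - inner F (imul G)"
  by (simp add: inner_eq_Re_cinner cinner_cscale_left cinner_cscale_right)

lemma cinner_eq_from_inner:
  assumes "\<And>G. inner A (T G) = inner B G" "\<And>G. T (cscale \<i> G) = cscale \<i> (T G)"
  shows "cinner A (T G) = cinner B G"
  unfolding cinner_eq_inner using assms by metis

text \<open>A relation and not a map, since an \<open>op\<close> is arbitrary outside
  \<open>L2\<close> and fixed only up to null sets inside. Whatever \<open>abs_op\<close> and
  \<open>mod_act\<close> happen to choose is represented as soon as it is bounded.\<close>

definition represents :: "(l2 \<Rightarrow>\<^sub>L l2) \<Rightarrow> op \<Rightarrow> bool" where
  "represents A X \<longleftrightarrow> clin A \<and> (\<forall>f\<in>L2. X f \<in> L2 \<and> abs_l2 (X f) = A (abs_l2 f))"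

definition op_of :: "(l2 \<Rightarrow>\<^sub>L l2) \<Rightarrow> op" where
  "op_of A f = rep_l2 (A (abs_l2 f))"

lemma represents_op_of: "clin A \<Longrightarrow> represents A (op_of A)"
  by (simp add: represents_def op_of_def)

lemma represents_ip:
  assumes "represents A X" "f \<in> L2" "g \<in> L2"
  shows "ip (X f) g = cinner (A (abs_l2 f)) (abs_l2 g)"
  using assms by (simp add: represents_def flip: l2_abs_simps(4))

lemma represents_ip2:
  assumes "represents A X" "f \<in> L2" "g \<in> L2"
  shows "ip (X f) (X g) = cinner (A (abs_l2 f)) (A (abs_l2 g))"
proof -
  have "X g \<in> L2" "abs_l2 (X g) = A (abs_l2 g)" using assms by (auto simp: represents_def)
  then show ?thesis using represents_ip[OF assms(1,2)] by simp
qed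

lemma represents_bounded_op: "represents A X \<Longrightarrow> bounded_op X"
  unfolding bounded_op_def
proof (intro conjI ballI impI allI)
  assume AX: "represents A X"
  then have X: "f \<in> L2 \<Longrightarrow> X f \<in> L2" "f \<in> L2 \<Longrightarrow> abs_l2 (X f) = A (abs_l2 f)"
    "A (cscale a F) = cscale a (A F)" for f a F
    by (auto simp: represents_def clin_def)
  show "f \<in> L2 \<Longrightarrow> X f \<in> L2" for f by (rule X)
  fix f g assume fg: "f \<in> L2" "g \<in> L2"
  show "aeq f g \<Longrightarrow> aeq (X f) (X g)" using fg by (simp add: X flip: abs_l2_eq_iff)
  fix a
  show "aeq (X (\<lambda>t. a * f t + g t)) (\<lambda>t. a * X f t + X g t)"
  proof (subst abs_l2_eq_iff[symmetric])
    show "X (\<lambda>t. a * f t + g t) \<in> L2" by (intro X L2_add L2_scale fg)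
    show "(\<lambda>t. a * X f t + X g t) \<in> L2" by (intro X L2_add L2_scale fg)
    have "abs_l2 (\<lambda>t. a * X f t + X g t) = cscale a (abs_l2 (X f)) + abs_l2 (X g)"
      by (simp add: l2_abs_simps L2_scale X(1) fg)
    moreover have "abs_l2 (\<lambda>t. a * f t + g t) = cscale a (abs_l2 f) + abs_l2 g"
      by (simp add: l2_abs_simps L2_scale fg)
    ultimately show "abs_l2 (X (\<lambda>t. a * f t + g t)) = abs_l2 (\<lambda>t. a * X f t + X g t)"
      by (simp add: X fg L2_add L2_scale blinfun.add_right)
  qed
next
  assume AX: "represents A X"
  show "\<exists>C. \<forall>f\<in>L2. l2norm (X f) \<le> C * l2norm f"
    using AX norm_blinfun[of A] by (auto simp: represents_def l2norm_eq_norm intro!: exI[of _ "norm A"])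
qed

lemma bounded_op_represented:
  assumes "bounded_op X" shows "\<exists>A. represents A X"
proof -
  have X: "\<And>f. f \<in> L2 \<Longrightarrow> X f \<in> L2" "\<And>f g. f \<in> L2 \<Longrightarrow> g \<in> L2 \<Longrightarrow> aeq f g \<Longrightarrow> aeq (X f) (X g)"
    "\<And>f g a. f \<in> L2 \<Longrightarrow> g \<in> L2 \<Longrightarrow> aeq (X (\<lambda>t. a * f t + g t)) (\<lambda>t. a * X f t + X g t)"
    using assms unfolding bounded_op_def by blast+
  obtain C where C: "\<And>f. f \<in> L2 \<Longrightarrow> l2norm (X f) \<le> C * l2norm f"
    using assms unfolding bounded_op_def by blast
  define A where "A F = abs_l2 (X (rep_l2 F))" for F
  have Aabs: "A (abs_l2 f) = abs_l2 (X f)" if "f \<in> L2" for f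
    unfolding A_def using that by (subst abs_l2_eq_iff) (auto intro!: X aeq_rep_abs)
  have lin: "A (cscale a F + G) = cscale a (A F) + A G" for a F G
  proof -
    obtain f g where fg: "f \<in> L2" "F = abs_l2 f" "g \<in> L2" "G = abs_l2 g" by (metis abs_l2_cases)
    have "A (cscale a F + G) = abs_l2 (X (\<lambda>t. a * f t + g t))"
      by (simp add: fg l2_abs_simps L2_scale Aabs L2_add)
    also have "\<dots> = abs_l2 (\<lambda>t. a * X f t + X g t)"
      by (subst abs_l2_eq_iff) (auto intro!: X L2_add L2_scale fg)
    also have "\<dots> = cscale a (A F) + A G" by (simp add: fg Aabs l2_abs_simps X L2_scale)
    finally show ?thesis .
  qed
  have A0: "A 0 = 0" using lin[of 1 0 0] by (simp add: cscale_simps)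
  have Ac: "A (cscale a F) = cscale a (A F)" for a F using lin[of a F 0] by (simp add: A0)
  have bl: "bounded_linear A"
  proof (rule bounded_linear_intro[where K=C])
    show "A (F + G) = A F + A G" for F G using lin[of 1 F G] by (simp add: cscale_simps)
    show "A (r *\<^sub>R F) = r *\<^sub>R A F" for r F by (simp add: scaleR_eq_cscale Ac)
    show "norm (A F) \<le> norm F * C" for F
      using C[of "rep_l2 F"] by (simp add: A_def l2norm_eq_norm X mult.commute)
  qed
  have "represents (Blinfun A) X"
    unfolding represents_def clin_def by (simp add: bounded_linear_Blinfun_apply[OF bl] Ac Aabs X)
  then show ?thesis by blast
qed

text \<open>Polarisation: F + G compares the imaginary parts, and replacing F by i F compares the
  real ones. \<open>positive_op\<close> only records a real nonnegative form, so self-adjointness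
  has to be derived.\<close>

lemma symmetric_if_real_form:
  assumes "clin P" "\<And>F. Im (cinner (P F) F) = 0"
  shows "cinner (P F) G = cinner F (P G)"
proof -
  have im: "Im (cinner (P F) G) = Im (cinner F (P G))" for F
  proof -
    have "Im (cinner (P (F + G)) (F + G)) = 0" by (rule assms)
    then have "Im (cinner (P F) G) + Im (cinner (P G) F) = 0"
      by (simp add: blinfun.add_right cinner_add_left cinner_add_right assms)
    moreover have "Im (cinner (P G) F) = - Im (cinner F (P G))" by (subst cinner_commute) simp
    ultimately show ?thesis by simp
  qed
  moreover have "Im (cinner (P (cscale \<i> F)) G) = Im (cinner (cscale \<i> F) (P G))" by (rule im)
  then have "Re (cinner (P F) G) = Re (cinner F (P G))"
    using assms(1) by (simp add: clin_def cinner_cscale_left)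
  ultimately show ?thesis by (simp add: complex_eq_iff)
qed

lemma positive_sqrt_clin:
  assumes "clin M" and sym: "\<And>F G. inner (M F) G = inner F (M G)" and pos: "\<And>F. 0 \<le> inner (M F) F"
  shows "\<exists>R. clin R \<and> (\<forall>F G. cinner (blinfun_apply R F) G = cinner F (blinfun_apply R G)) \<and>
     (\<forall>F. 0 \<le> inner (blinfun_apply R F) F) \<and> (\<forall>F. blinfun_apply R (blinfun_apply R F) = M F)"
proof -
  obtain R where R: "\<And>x y. inner (blinfun_apply R x) y = inner x (blinfun_apply R y)"
    "\<And>x. 0 \<le> inner (blinfun_apply R x) x" "\<And>x. blinfun_apply R (blinfun_apply R x) = M x"
    "\<And>C x. (\<And>x. blinfun_apply C (M x) = M (C x)) \<Longrightarrow> blinfun_apply C (blinfun_apply R x) = R (C x)"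
    using positive_sqrt[OF sym pos] by metis
  have "clin R" unfolding clin_iff_imul by (intro allI R(4)) (use assms in \<open>auto simp: clin_iff_imul\<close>)
  moreover have "cinner (R F) G = cinner F (R G)" for F G
    using \<open>clin R\<close> by (intro cinner_eq_from_inner[symmetric]) (simp_all add: R clin_def)
  ultimately show ?thesis using R by blast
qed

text \<open>The root of A*A, where A*A is the operator M of the form <A F, A G>. This makes the
  choice in \<open>abs_op\<close> meaningful.\<close>

lemma is_abs_exists:
  assumes "bounded_op X" shows "\<exists>P. is_abs X P"
proof -
  obtain A where A: "represents A X" using bounded_op_represented[OF assms] by blast
  have Ac: "A (cscale a F) = cscale a (A F)" for a F using A by (simp add: represents_def clin_def)
  have "bounded_bilinear (\<lambda>F G. inner (A F) (A G))"
    by (rule bounded_bilinear.comp[OF bounded_bilinear_inner]) (rule blinfun.bounded_linear_right)+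
  then obtain M :: "l2 \<Rightarrow>\<^sub>L l2" where M: "\<And>F G. inner (A F) (A G) = inner (M F) G"
    using riesz_bilinear by blast
  have Mi: "imul (M F) = M (imul F)" for F
  proof (rule inner_left_eqI)
    fix G
    have "inner (imul (M F)) G = - inner (A F) (A (imul G))" by (simp only: inner_imul M)
    also have "\<dots> = - inner (A F) (imul (A G))" by (simp add: Ac)
    also have "\<dots> = inner (A (imul F)) (A G)" by (simp add: Ac inner_imul[simplified])
    finally show "inner (imul (M F)) G = inner (M (imul F)) G" by (simp only: M)
  qed
  obtain R where R: "clin R" "\<And>F G. cinner (blinfun_apply R F) G = cinner F (blinfun_apply R G)"
     "\<And>F. 0 \<le> inner (blinfun_apply R F) F" "\<And>F. blinfun_apply R (blinfun_apply R F) = M F"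
    using positive_sqrt_clin[of M] Mi by (metis (no_types, lifting) M clin_iff_imul inner_commute inner_ge_zero)
  have RA: "cinner (R F) (R G) = cinner (A F) (A G)" for F G
  proof -
    have "inner (R F) (R G) = inner (A F) (A G)" for F G
      unfolding M using R(2)[of "R F" G] by (simp add: inner_eq_Re_cinner R(4))
    then show ?thesis unfolding cinner_eq_inner using R(1) Ac by (metis clin_def)
  qed
  have rep: "represents R (op_of R)" using R(1) by (rule represents_op_of)
  have Rim: "Im (cinner (R F) F) = 0" for F
  proof -
    have "cinner (R F) F = cnj (cinner (R F) F)" by (metis R(2) cinner_commute)
    then show ?thesis by (metis Reals_cnj_iff complex_is_Real_iff)
  qed
  have "is_abs X (op_of R)" unfolding is_abs_def positive_op_def
  proof (intro conjI ballI)
    show "bounded_op (op_of R)" using rep by (rule represents_bounded_op)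
    show "ip (op_of R f) f \<in> \<real>" "0 \<le> Re (ip (op_of R f) f)" if "f \<in> L2" for f
      using Rim R(3) by (simp_all add: represents_ip[OF rep that that] complex_is_Real_iff flip: inner_eq_Re_cinner)
    fix f g assume fg: "f \<in> L2" "g \<in> L2"
    have "ip (X f) (X g) = cinner (A (abs_l2 f)) (A (abs_l2 g))"
      using A fg by (rule represents_ip2)
    moreover have "ip (op_of R f) (op_of R g) = cinner (R (abs_l2 f)) (R (abs_l2 g))"
      using rep fg by (rule represents_ip2)
    ultimately show "ip (op_of R f) (op_of R g) = ip (X f) (X g)" by (simp add: RA)
  qed
  then show ?thesis by blast
qed

lemma abs_op_represented:
  assumes "represents A X"
  shows "\<exists>P. represents P (abs_op X) \<and> (\<forall>F G. cinner (blinfun_apply P F) (blinfun_apply P G) = cinner (A F) (A G)) \<and>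
    (\<forall>F G. cinner (blinfun_apply P F) G = cinner F (blinfun_apply P G)) \<and> (\<forall>F. 0 \<le> inner (blinfun_apply P F) F)"
proof -
  have "is_abs X (abs_op X)"
    unfolding abs_op_def by (rule someI_ex[OF is_abs_exists[OF represents_bounded_op[OF assms]]])
  then have *: "bounded_op (abs_op X)" "\<And>f. f \<in> L2 \<Longrightarrow> ip (abs_op X f) f \<in> \<real>"
    "\<And>f. f \<in> L2 \<Longrightarrow> 0 \<le> Re (ip (abs_op X f) f)"
    "\<And>f g. f \<in> L2 \<Longrightarrow> g \<in> L2 \<Longrightarrow> ip (abs_op X f) (abs_op X g) = ip (X f) (X g)"
    by (auto simp: is_abs_def positive_op_def)
  obtain P where P: "represents P (abs_op X)" using bounded_op_represented[OF *(1)] by blast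
  have "Im (cinner (P F) F) = 0" for F
    using *(2)[of "rep_l2 F"] by (simp add: represents_ip[OF P] complex_is_Real_iff)
  then have "cinner (P F) G = cinner F (P G)" for F G
    using P symmetric_if_real_form[of P] by (simp add: represents_def)
  moreover have "0 \<le> inner (P F) F" for F
    using *(3)[of "rep_l2 F"] by (simp add: represents_ip[OF P] inner_eq_Re_cinner)
  moreover have "cinner (P F) (P G) = cinner (A F) (A G)" for F G
  proof -
    from represents_ip2[OF P, of "rep_l2 F" "rep_l2 G"] represents_ip2[OF assms, of "rep_l2 F" "rep_l2 G"]
      *(4)[of "rep_l2 F" "rep_l2 G"]
    show ?thesis by simp
  qed
  ultimately show ?thesis using P by blast
qed

subsection \<open>Orthonormal families\<close>

lemma norm_sq_orthonormal_sum:
  assumes "finite A" "\<And>i j. i \<in> A \<Longrightarrow> j \<in> A \<Longrightarrow> cinner (E i) (E j) = (if i = j then 1 else 0)"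
  shows "(norm (\<Sum>i\<in>A. cscale (c i) (E i)))\<^sup>2 = (\<Sum>i\<in>A. (cmod (c i))\<^sup>2)"
proof -
  let ?G = "\<Sum>i\<in>A. cscale (c i) (E i)"
  have "complex_of_real ((norm ?G)\<^sup>2) = (\<Sum>i\<in>A. \<Sum>j\<in>A. c i * (cnj (c j) * cinner (E i) (E j)))"
    unfolding cinner_self[symmetric] cinner.sum_left cinner.sum_right
    by (subst sum.swap) (simp add: cinner_cscale_left cinner_cscale_right mult.assoc mult.left_commute)
  also have "\<dots> = (\<Sum>i\<in>A. \<Sum>j\<in>A. if i = j then c i * cnj (c j) else 0)"
    by (intro sum.cong refl) (simp add: assms)
  also have "\<dots> = (\<Sum>i\<in>A. c i * cnj (c i))" using assms(1) by simp
  also have "\<dots> = complex_of_real (\<Sum>i\<in>A. (cmod (c i))\<^sup>2)"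
    by (simp add: complex_norm_square del: of_real_power)
  finally show ?thesis by (simp only: of_real_eq_iff)
qed

lemma bessel_inequality:
  assumes "finite A" "\<And>i j. i \<in> A \<Longrightarrow> j \<in> A \<Longrightarrow> cinner (E i) (E j) = (if i = j then 1 else 0)"
  shows "(\<Sum>i\<in>A. (cmod (cinner F (E i)))\<^sup>2) \<le> (norm F)\<^sup>2"
proof -
  let ?s = "\<Sum>i\<in>A. (cmod (cinner F (E i)))\<^sup>2"
  let ?G = "\<Sum>i\<in>A. cscale (cinner F (E i)) (E i)"
  have G: "(norm ?G)\<^sup>2 = ?s" by (rule norm_sq_orthonormal_sum[OF assms])
  have "cinner F ?G = (\<Sum>i\<in>A. cinner F (E i) * cnj (cinner F (E i)))"
    unfolding cinner.sum_right cinner_cscale_right by (simp add: mult.commute)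
  also have "\<dots> = complex_of_real ?s" by (simp add: complex_norm_square del: of_real_power)
  finally have "inner F ?G = ?s" by (simp add: inner_eq_Re_cinner)
  moreover have "0 \<le> (norm (F - ?G))\<^sup>2" by simp
  moreover have "(norm (F - ?G))\<^sup>2 = (norm F)\<^sup>2 - 2 * inner F ?G + (norm ?G)\<^sup>2"
    unfolding power2_norm_eq_inner by (simp add: inner_simps inner_commute)
  ultimately show ?thesis using G by simp
qed

lemma orthonormal_expansion:
  fixes E :: "nat \<Rightarrow> l2"
  assumes E: "\<And>i j. cinner (E i) (E j) = (if i = j then 1 else 0)"
    and complete: "\<And>F. (\<And>n. cinner F (E n) = 0) \<Longrightarrow> F = 0"
  shows "(\<lambda>n. cscale (cinner F (E n)) (E n)) sums F"
proof -
  define c where "c n = cinner F (E n)" for n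
  have summ: "summable (\<lambda>n. (cmod (c n))\<^sup>2)"
    unfolding c_def by (rule bounded_imp_summable[where B="(norm F)\<^sup>2"]) (auto intro!: bessel_inequality simp: E)
  have "summable (\<lambda>n. cscale (c n) (E n))"
    unfolding summable_Cauchy
  proof (intro allI impI)
    fix e :: real assume "e > 0"
    then obtain N where N: "\<And>m n. m \<ge> N \<Longrightarrow> norm (sum (\<lambda>n. (cmod (c n))\<^sup>2) {m..<n}) < e\<^sup>2"
      using summ unfolding summable_Cauchy by (meson zero_less_power)
    have "norm (\<Sum>i=m..<n. cscale (c i) (E i)) < e" if "m \<ge> N" for m n
    proof -
      have "(norm (\<Sum>i=m..<n. cscale (c i) (E i)))\<^sup>2 < e\<^sup>2"
        using N[OF that, of n] by (subst norm_sq_orthonormal_sum) (auto simp: E)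
      then show ?thesis using \<open>e > 0\<close> by (simp add: power_less_imp_less_base)
    qed
    then show "\<exists>N. \<forall>m\<ge>N. \<forall>n. norm (\<Sum>i=m..<n. cscale (c i) (E i)) < e" by blast
  qed
  then obtain G where G: "(\<lambda>n. cscale (c n) (E n)) sums G" by blast
  have "cinner (F - G) (E m) = 0" for m
  proof -
    have "(\<lambda>n. cinner (cscale (c n) (E n)) (E m)) sums cinner G (E m)"
      by (rule bounded_linear.sums[OF cinner.bounded_linear_left G])
    moreover have "(\<lambda>n. cinner (cscale (c n) (E n)) (E m)) = (\<lambda>n. if n = m then c n else 0)"
      by (auto simp: cinner_cscale_left E)
    moreover have "(\<lambda>n. if n = m then c n else 0) sums c m" by (rule sums_single)
    ultimately have "cinner G (E m) = c m" using sums_unique2 by metis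
    then show ?thesis by (simp add: cinner.diff_left c_def)
  qed
  then have "F = G" using complete[of "F - G"] by simp
  then show ?thesis using G by (simp add: c_def)
qed

subsection \<open>Step functions\<close>

definition step :: "real \<Rightarrow> real \<Rightarrow> l2" where
  "step a b = abs_l2 (indicator {a..<b})"

lemma indicator_L2: "indicator {a..<b::real} \<in> L2"
proof (rule L2I)
  have "(\<lambda>t. (cmod (indicator {a..<b} t))\<^sup>2) = (indicator {a..<b} :: real \<Rightarrow> real)"
    by (auto simp: indicator_def)
  then show "integrable lborel (\<lambda>t. (cmod (indicator {a..<b} t))\<^sup>2)"
    by (cases "a \<le> b") simp_all
qed simp

lemma cnj_indicator: "cnj (indicator A x) = indicator A x"
  by (simp add: indicator_def)

lemma step_add: "a \<le> b \<Longrightarrow> b \<le> c \<Longrightarrow> step a b + step b c = step a c"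
  unfolding step_def by (subst l2_abs_simps) (auto intro!: indicator_L2 arg_cong[of _ _ abs_l2] simp: indicator_def)

lemma step_empty: "step a a = 0"
  using step_add[of a a a] by simp

lemma norm_step: "a \<le> b \<Longrightarrow> (norm (step a b))\<^sup>2 = b - a"
proof -
  have "(\<lambda>t. (cmod (indicator {a..<b} t))\<^sup>2) = (indicator {a..<b} :: real \<Rightarrow> real)"
    by (auto simp: indicator_def)
  then show "a \<le> b \<Longrightarrow> (norm (step a b))\<^sup>2 = b - a"
    unfolding step_def by (subst norm_abs_l2) (simp_all add: indicator_L2)
qed

lemma cinner_step:
  "cinner F (step a b) = (\<integral>t. rep_l2 F t * indicator {a..<b} t \<partial>lborel)"
  using l2_abs_simps(4)[OF rep_l2_L2 indicator_L2, of F a b]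
  by (simp add: step_def ip_def cnj_indicator)

lemma cinner_step_disjoint: "b \<le> c \<or> d \<le> a \<Longrightarrow> cinner (step a b) (step c d) = 0"
proof -
  assume "b \<le> c \<or> d \<le> a"
  then have "(\<lambda>t. indicator {a..<b} t * cnj (indicator {c..<d} t)) = (\<lambda>t. 0)"
    by (auto simp: indicator_def)
  then show ?thesis unfolding step_def by (simp add: l2_abs_simps indicator_L2 ip_def)
qed

text \<open>\<open>ennreal\<close> cuts negative values to 0, so \<open>?M\<close> and
  \<open>?N\<close> have the positive and the negative part of h as densities. They agree on the
  half-lines, hence as measures, and the two parts coincide only where h is 0.\<close>

lemma integrable_zero_AE:
  fixes h :: "real \<Rightarrow> real"
  assumes h: "integrable lborel h" and zero: "\<And>x. (\<integral>t. h t * indicator {x<..} t \<partial>lborel) = 0"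
  shows "AE t in lborel. h t = 0"
proof -
  have hm [measurable]: "h \<in> borel_measurable borel" using h by simp
  let ?M = "density lborel (\<lambda>t. ennreal (h t))" and ?N = "density lborel (\<lambda>t. ennreal (- h t))"
  have eqs: "emeasure ?M {x<..} = (\<integral>\<^sup>+ t. ennreal (h t * indicator {x<..} t) \<partial>lborel)"
     "emeasure ?N {x<..} = (\<integral>\<^sup>+ t. ennreal (- (h t * indicator {x<..} t)) \<partial>lborel)" for x
    by (auto simp: emeasure_density intro!: nn_integral_cong split: split_indicator)
  have hx: "integrable lborel (\<lambda>t. h t * indicator {x<..} t)" for x
    by (rule integrable_real_mult_indicator) (simp_all add: h)
  have fin: "(\<integral>\<^sup>+ t. ennreal (h t * indicator {x<..} t) \<partial>lborel) < \<infinity>"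
     "(\<integral>\<^sup>+ t. ennreal (- (h t * indicator {x<..} t)) \<partial>lborel) < \<infinity>" for x
    using hx[of x] by (auto simp: real_integrable_def less_top)
  have "?M = ?N"
  proof (rule measure_eqI_lessThan)
    show "emeasure ?M {x<..} < \<infinity>" for x unfolding eqs by (rule fin)
    show "emeasure ?M {x<..} = emeasure ?N {x<..}" for x
    proof -
      have "enn2real (\<integral>\<^sup>+ t. ennreal (h t * indicator {x<..} t) \<partial>lborel)
          = enn2real (\<integral>\<^sup>+ t. ennreal (- (h t * indicator {x<..} t)) \<partial>lborel)"
        using real_lebesgue_integral_def[OF hx[of x]] zero[of x] by simp
      then show ?thesis
        unfolding eqs using fin[of x] by (metis ennreal_enn2real infinity_ennreal_def)
    qed
  qed simp_all
  then have "AE t in lborel. ennreal (h t) = ennreal (- h t)"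
    by (intro sigma_finite_measure.density_unique[OF sigma_finite_lborel]) auto
  then show ?thesis
  proof eventually_elim
    fix t assume e: "ennreal (h t) = ennreal (- h t)"
    show "h t = 0"
    proof (cases "h t" "0 :: real" rule: linorder_cases)
      case less
      then show ?thesis using e by (metis ennreal_eq_0_iff ennreal_neg less_imp_le neg_le_0_iff_le order_antisym)
    next
      case greater
      then show ?thesis using e by (metis ennreal_eq_0_iff ennreal_neg less_imp_le neg_le_0_iff_le order_antisym)
    qed
  qed
qed

definition dyad :: "nat \<Rightarrow> int \<Rightarrow> l2" where
  "dyad k a = step (of_int a / 2^k) ((of_int a + 1) / 2^k)"

text \<open>Orthogonality to the cells extends by additivity to intervals with dyadic endpoints, by
  approximation to arbitrary left endpoints, and then determines the function through its integrals
  over half-lines.\<close>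

lemma dyad_total:
  assumes F: "\<And>k a. cinner F (dyad k a) = 0"
  shows "F = 0"
proof -
  have dyadic: "cinner F (step (of_int a / 2^k) (of_int (a + int n) / 2^k)) = 0" for a k n
  proof (induction n)
    case (Suc n)
    have "step (of_int a / 2^k) (of_int (a + int (Suc n)) / 2^k) =
        step (of_int a / 2^k) (of_int (a + int n) / 2^k)
        + step (of_int (a + int n) / 2^k) ((of_int (a + int n) + 1) / 2^k)"
      by (subst step_add) (auto simp: divide_right_mono algebra_simps)
    then show ?case using Suc F[of k "a + int n"] by (simp add: cinner_add_right dyad_def)
  qed (simp add: step_empty cinner.zero_right)
  have real: "cinner F (step x (real n)) = 0" if x: "x \<le> real n" for x n
  proof -
    \<comment> \<open>x rounded down to the grid of mesh 2^-k. The interval between y and x has an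
      indicator of norm at most sqrt (2^-k), so replacing y by x costs nothing in the limit.\<close>
    define y where "y k = of_int \<lfloor>x * 2^k\<rfloor> / (2::real)^k" for k :: nat
    have y: "y k \<le> x" "x - y k \<le> (1/2)^k" for k
    proof -
      have *: "of_int \<lfloor>x * 2^k\<rfloor> \<le> x * 2^k" "x * 2^k - of_int \<lfloor>x * 2^k\<rfloor> \<le> 1" by linarith+
      show "y k \<le> x" using *(1) by (simp add: y_def field_simps)
      have "x - y k = (x * 2^k - of_int \<lfloor>x * 2^k\<rfloor>) / 2^k" by (simp add: y_def diff_divide_distrib)
      also have "\<dots> \<le> 1 / 2^k" using *(2) by (rule divide_right_mono) simp
      finally show "x - y k \<le> (1/2)^k" by (simp add: power_one_over)
    qed
    have z: "cinner F (step (y k) (real n)) = 0" for k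
    proof -
      have "\<lfloor>x * 2^k\<rfloor> \<le> int (n * 2^k)" using x by (simp add: floor_le_iff) (smt (verit) mult_right_mono zero_le_power)
      then obtain m where "int (n * 2^k) = \<lfloor>x * 2^k\<rfloor> + int m" by (metis zle_iff_zadd)
      then have "of_int (\<lfloor>x * 2^k\<rfloor> + int m) / 2^k = real n"
        by (metis nonzero_mult_div_cancel_right of_int_of_nat_eq of_nat_mult of_nat_numeral of_nat_power power_not_zero zero_neq_numeral)
      then show ?thesis using dyadic[of "\<lfloor>x * 2^k\<rfloor>" k m] by (simp add: y_def)
    qed
    have "cmod (cinner F (step x (real n))) \<le> norm F * sqrt ((1/2)^k)" for k
    proof -
      have "step (y k) x + step x (real n) = step (y k) (real n)" by (rule step_add) (use y x in auto)
      then have "cinner F (step x (real n)) = - cinner F (step (y k) x)"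
        using z[of k] by (metis add_eq_0_iff2 cinner_add_right add.commute)
      then have "cmod (cinner F (step x (real n))) \<le> norm F * norm (step (y k) x)"
        by (simp add: norm_cinner_le)
      also have "norm (step (y k) x) \<le> sqrt ((1/2)^k)"
        using norm_step[OF y(1)] y(2) by (simp add: real_le_rsqrt)
      finally show ?thesis by (simp add: mult_left_mono)
    qed
    moreover have "(\<lambda>k. norm F * sqrt ((1/2)^k)) \<longlonglongrightarrow> norm F * sqrt 0"
      by (intro tendsto_intros LIMSEQ_power_zero) simp
    ultimately have "cmod (cinner F (step x (real n))) \<le> norm F * sqrt 0"
      by (intro LIMSEQ_le_const) auto
    then show ?thesis by simp
  qed
  define f where "f = rep_l2 F"
  have fL: "f \<in> L2" by (simp add: f_def)
  have fint: "integrable lborel (\<lambda>t. f t * indicator {a..<b} t)" for a b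
    using L2_mult_integrable[OF fL indicator_L2[of a b]] by (simp add: cnj_indicator)
  \<comment> \<open>Truncation to [-n, n) makes the square-integrable function integrable. The
    half-open intervals of \<open>step\<close> and the open half-line differ at most in the null set
    {x}.\<close>
  have int0: "(\<integral>t. f t * indicator {- real n..<real n} t * of_real (indicator {x<..} t) \<partial>lborel) = 0" for x n
  proof (cases "x < real n")
    case True
    define m where "m = max x (- real n)"
    have "(\<integral>t. f t * indicator {- real n..<real n} t * of_real (indicator {x<..} t) \<partial>lborel)
        = (\<integral>t. f t * indicator {m..<real n} t \<partial>lborel)"
    proof (rule integral_cong_AE)
      show "AE t in lborel. f t * indicator {- real n..<real n} t * of_real (indicator {x<..} t) = f t * indicator {m..<real n} t"
        using AE_lborel_singleton[of x] by eventually_elim (auto simp: indicator_def m_def)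
    qed (use fL in \<open>auto dest: L2_measurable\<close>)
    also have "\<dots> = 0" using real[of m n] True by (simp add: cinner_step f_def m_def)
    finally show ?thesis .
  next
    case False
    then have "(\<lambda>t. f t * indicator {- real n..<real n} t * of_real (indicator {x<..} t)) = (\<lambda>t. 0)"
      by (auto simp: indicator_def)
    then show ?thesis by (simp only:) simp
  qed
  have "AE t in lborel. f t * indicator {- real n..<real n} t = 0" for n
  proof -
    let ?h = "\<lambda>t. f t * indicator {- real n..<real n} t"
    have hi: "integrable lborel (\<lambda>t. ?h t * of_real (indicator {x<..} t))" for x
      using integrable_mult_indicator[OF _ fint, of "{x<..}" "- real n" "real n"]
      by (simp add: scaleR_conv_of_real mult.commute)
    have "AE t in lborel. Re (?h t) = 0"
    proof (rule integrable_zero_AE)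
      show "integrable lborel (\<lambda>t. Re (?h t))" using fint by (rule integrable_Re)
      show "(\<integral>t. Re (?h t) * indicator {x<..} t \<partial>lborel) = 0" for x
        using integral_Re[OF hi[of x]] int0[of n x] by simp
    qed
    moreover have "AE t in lborel. Im (?h t) = 0"
    proof (rule integrable_zero_AE)
      show "integrable lborel (\<lambda>t. Im (?h t))" using fint by (rule integrable_Im)
      show "(\<integral>t. Im (?h t) * indicator {x<..} t \<partial>lborel) = 0" for x
        using integral_Im[OF hi[of x]] int0[of n x] by simp
    qed
    ultimately show ?thesis by eventually_elim (simp add: complex_eq_iff)
  qed
  then have "AE t in lborel. \<forall>n. f t * indicator {- real n..<real n} t = 0"
    unfolding AE_all_countable by blast
  then have "AE t in lborel. f t = 0"
  proof eventually_elim
    fix t assume *: "\<forall>n. f t * indicator {- real n..<real n} t = 0"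
    obtain n where "\<bar>t\<bar> < real n" using reals_Archimedean2 by blast
    then have "t \<in> {- real n..<real n}" by auto
    then show "f t = 0" using *[rule_format, of n] by simp
  qed
  then have "aeq f (\<lambda>_. 0)" by (simp add: aeq_def)
  then have "abs_l2 f = abs_l2 (\<lambda>_. 0)" using fL by (simp add: abs_l2_eq_iff L2_zero)
  then show ?thesis by (simp add: f_def flip: zero_l2.abs_eq)
qed

subsection \<open>Existence of an orthonormal basis\<close>

definition orthoset :: "l2 set \<Rightarrow> bool" where
  "orthoset S \<longleftrightarrow> (\<forall>x\<in>S. \<forall>y\<in>S. cinner x y = (if x = y then 1 else 0))"

text \<open>Separability: by Bessel each of the countably many dyadic indicators pairs nontrivially
  with only countably many members of S, and by totality every member pairs nontrivially with one of
  them.\<close>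

lemma orthoset_countable:
  assumes S: "orthoset S" shows "countable S"
proof -
  have fin: "finite {x\<in>S. e < (cmod (cinner F x))\<^sup>2}" if e: "e > 0" for F e
  proof (rule ccontr)
    let ?T = "{x\<in>S. e < (cmod (cinner F x))\<^sup>2}"
    assume "infinite ?T"
    obtain n where n: "(norm F)\<^sup>2 < real n * e" using reals_Archimedean3[OF e, rule_format, of "(norm F)\<^sup>2"] by blast
    obtain A where A: "A \<subseteq> ?T" "finite A" "card A = n" using infinite_arbitrarily_large[OF \<open>infinite ?T\<close>] by blast
    have "(\<Sum>x\<in>A. (cmod (cinner F x))\<^sup>2) \<le> (norm F)\<^sup>2"
      using bessel_inequality[OF A(2), of "\<lambda>x. x"] S A(1) by (simp add: orthoset_def subset_iff)
    moreover have "real n * e \<le> (\<Sum>x\<in>A. (cmod (cinner F x))\<^sup>2)"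
      using sum_bounded_below[of A e "\<lambda>x. (cmod (cinner F x))\<^sup>2"] A by fastforce
    ultimately show False using n by simp
  qed
  have cnt: "countable {x\<in>S. cinner F x \<noteq> 0}" for F
  proof (rule countable_subset)
    show "{x\<in>S. cinner F x \<noteq> 0} \<subseteq> (\<Union>n. {x\<in>S. inverse (real (Suc n)) < (cmod (cinner F x))\<^sup>2})"
    proof clarsimp
      fix x assume "cinner F x \<noteq> 0"
      then have "(cmod (cinner F x))\<^sup>2 > 0" by simp
      then obtain n where "inverse (real (Suc n)) < (cmod (cinner F x))\<^sup>2" using reals_Archimedean by blast
      then show "\<exists>n. inverse (1 + real n) < (cmod (cinner F x))\<^sup>2" by auto
    qed
    show "countable (\<Union>n. {x\<in>S. inverse (real (Suc n)) < (cmod (cinner F x))\<^sup>2})"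
    proof (rule countable_UN[OF _ countable_finite])
      show "finite {x\<in>S. inverse (real (Suc n)) < (cmod (cinner F x))\<^sup>2}" for n by (rule fin) simp
    qed simp
  qed
  have "S \<subseteq> (\<Union>(k::nat, a::int) \<in> UNIV. {x\<in>S. cinner (dyad k a) x \<noteq> 0})"
  proof
    fix x assume x: "x \<in> S"
    then have "x \<noteq> 0" using S unfolding orthoset_def by (metis cinner.zero_left zero_neq_one)
    then obtain k :: nat and a :: int where "cinner x (dyad k a) \<noteq> 0" using dyad_total by blast
    then have "cinner (dyad k a) x \<noteq> 0" by (metis cinner_commute complex_cnj_zero)
    then show "x \<in> (\<Union>(k::nat, a::int) \<in> UNIV. {x\<in>S. cinner (dyad k a) x \<noteq> 0})"
      using x by auto
  qed
  moreover have "countable (\<Union>(k::nat, a::int) \<in> UNIV. {x\<in>S. cinner (dyad k a) x \<noteq> 0})"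
    by (rule countable_UN) (auto intro: cnt)
  ultimately show ?thesis by (rule countable_subset)
qed

text \<open>Zorn's lemma among the orthonormal sets that contain the indicators of [k, k+1).
  Containing these forces the maximal set to be infinite, so that it is enumerated by the naturals
  without repetition.\<close>

lemma orthonormal_basis_exists:
  "\<exists>E :: nat \<Rightarrow> l2. (\<forall>i j. cinner (E i) (E j) = (if i = j then 1 else 0)) \<and>
     (\<forall>F. (\<forall>n. cinner F (E n) = 0) \<longrightarrow> F = 0)"
proof -
  define u where "u k = step (real k) (real (Suc k))" for k
  have uu: "cinner (u i) (u j) = (if i = j then 1 else 0)" for i j
  proof (cases "i = j")
    case True
    have "(norm (u i))\<^sup>2 = 1" unfolding u_def by (subst norm_step) auto
    then show ?thesis using True by (simp add: cinner_self)
  next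
    case False
    then show ?thesis unfolding u_def by (subst cinner_step_disjoint) auto
  qed
  then have inj: "inj u" by (metis injI one_neq_zero)
  define \<A> where "\<A> = {S. range u \<subseteq> S \<and> orthoset S}"
  have "\<exists>M\<in>\<A>. \<forall>X\<in>\<A>. M \<subseteq> X \<longrightarrow> X = M"
  proof (rule subset_Zorn_nonempty)
    have "range u \<in> \<A>" unfolding \<A>_def orthoset_def using uu inj by (auto simp: inj_eq)
    then show "\<A> \<noteq> {}" by blast
  next
    fix \<C> assume C: "\<C> \<noteq> {}" "subset.chain \<A> \<C>"
    then have sub: "\<C> \<subseteq> \<A>" and ch: "\<And>S T. S \<in> \<C> \<Longrightarrow> T \<in> \<C> \<Longrightarrow> S \<subseteq> T \<or> T \<subseteq> S"
      by (auto simp: subset_chain_def)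
    have "orthoset (\<Union>\<C>)" unfolding orthoset_def
    proof (intro ballI)
      fix x y assume "x \<in> \<Union>\<C>" "y \<in> \<Union>\<C>"
      then obtain S where "S \<in> \<C>" "x \<in> S" "y \<in> S" using ch by blast
      then show "cinner x y = (if x = y then 1 else 0)" using sub by (auto simp: \<A>_def orthoset_def)
    qed
    then show "\<Union>\<C> \<in> \<A>" using sub C(1) by (auto simp: \<A>_def)
  qed
  then obtain S where "S \<in> \<A>" and max: "\<And>X. X \<in> \<A> \<Longrightarrow> S \<subseteq> X \<Longrightarrow> X = S" by blast
  then have S: "range u \<subseteq> S" "orthoset S" by (simp_all add: \<A>_def)
  have inf: "infinite S" using S(1) inj by (meson finite_subset range_inj_infinite)
  define E where "E = from_nat_into S"
  have bij: "bij_betw E UNIV S"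
    unfolding E_def by (rule bij_betw_from_nat_into[OF orthoset_countable[OF S(2)] inf])
  have ES: "E i \<in> S" for i using bij by (auto simp: bij_betw_def)
  have "cinner (E i) (E j) = (if i = j then 1 else 0)" for i j
    using S(2) ES[of i] ES[of j] bij by (auto simp: orthoset_def bij_betw_def inj_eq)
  moreover have "F = 0" if F: "\<And>n. cinner F (E n) = 0" for F
  proof (rule ccontr)
    assume F0: "F \<noteq> 0"
    have FS: "cinner F x = 0" if "x \<in> S" for x using bij that F unfolding bij_betw_def by (metis imageE)
    define G where "G = inverse (norm F) *\<^sub>R F"
    have GG: "cinner G G = 1" using F0 by (simp add: G_def cinner_self)
    have GS: "cinner G x = 0" "cinner x G = 0" if "x \<in> S" for x
      using FS[OF that] by (simp_all add: G_def cinner.scaleR_left cinner.scaleR_right) (metis cinner_commute complex_cnj_zero)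
    have "orthoset (insert G S)" unfolding orthoset_def
      using S(2) GG GS by (auto simp: orthoset_def)
    then have "insert G S \<in> \<A>" using S(1) by (auto simp: \<A>_def)
    then have "insert G S = S" by (rule max) blast
    then have "G \<in> S" by blast
    then show False using GS GG by force
  qed
  ultimately show ?thesis by blast
qed

definition basis :: "nat \<Rightarrow> l2" where "basis n = abs_l2 (the_onb n)"

lemma the_onb_L2: "the_onb n \<in> L2"
  and basis_orthonormal: "cinner (basis i) (basis j) = (if i = j then 1 else 0)"
  and basis_complete: "(\<And>n. cinner F (basis n) = 0) \<Longrightarrow> F = 0"
proof -
  obtain E :: "nat \<Rightarrow> l2" where E: "\<And>i j. cinner (E i) (E j) = (if i = j then 1 else 0)"
     "\<And>F. (\<And>n. cinner F (E n) = 0) \<Longrightarrow> F = 0" using orthonormal_basis_exists by blast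
  have "onb (\<lambda>n. rep_l2 (E n))"
    unfolding onb_def
  proof (intro conjI allI ballI impI)
    show "ip (rep_l2 (E n)) (rep_l2 (E m)) = (if n = m then 1 else 0)" for n m
      using E(1)[of n m] l2_abs_simps(4)[OF rep_l2_L2 rep_l2_L2, of "E n" "E m"] by simp
    fix f assume f: "f \<in> L2" "\<forall>n. ip f (rep_l2 (E n)) = 0"
    have "abs_l2 f = 0"
      by (rule E(2)) (use f l2_abs_simps(4)[OF f(1) rep_l2_L2] in simp)
    then show "aeq f (\<lambda>_. 0)"
      using f(1) by (simp add: zero_l2.abs_eq abs_l2_eq_iff L2_zero)
  qed simp
  then have *: "onb the_onb" unfolding the_onb_def by (rule someI[where P=onb])
  then show L: "the_onb n \<in> L2" for n by (simp add: onb_def)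
  show "cinner (basis i) (basis j) = (if i = j then 1 else 0)"
    using * by (simp add: basis_def l2_abs_simps L onb_def)
  assume "\<And>n. cinner F (basis n) = 0"
  then have "\<forall>n. ip (rep_l2 F) (the_onb n) = 0"
    using l2_abs_simps(4)[OF rep_l2_L2 L, of F] by (simp add: basis_def)
  then have "aeq (rep_l2 F) (\<lambda>_. 0)" using * by (simp add: onb_def)
  then show "F = 0" using abs_l2_eq_iff[OF rep_l2_L2 L2_zero, of F] by (simp add: zero_l2.abs_eq)
qed

lemma basis_expansion: "(\<lambda>n. cscale (cinner F (basis n)) (basis n)) sums F"
  by (rule orthonormal_expansion[OF basis_orthonormal basis_complete])

lemma parseval: "(\<lambda>n. cinner F (basis n) * cinner (basis n) G) sums cinner F G"
proof -
  have "(\<lambda>n. cinner (cscale (cinner F (basis n)) (basis n)) G) sums cinner F G"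
    by (rule bounded_linear.sums[OF cinner.bounded_linear_left basis_expansion])
  then show ?thesis by (simp add: cinner_cscale_left)
qed

subsection \<open>Trace norm by duality, and nuclear expansions\<close>

text \<open>The model is \<open>u m = V (basis m)\<close> with V a contraction: pairing Y (basis m)
  with it computes partial sums of the trace of V*Y, the quantity dual to the trace norm. Unlike
  orthonormality, the condition survives every contraction, in particular the shifts.\<close>

definition bessel :: "nat \<Rightarrow> (nat \<Rightarrow> l2) \<Rightarrow> bool" where
  "bessel N u \<longleftrightarrow> (\<forall>F. (\<Sum>m<N. (cmod (cinner F (u m)))\<^sup>2) \<le> (norm F)\<^sup>2)"

lemma bessel_basis: "bessel N basis"
  unfolding bessel_def by (intro allI bessel_inequality) (auto simp: basis_orthonormal)

lemma clin_adjoint: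
  assumes "clin A"
  shows "\<exists>B. clin B \<and> (\<forall>F G. cinner (blinfun_apply B F) G = cinner F (blinfun_apply A G)) \<and> norm B \<le> norm A"
proof -
  obtain B :: "l2 \<Rightarrow>\<^sub>L l2" where B: "\<And>F G. inner (blinfun_apply B F) G = inner F (blinfun_apply A G)" "norm B \<le> norm A"
    using blinfun_adjoint[of A] by blast
  have c: "cinner (B F) G = cinner F (A G)" for F G
    using assms by (simp add: cinner_eq_inner B(1) clin_def)
  have "clin B" unfolding clin_def
    by (intro allI cinner_eqI) (simp add: c cinner_cscale_left)
  then show ?thesis using B c by blast
qed

lemma bessel_image:
  assumes u: "bessel N u" and A: "clin A" "norm A \<le> 1"
  shows "bessel N (\<lambda>m. A (u m))"
  unfolding bessel_def
proof
  fix F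
  obtain B where B: "\<And>F G. cinner (blinfun_apply B F) G = cinner F (blinfun_apply A G)" "norm B \<le> norm A"
    using clin_adjoint[OF A(1)] by blast
  have "(\<Sum>m<N. (cmod (cinner F (A (u m))))\<^sup>2) \<le> (norm (B F))\<^sup>2"
    using u unfolding bessel_def B(1)[symmetric] by blast
  also have "norm (B F) \<le> 1 * norm F"
    by (rule order_trans[OF norm_blinfun mult_right_mono]) (use A B in auto)
  then have "(norm (B F))\<^sup>2 \<le> (norm F)\<^sup>2" by simp
  finally show "(\<Sum>m<N. (cmod (cinner F (A (u m))))\<^sup>2) \<le> (norm F)\<^sup>2" .
qed

text \<open>Cauchy-Schwarz for finite sums. In terms of duality, the operator taking H to <H, G> F
  has trace norm at most |F| |G|.\<close>

lemma bessel_rank_one: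
  assumes e: "bessel N e" and u: "bessel N u"
  shows "cmod (\<Sum>m<N. cinner (e m) G * cinner F (u m)) \<le> norm F * norm G"
proof -
  have b: "L2_set (\<lambda>m. cmod (cinner H (w m))) {..<N} \<le> norm H" if "bessel N w" for H w
    using that unfolding L2_set_def bessel_def by (simp add: real_le_lsqrt sum_nonneg)
  have "cmod (\<Sum>m<N. cinner (e m) G * cinner F (u m)) \<le> (\<Sum>m<N. \<bar>cmod (cinner G (e m))\<bar> * \<bar>cmod (cinner F (u m))\<bar>)"
    by (rule order_trans[OF norm_sum sum_mono]) (subst cinner_commute, simp add: norm_mult)
  also have "\<dots> \<le> L2_set (\<lambda>m. cmod (cinner G (e m))) {..<N} * L2_set (\<lambda>m. cmod (cinner F (u m))) {..<N}"
    by (rule L2_set_mult_ineq)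
  also have "\<dots> \<le> norm G * norm F" by (intro mult_mono b e u) auto
  finally show ?thesis by (simp add: mult.commute)
qed

lemma polar_coisometry_clin:
  assumes "clin A" "clin P" "\<And>F G. cinner (P F) (P G) = cinner (A F) (A G)"
  shows "\<exists>W. clin W \<and> norm W \<le> 1 \<and> (\<forall>F. blinfun_apply W (A F) = P F) \<and>
    (\<forall>F G. cinner (P F) (blinfun_apply W G) = cinner (A F) G)"
proof -
  have "inner (P F) (P G) = inner (A F) (A G)" for F G by (simp add: inner_eq_Re_cinner assms)
  from polar_coisometry[of P A, OF this]
  obtain W :: "l2 \<Rightarrow>\<^sub>L l2" where W: "\<And>G. norm (blinfun_apply W G) \<le> norm G" "\<And>F. blinfun_apply W (A F) = P F"
     "\<And>F G. inner (P F) (blinfun_apply W G) = inner (A F) G"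
     "\<And>J :: l2 \<Rightarrow>\<^sub>L l2. \<lbrakk>\<And>x y. inner (J x) y = - inner x (J y); \<And>x. J (A x) = A (J x); \<And>x. J (P x) = P (J x)\<rbrakk>
       \<Longrightarrow> \<forall>x. J (blinfun_apply W x) = W (J x)"
    by metis
  have cW: "clin W" unfolding clin_iff_imul
    by (rule W(4)) (use assms(1,2) in \<open>simp_all only: inner_imul clin_iff_imul\<close>)
  moreover have "norm W \<le> 1" by (rule norm_blinfun_bound) (simp_all add: W)
  moreover have "cinner (P F) (W G) = cinner (A F) G" for F G
    using cW by (intro cinner_eq_from_inner) (simp_all add: W clin_def)
  ultimately show ?thesis using W(2) by blast
qed

text \<open>With P = W A the absolute value and V the adjoint of W, <A e, V e> = <P e, e>. The
  partial sums of the trace of P are thus among the sums that the hypothesis bounds.\<close>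

lemma trace_norm_le:
  assumes A: "represents A Y"
    and bound: "\<And>N u. bessel N u \<Longrightarrow> cmod (\<Sum>m<N. cinner (A (basis m)) (u m)) \<le> C"
  shows "trace_norm Y \<le> ennreal C"
proof -
  obtain P where P: "represents P (abs_op Y)" "\<And>F G. cinner (blinfun_apply P F) (blinfun_apply P G) = cinner (A F) (A G)"
    "\<And>F. 0 \<le> inner (blinfun_apply P F) F"
    using abs_op_represented[OF A] by blast
  obtain W where W: "clin W" "norm W \<le> 1" "\<And>F. blinfun_apply W (A F) = P F"
    using polar_coisometry_clin[OF _ _ P(2)] A P(1) by (metis represents_def)
  obtain V where V: "clin V" "\<And>F G. cinner (blinfun_apply V F) G = cinner F (blinfun_apply W G)" "norm V \<le> norm W"
    using clin_adjoint[OF W(1)] by blast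
  have tm: "Re (ip (abs_op Y (the_onb n)) (the_onb n)) = inner (P (basis n)) (basis n)" for n
    using represents_ip[OF P(1) the_onb_L2 the_onb_L2] by (simp add: basis_def inner_eq_Re_cinner)
  have "(\<Sum>n<N. ennreal (inner (P (basis n)) (basis n))) \<le> ennreal C" for N
  proof -
    have "bessel N (\<lambda>m. V (basis m))" using V W by (intro bessel_image bessel_basis) auto
    then have "cmod (\<Sum>m<N. cinner (A (basis m)) (V (basis m))) \<le> C" by (rule bound)
    moreover have "cinner (A (basis m)) (V (basis m)) = cinner (P (basis m)) (basis m)" for m
      by (metis V(2) W(3) cinner_commute)
    ultimately have "cmod (\<Sum>m<N. cinner (P (basis m)) (basis m)) \<le> C" by simp
    then have "(\<Sum>m<N. inner (P (basis m)) (basis m)) \<le> C"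
      using complex_Re_le_cmod[of "\<Sum>m<N. cinner (P (basis m)) (basis m)"] by (simp add: inner_eq_Re_cinner)
    then show ?thesis by (subst sum_ennreal) (auto simp: P intro: ennreal_leI)
  qed
  then show ?thesis unfolding trace_norm_def trace_pos_def tm by (intro suminf_le_const) auto
qed

text \<open>A is the sum of the rank one operators taking F to <F, psi n> phi n, with summable trace
  norms. The convergence is stated on coefficients because only coefficients are summed and
  integrated later.\<close>

definition nuclear :: "(l2 \<Rightarrow>\<^sub>L l2) \<Rightarrow> (nat \<Rightarrow> l2) \<Rightarrow> (nat \<Rightarrow> l2) \<Rightarrow> bool" where
  "nuclear A \<phi> \<psi> \<longleftrightarrow> summable (\<lambda>n. norm (\<phi> n) * norm (\<psi> n)) \<and>
     (\<forall>F G. (\<lambda>n. cinner F (\<psi> n) * cinner (\<phi> n) G) sums cinner (A F) G)"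

text \<open>Write A = V Q Q with Q the root of |A| and V the partial isometry, and insert the basis
  between the two factors Q. Then |psi n|^2 = <|A| e, e> for the n-th basis vector e, which has
  finite sum; the spectrum of |A| does not enter.\<close>

lemma nuclear_exists:
  assumes X: "X \<in> S1" and A: "represents A X"
  shows "\<exists>\<phi> \<psi>. nuclear A \<phi> \<psi>"
proof -
  obtain P where P: "represents P (abs_op X)" "\<And>F G. cinner (blinfun_apply P F) (blinfun_apply P G) = cinner (A F) (A G)"
    "\<And>F G. cinner (blinfun_apply P F) G = cinner F (blinfun_apply P G)" "\<And>F. 0 \<le> inner (blinfun_apply P F) F"
    using abs_op_represented[OF A] by blast
  have cP: "clin P" using P(1) by (simp add: represents_def)
  obtain Q where Q: "clin Q" "\<And>F G. cinner (blinfun_apply Q F) G = cinner F (blinfun_apply Q G)"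
    "\<And>F. blinfun_apply Q (blinfun_apply Q F) = P F"
    using positive_sqrt_clin[OF cP _ P(4)] P(3) by (metis inner_eq_Re_cinner)
  obtain W where W: "clin W" "norm W \<le> 1" "\<And>F G. cinner (P F) (blinfun_apply W G) = cinner (A F) G"
    using polar_coisometry_clin[OF _ cP P(2)] A by (metis represents_def)
  obtain V where V: "\<And>F G. cinner (blinfun_apply V F) G = cinner F (blinfun_apply W G)" "norm V \<le> norm W"
    using clin_adjoint[OF W(1)] by blast
  have "(\<Sum>n. ennreal (inner (P (basis n)) (basis n))) = trace_norm X"
    unfolding trace_norm_def trace_pos_def
    using represents_ip[OF P(1) the_onb_L2 the_onb_L2] by (simp add: basis_def inner_eq_Re_cinner)
  then have summ: "summable (\<lambda>n. inner (P (basis n)) (basis n))"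
    using X P(4) by (intro summable_suminf_not_top) (auto simp: S1_def)
  define \<psi> where "\<psi> n = Q (basis n)" for n
  define \<phi> where "\<phi> n = V (\<psi> n)" for n
  have \<psi>2: "norm (\<psi> n) * norm (\<psi> n) = inner (P (basis n)) (basis n)" for n
    using Q(2)[of "Q (basis n)" "basis n"]
    by (simp add: \<psi>_def Q(3) inner_eq_Re_cinner cinner_self power2_eq_square)
  have "norm (\<phi> n) \<le> 1 * norm (\<psi> n)" for n
    unfolding \<phi>_def by (rule order_trans[OF norm_blinfun mult_right_mono]) (use V W in auto)
  then have "norm (\<phi> n) * norm (\<psi> n) \<le> inner (P (basis n)) (basis n)" for n
    unfolding \<psi>2[symmetric] by (intro mult_right_mono) auto
  then have s: "summable (\<lambda>n. norm (\<phi> n) * norm (\<psi> n))"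
    by (intro summable_comparison_test'[OF summ, of 0]) simp
  have "(\<lambda>n. cinner F (\<psi> n) * cinner (\<phi> n) G) sums cinner (A F) G" for F G
  proof -
    have "(\<lambda>n. cinner (Q F) (basis n) * cinner (basis n) (Q (W G))) sums cinner (Q F) (Q (W G))"
      by (rule parseval)
    moreover have "cinner (Q F) (Q (W G)) = cinner (A F) G" by (metis Q(2,3) W(3))
    moreover have "cinner (Q F) (basis n) * cinner (basis n) (Q (W G)) = cinner F (\<psi> n) * cinner (\<phi> n) G" for n
      by (simp add: \<psi>_def \<phi>_def V(1) Q(2))
    ultimately show ?thesis by simp
  qed
  then show ?thesis using s unfolding nuclear_def by blast
qed

lemma nuclear_bessel_sums:
  assumes "nuclear A \<phi> \<psi>"
  shows "(\<lambda>n. \<Sum>m<N. cinner (e m) (\<psi> n) * cinner (\<phi> n) (u m)) sums (\<Sum>m<N. cinner (A (e m)) (u m))"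
  using assms unfolding nuclear_def by (intro sums_sum) blast

lemma nuclear_truncation:
  assumes A: "nuclear A \<phi> \<psi>" and e: "bessel N e" and u: "bessel N u"
  shows "cmod ((\<Sum>m<N. cinner (A (e m)) (u m)) - (\<Sum>n<K. \<Sum>m<N. cinner (e m) (\<psi> n) * cinner (\<phi> n) (u m)))
    \<le> (\<Sum>n. norm (\<phi> (n + K)) * norm (\<psi> (n + K)))"
proof (rule norm_sums_le)
  show "(\<lambda>n. \<Sum>m<N. cinner (e m) (\<psi> (n + K)) * cinner (\<phi> (n + K)) (u m)) sums
     ((\<Sum>m<N. cinner (A (e m)) (u m)) - (\<Sum>n<K. \<Sum>m<N. cinner (e m) (\<psi> n) * cinner (\<phi> n) (u m)))"
    by (rule sums_split_initial_segment[OF nuclear_bessel_sums[OF A]])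
  show "(\<lambda>n. norm (\<phi> (n + K)) * norm (\<psi> (n + K))) sums (\<Sum>n. norm (\<phi> (n + K)) * norm (\<psi> (n + K)))"
    using A unfolding nuclear_def by (intro summable_sums summable_ignore_initial_segment) blast
qed (rule bessel_rank_one[OF e u])

text \<open>\<open>trace\<close> is tied to one basis. Tannery's theorem exchanges the sum over the
  basis with the nuclear sum, dominated by |phi n| |psi n| through \<open>bessel_rank_one\<close>,
  and Parseval evaluates each term.\<close>

lemma trace_nuclear:
  assumes A: "represents A X" and nuc: "nuclear A \<phi> \<psi>"
  shows "(\<lambda>n. cinner (\<phi> n) (\<psi> n)) sums trace X"
proof -
  let ?g = "\<lambda>M n. \<Sum>m<M. cinner (basis m) (\<psi> n) * cinner (\<phi> n) (basis m)"
  have summ: "summable (\<lambda>n. norm (\<phi> n) * norm (\<psi> n))" using nuc by (simp add: nuclear_def)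
  have g: "(\<lambda>n. ?g M n) sums (\<Sum>m<M. cinner (A (basis m)) (basis m))" for M
    by (rule nuclear_bessel_sums[OF nuc])
  have lim: "(\<lambda>M. ?g M n) \<longlonglongrightarrow> cinner (\<phi> n) (\<psi> n)" for n
    using parseval[of "\<phi> n" "\<psi> n"] by (simp add: sums_def mult.commute)
  have "summable (\<lambda>n. norm (cinner (\<phi> n) (\<psi> n))) \<and>
      (\<lambda>M. \<Sum>n. ?g M n) \<longlonglongrightarrow> (\<Sum>n. cinner (\<phi> n) (\<psi> n))"
    using tannerys_theorem[of "\<lambda>n M. ?g M n", OF lim _ summ]
      always_eventually[of "\<lambda>(n, M). cmod (?g M n) \<le> norm (\<phi> n) * norm (\<psi> n)"]
      bessel_rank_one[OF bessel_basis bessel_basis] by auto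
  moreover have "(\<Sum>n. ?g M n) = (\<Sum>m<M. cinner (A (basis m)) (basis m))" for M
    using g[of M] by (rule sums_unique[symmetric])
  ultimately have "(\<lambda>m. cinner (A (basis m)) (basis m)) sums (\<Sum>n. cinner (\<phi> n) (\<psi> n))"
    and s: "summable (\<lambda>n. norm (cinner (\<phi> n) (\<psi> n)))"
    by (auto simp: sums_def)
  moreover have "ip (X (the_onb m)) (the_onb m) = cinner (A (basis m)) (basis m)" for m
    using represents_ip[OF A the_onb_L2 the_onb_L2] by (simp add: basis_def)
  ultimately have "trace X = (\<Sum>n. cinner (\<phi> n) (\<psi> n))"
    unfolding trace_def by (simp add: sums_iff)
  then show ?thesis using summable_sums[OF summable_norm_cancel[OF s]] by simp
qed

subsection \<open>A band-limited kernel\<close>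

text \<open>Up to scaling Fejer's kernel, 2 sin(a t/2)^2 / t^2. Division by zero gives the value 0
  at t = 0 instead of the continuous value a^2/2, which no integral notices.\<close>

definition cos_quot :: "real \<Rightarrow> real \<Rightarrow> real" where "cos_quot a t = (1 - cos (a * t)) / t\<^sup>2"

definition cos_const :: real where "cos_const = (\<integral>t. cos_quot 1 t \<partial>lborel)"

lemma cos_quot_measurable [measurable]: "cos_quot a \<in> borel_measurable borel"
  unfolding cos_quot_def by measurable

lemma cos_quot_nonneg: "0 \<le> cos_quot a t"
  by (simp add: cos_quot_def)

lemma cos_quot_1_le: "cos_quot 1 t \<le> 4 * inverse (1 + t\<^sup>2)"
proof (cases "t = 0")
  case False
  \<comment> \<open>The constant 4 comes from t^2 > 1, where 1 - cos t \<le> 2 and 1 + t^2 \<le> 2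
    t^2.\<close>
  have a: "(1 - cos t) * (1 + t\<^sup>2) \<le> 4 * t\<^sup>2"
  proof (cases "t\<^sup>2 \<le> 1")
    case True
    have s: "\<bar>sin (t/2)\<bar> \<le> \<bar>t/2\<bar>" by (rule abs_sin_x_le_abs_x)
    have "1 - cos t = 2 * (sin (t/2))\<^sup>2" using cos_double_sin[of "t/2"] by simp
    also have "\<dots> \<le> 2 * (t/2)\<^sup>2" using s by (simp only: abs_le_square_iff)
    finally have "1 - cos t \<le> t\<^sup>2 / 2" by (simp add: power2_eq_square)
    then have "(1 - cos t) * (1 + t\<^sup>2) \<le> t\<^sup>2 / 2 * 2" using True by (intro mult_mono) auto
    then show ?thesis using zero_le_power2[of t] by linarith
  next
    case False
    have "(1 - cos t) * (1 + t\<^sup>2) \<le> 2 * (1 + t\<^sup>2)" by (intro mult_right_mono) (use cos_ge_minus_one[of t] in auto)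
    then show ?thesis using False by simp
  qed
  have "1 + t\<^sup>2 > 0" by (simp add: add_pos_nonneg)
  then show ?thesis using a False by (simp add: cos_quot_def field_simps)
qed (simp add: cos_quot_def)

lemma integrable_cos_quot_1: "integrable lborel (cos_quot 1)"
proof (rule Bochner_Integration.integrable_bound[where f="\<lambda>t. 4 * inverse (1 + t\<^sup>2)"])
  show "integrable lborel (\<lambda>t::real. 4 * inverse (1 + t\<^sup>2))"
    using integrable_inverse_1_plus_square by (simp add: set_integrable_def)
  show "AE t in lborel. norm (cos_quot 1 t) \<le> norm (4 * inverse (1 + t\<^sup>2))"
    by (rule AE_I2) (use cos_quot_1_le cos_quot_nonneg in \<open>auto intro: order_trans\<close>)
qed simp

lemma cos_const_pos: "cos_const > 0"
proof -
  have "\<not> (AE t in lborel. cos_quot 1 t = 0)"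
  proof
    assume "AE t in lborel. cos_quot 1 t = 0"
    then have "AE t in lborel. t \<notin> {0<..<1::real}"
    proof eventually_elim
      fix t :: real assume t: "cos_quot 1 t = 0"
      show "t \<notin> {0<..<1}"
      proof
        assume "t \<in> {0<..<1}"
        then have "cos t < cos 0" by (intro cos_monotone_0_pi) (use pi_gt3 in auto)
        then show False using t \<open>t \<in> {0<..<1}\<close> by (simp add: cos_quot_def)
      qed
    qed
    then have "emeasure lborel {0<..<1::real} = 0" by (subst (asm) AE_iff_measurable[of "{0<..<1}"]) auto
    then show False by simp
  qed
  then have "cos_const \<noteq> 0"
    unfolding cos_const_def
    using integral_nonneg_eq_0_iff_AE[OF integrable_cos_quot_1] by (auto simp: cos_quot_nonneg)
  moreover have "cos_const \<ge> 0" unfolding cos_const_def by (simp add: cos_quot_nonneg)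
  ultimately show ?thesis by simp
qed

lemma cos_quot_integral:
  shows "integrable lborel (cos_quot a)" and "(\<integral>t. cos_quot a t \<partial>lborel) = \<bar>a\<bar> * cos_const"
proof -
  have "integrable lborel (cos_quot a) \<and> (\<integral>t. cos_quot a t \<partial>lborel) = \<bar>a\<bar> * cos_const"
  proof (cases "a = 0")
    case False
    have eq: "cos_quot a = (\<lambda>t. a\<^sup>2 * cos_quot 1 (0 + a * t))"
      using False by (intro ext) (simp add: cos_quot_def power_mult_distrib)
    have i: "integrable lborel (\<lambda>t. cos_quot 1 (0 + a * t))"
      using False by (intro lborel_integrable_real_affine integrable_cos_quot_1)
    define I where "I = (\<integral>t. cos_quot 1 (0 + a * t) \<partial>lborel)"
    have c: "cos_const = \<bar>a\<bar> * I"
      unfolding cos_const_def I_def using lborel_integral_real_affine[OF False, of "cos_quot 1" 0] by simp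
    have "(\<integral>t. cos_quot a t \<partial>lborel) = a\<^sup>2 * I" unfolding eq I_def by simp
    also have "\<dots> = \<bar>a\<bar> * cos_const" unfolding c by (simp add: power2_eq_square)
    finally show ?thesis using i by (subst eq) simp
  qed (simp add: cos_quot_def[abs_def])
  then show "integrable lborel (cos_quot a)" "(\<integral>t. cos_quot a t \<partial>lborel) = \<bar>a\<bar> * cos_const" by auto
qed

definition chr :: "real \<Rightarrow> complex" where "chr r = cis (- 2 * pi * r)"

lemma chr_eq_exp: "exp (- 2 * complex_of_real pi * \<i> * complex_of_real r) = chr r"
  by (simp add: chr_def cis_conv_exp mult_ac)

lemma norm_chr [simp]: "cmod (chr r) = 1" by (simp add: chr_def)

lemma chr_add: "chr (r + s) = chr r * chr s" by (simp add: chr_def cis_mult algebra_simps)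

lemma cnj_chr: "cnj (chr r) = chr (- r)" by (simp add: chr_def cis_cnj)

lemma chr_0 [simp]: "chr 0 = 1" by (simp add: chr_def)

lemma chr_measurable [measurable]: "chr \<in> borel_measurable borel"
  unfolding chr_def by (intro borel_measurable_continuous_onI continuous_intros)

text \<open>The de la Vallee Poussin kernel. Its Fourier transform is a trapezoid because
  the integral of \<open>cos_quot a\<close> is proportional to \<open>\<bar>a\<bar>\<close>; the constant need not be computed.\<close>
definition vker :: "real \<Rightarrow> real" where
  "vker t = (cos_quot (4 * pi) t - cos_quot (2 * pi) t) / (2 * pi * cos_const)"

lemma vker_measurable [measurable]: "vker \<in> borel_measurable borel"
  unfolding vker_def by measurable

lemma integrable_vker: "integrable lborel vker"
  unfolding vker_def by (intro integrable_divide Bochner_Integration.integrable_diff cos_quot_integral)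

text \<open>Modulation moves the frequencies 1 and 2 to 1+s, 1-s and 2+s, 2-s. The constant terms 1
  of the four quotients cancel, so the result is again a combination of kernels with known
  integral.\<close>

lemma vker_cos:
  "vker t * cos (2 * pi * s * t) = (cos_quot (2*pi*(2+s)) t + cos_quot (2*pi*(2-s)) t
     - cos_quot (2*pi*(1+s)) t - cos_quot (2*pi*(1-s)) t) / (4 * pi * cos_const)"
proof -
  have pr: "cos (2 * pi * k * t) * cos (2 * pi * s * t) = (cos (2*pi*(k+s)*t) + cos (2*pi*(k-s)*t)) / 2" for k
    by (simp add: cos_times_cos algebra_simps add.commute)
  have v: "vker t = (cos (2 * pi * 1 * t) - cos (2 * pi * 2 * t)) / t\<^sup>2 / (2 * pi * cos_const)"
    by (simp add: vker_def cos_quot_def diff_divide_distrib)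
  have "vker t * cos (2 * pi * s * t)
     = (cos (2 * pi * 1 * t) * cos (2 * pi * s * t) - cos (2 * pi * 2 * t) * cos (2 * pi * s * t)) / t\<^sup>2 / (2 * pi * cos_const)"
    unfolding v by (simp add: left_diff_distrib)
  also have "\<dots> = ((cos (2*pi*(1+s)*t) + cos (2*pi*(1-s)*t)) / 2 - (cos (2*pi*(2+s)*t) + cos (2*pi*(2-s)*t)) / 2) / t\<^sup>2 / (2 * pi * cos_const)"
    unfolding pr ..
  also have "\<dots> = (cos_quot (2*pi*(2+s)) t + cos_quot (2*pi*(2-s)) t
     - cos_quot (2*pi*(1+s)) t - cos_quot (2*pi*(1-s)) t) / (4 * pi * cos_const)"
    using cos_const_pos by (cases "t = 0") (simp_all add: cos_quot_def field_simps)
  finally show ?thesis .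
qed

lemma vker_minus: "vker (- t) = vker t"
  by (simp add: vker_def cos_quot_def)

text \<open>The right-hand side is 1 for |s| \<le> 1 and 0 for |s| \<ge> 2: the plateau serves
  \<open>rho_fourier\<close>, the support bound \<open>band_limited_zero\<close>. The imaginary part
  vanishes because the kernel is even.\<close>

lemma vker_fourier:
  "(\<integral>t. of_real (vker t) * chr (s * t) \<partial>lborel) = of_real ((\<bar>2+s\<bar> + \<bar>2-s\<bar> - \<bar>1+s\<bar> - \<bar>1-s\<bar>) / 2)"
proof -
  let ?F = "\<lambda>t. complex_of_real (vker t) * chr (s * t)"
  have int: "integrable lborel ?F"
    by (rule Bochner_Integration.integrable_bound[OF integrable_vker]) (auto simp: norm_mult)
  have "Re (\<integral>t. ?F t \<partial>lborel) = (\<integral>t. vker t * cos (2 * pi * s * t) \<partial>lborel)"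
    using integral_Re[OF int] by (simp add: chr_def mult.assoc)
  also have "\<dots> = (\<bar>2*pi*(2+s)\<bar> * cos_const + \<bar>2*pi*(2-s)\<bar> * cos_const - \<bar>2*pi*(1+s)\<bar> * cos_const
      - \<bar>2*pi*(1-s)\<bar> * cos_const) / (4 * pi * cos_const)"
    unfolding vker_cos by (simp add: cos_quot_integral)
  also have "\<dots> = (\<bar>2+s\<bar> + \<bar>2-s\<bar> - \<bar>1+s\<bar> - \<bar>1-s\<bar>) / 2"
    using cos_const_pos unfolding abs_mult by (simp add: field_simps)
  finally have re: "Re (\<integral>t. ?F t \<partial>lborel) = (\<bar>2+s\<bar> + \<bar>2-s\<bar> - \<bar>1+s\<bar> - \<bar>1-s\<bar>) / 2" .
  have "Im (\<integral>t. ?F t \<partial>lborel) = (\<integral>t. - (vker t * sin (2 * pi * s * t)) \<partial>lborel)"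
    using integral_Im[OF int] by (simp add: chr_def mult.assoc)
  also have "(\<integral>t. - (vker t * sin (2 * pi * s * t)) \<partial>lborel) = (\<integral>t. vker t * sin (2 * pi * s * t) \<partial>lborel)"
    by (subst lborel_integral_real_affine[of "-1" _ 0]) (simp_all add: vker_minus)
  then have "(\<integral>t. - (vker t * sin (2 * pi * s * t)) \<partial>lborel) = 0" by simp
  finally have "Im (\<integral>t. ?F t \<partial>lborel) = 0" by simp
  then show ?thesis using re by (simp add: complex_eq_iff)
qed

definition vdil :: "nat \<Rightarrow> real \<Rightarrow> real" where
  "vdil n t = vker (t / real (Suc n)) / real (Suc n)"

lemma vdil_affine: "vdil n = (\<lambda>t. (1 / real (Suc n)) * vker (0 + (1 / real (Suc n)) * t))"
  by (auto simp: vdil_def)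

lemma vdil_measurable [measurable]: "vdil n \<in> borel_measurable borel"
  unfolding vdil_affine by measurable

lemma integrable_vdil: "integrable lborel (vdil n)"
  unfolding vdil_affine by (intro integrable_mult_right lborel_integrable_real_affine integrable_vker) simp

lemma vdil_rescale:
  fixes f :: "real \<Rightarrow> 'a :: {banach, second_countable_topology}"
  shows "(\<integral>t. f (t / real (Suc n)) /\<^sub>R real (Suc n) \<partial>lborel) = (\<integral>t. f t \<partial>lborel)"
  using lborel_integral_real_affine[of "1 / real (Suc n)" f 0] by (simp add: inverse_eq_divide)

lemma vdil_L1: "(\<integral>t. \<bar>vdil n t\<bar> \<partial>lborel) = (\<integral>t. \<bar>vker t\<bar> \<partial>lborel)"
  using vdil_rescale[where n=n and f="\<lambda>t. \<bar>vker t\<bar>"] by (simp add: vdil_def abs_mult divide_inverse mult.commute)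

lemma vdil_fourier:
  "(\<integral>t. of_real (vdil n t) * chr (s * t) \<partial>lborel) =
    of_real ((\<bar>2 + real (Suc n) * s\<bar> + \<bar>2 - real (Suc n) * s\<bar> - \<bar>1 + real (Suc n) * s\<bar> - \<bar>1 - real (Suc n) * s\<bar>) / 2)"
proof -
  have "complex_of_real (vdil n t) * chr (s * t) =
    (of_real (vker (t / real (Suc n))) * chr (real (Suc n) * s * (t / real (Suc n)))) /\<^sub>R real (Suc n)" for t
    by (simp add: vdil_def scaleR_conv_of_real del: of_nat_Suc) (simp add: field_simps)
  then show ?thesis
    using vdil_rescale[where n=n and f="\<lambda>t. complex_of_real (vker t) * chr (real (Suc n) * s * t)"]
    by (simp only: vker_fourier)
qed

text \<open>Rescaling turns the shift c into c / Suc n, and translation is continuous in L1. The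
  latter follows from Scheffe's lemma: the translates converge almost everywhere and have equal
  norms.\<close>

lemma vdil_translation:
  "(\<lambda>n. \<integral>t. \<bar>vdil n (t + c) - vdil n t\<bar> \<partial>lborel) \<longlonglongrightarrow> 0"
proof -
  define h where "h n = c / real (Suc n)" for n
  have h: "h \<longlonglongrightarrow> 0"
    unfolding h_def using tendsto_mult_right_zero[OF LIMSEQ_inverse_real_of_nat, of c] by (simp add: divide_inverse)
  have ih: "integrable lborel (\<lambda>t. vker (h n + 1 * t))" for n
    by (intro lborel_integrable_real_affine integrable_vker) simp
  have eq: "(\<integral>t. \<bar>vdil n (t + c) - vdil n t\<bar> \<partial>lborel) = (\<integral>t. norm (vker (h n + 1 * t) - vker t) \<partial>lborel)" for n
    using vdil_rescale[where n=n and f="\<lambda>t. \<bar>vker (h n + t) - vker t\<bar>"]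
    by (simp add: vdil_def h_def abs_mult divide_inverse mult.commute ring_distribs add.commute flip: left_diff_distrib right_diff_distrib)
  have "(\<lambda>n. \<integral>\<^sup>+ t. norm (vker (h n + 1 * t) - vker t) \<partial>lborel) \<longlonglongrightarrow> 0"
  proof (rule Scheffe_lemma2)
    show "AE t in lborel. (\<lambda>n. vker (h n + 1 * t)) \<longlonglongrightarrow> vker t"
      \<comment> \<open>The division convention makes \<open>vker\<close> 0 at the origin, so
        continuity is claimed only away from it.\<close>
      using AE_lborel_singleton[of 0]
    proof eventually_elim
      fix t :: real assume "t \<noteq> 0"
      then have "isCont vker t" unfolding vker_def cos_quot_def
        using cos_const_pos by (intro continuous_intros) auto
      moreover have "(\<lambda>n. h n + 1 * t) \<longlonglongrightarrow> 0 + 1 * t" by (intro tendsto_intros h)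
      ultimately show "(\<lambda>n. vker (h n + 1 * t)) \<longlonglongrightarrow> vker t" using isCont_tendsto_compose by fastforce
    qed
    show "(\<integral>\<^sup>+ t. norm (vker (h n + 1 * t)) \<partial>lborel) \<le> (\<integral>\<^sup>+ t. norm (vker t) \<partial>lborel)" for n
      using nn_integral_real_affine[of "\<lambda>t. ennreal (norm (vker t))" 1 "h n"] by simp
  qed (use integrable_vker in auto)
  moreover have "(\<integral>\<^sup>+ t. norm (vker (h n + 1 * t) - vker t) \<partial>lborel) = ennreal (\<integral>t. norm (vker (h n + 1 * t) - vker t) \<partial>lborel)" for n
    by (rule nn_integral_eq_integral) (use ih[of n] integrable_vker in auto)
  ultimately have "(\<lambda>n. ennreal (\<integral>t. norm (vker (h n + 1 * t) - vker t) \<partial>lborel)) \<longlonglongrightarrow> ennreal 0" by simp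
  then have "(\<lambda>n. \<integral>t. norm (vker (h n + 1 * t) - vker t) \<partial>lborel) \<longlonglongrightarrow> 0"
    by (subst (asm) tendsto_ennreal_iff) auto
  then show ?thesis unfolding eq .
qed

subsection \<open>The phase-space shifts and the module action\<close>

text \<open>This is S = M_x T_-y for z = (x, y), and z . X = S*XS. Matrix coefficients of z . X are
  therefore coefficients of X at shifted vectors.\<close>

definition shift_fn :: "real \<times> real \<Rightarrow> fn \<Rightarrow> fn" where
  "shift_fn z f t = chr (fst z * t) * f (t + snd z)"

lemma shift_fn_L2:
  assumes "f \<in> L2" shows "shift_fn z f \<in> L2"
    and "(\<integral>t. (cmod (shift_fn z f t))\<^sup>2 \<partial>lborel) = (\<integral>t. (cmod (f t))\<^sup>2 \<partial>lborel)"
proof -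
  have [measurable]: "f \<in> borel_measurable borel" using assms by (rule L2_measurable)
  have n: "(\<lambda>t. (cmod (shift_fn z f t))\<^sup>2) = (\<lambda>t. (cmod (f (snd z + 1 * t)))\<^sup>2)"
    by (auto simp: shift_fn_def norm_mult add.commute)
  show "shift_fn z f \<in> L2"
  proof (rule L2I)
    show "shift_fn z f \<in> borel_measurable borel" unfolding shift_fn_def by measurable
    show "integrable lborel (\<lambda>t. (cmod (shift_fn z f t))\<^sup>2)"
      unfolding n by (rule lborel_integrable_real_affine[OF L2_integrable[OF assms]]) simp
  qed
  show "(\<integral>t. (cmod (shift_fn z f t))\<^sup>2 \<partial>lborel) = (\<integral>t. (cmod (f t))\<^sup>2 \<partial>lborel)"
    unfolding n using lborel_integral_real_affine[of 1 "\<lambda>t. (cmod (f t))\<^sup>2" "snd z"] by simp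
qed

definition shift :: "real \<times> real \<Rightarrow> l2 \<Rightarrow>\<^sub>L l2" where
  "shift z = Blinfun (\<lambda>F. abs_l2 (shift_fn z (rep_l2 F)))"

lemma shift_abs: "f \<in> L2 \<Longrightarrow> shift z (abs_l2 f) = abs_l2 (shift_fn z f)"
  and norm_shift: "norm (shift z F) = norm F"
  and clin_shift: "clin (shift z)"
proof -
  let ?S = "\<lambda>F. abs_l2 (shift_fn z (rep_l2 F))"
  have nrm: "norm (abs_l2 (shift_fn z f)) = norm (abs_l2 f)" if "f \<in> L2" for f
    using shift_fn_L2[OF that, of z] by (simp add: l2norm_eq_norm[symmetric] that l2norm_def)
  have S: "?S (abs_l2 f) = abs_l2 (shift_fn z f)" if f: "f \<in> L2" for f
  proof -
    \<comment> \<open>A representative of the class of f differs from f by a function of norm 0, and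
      the shift preserves norms; hence the value does not depend on the representative.\<close>
    define d where "d t = rep_l2 (abs_l2 f) t - f t" for t
    have d: "d \<in> L2" unfolding d_def by (intro L2_diff f rep_l2_L2)
    have "shift_fn z d = (\<lambda>t. shift_fn z (rep_l2 (abs_l2 f)) t - shift_fn z f t)"
      by (auto simp: shift_fn_def d_def right_diff_distrib)
    then have "?S (abs_l2 f) - abs_l2 (shift_fn z f) = abs_l2 (shift_fn z d)"
      by (simp add: l2_abs_simps shift_fn_L2 f)
    also have "norm \<dots> = norm (abs_l2 d)" by (rule nrm[OF d])
    also have "abs_l2 d = 0"
      unfolding d_def using l2_abs_simps(2)[OF rep_l2_L2 f, of "abs_l2 f"] by simp
    finally show ?thesis by simp
  qed
  have add: "?S (F + G) = ?S F + ?S G" for F G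
  proof -
    obtain f g where fg: "f \<in> L2" "F = abs_l2 f" "g \<in> L2" "G = abs_l2 g" by (metis abs_l2_cases)
    have "shift_fn z (\<lambda>t. f t + g t) = (\<lambda>t. shift_fn z f t + shift_fn z g t)"
      by (auto simp: shift_fn_def distrib_left)
    then show ?thesis by (simp add: fg l2_abs_simps S L2_add shift_fn_L2)
  qed
  have scale: "?S (cscale a F) = cscale a (?S F)" for a F
  proof -
    obtain f where fg: "f \<in> L2" "F = abs_l2 f" by (metis abs_l2_cases)
    have "shift_fn z (\<lambda>t. a * f t) = (\<lambda>t. a * shift_fn z f t)"
      by (auto simp: shift_fn_def)
    then show ?thesis by (simp add: fg l2_abs_simps S L2_scale shift_fn_L2)
  qed
  have nS: "norm (?S F) = norm F" for F using nrm[OF rep_l2_L2, of F] by simp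
  have "bounded_linear ?S"
    by (rule bounded_linear_intro[where K=1]) (simp_all add: add scale scaleR_eq_cscale nS)
  then have app: "shift z F = ?S F" for F by (simp add: shift_def bounded_linear_Blinfun_apply)
  show "f \<in> L2 \<Longrightarrow> shift z (abs_l2 f) = abs_l2 (shift_fn z f)" by (simp add: app S)
  show "norm (shift z F) = norm F" by (simp add: app nS)
  show "clin (shift z)" by (simp add: clin_def app scale)
qed

lemma shift_cscale: "shift z (cscale a F) = cscale a (shift z F)"
  using clin_shift by (simp add: clin_def)

lemma norm_shift_le_1: "norm (shift z) \<le> 1"
  by (rule norm_blinfun_bound) (simp_all add: norm_shift)

lemma bessel_shift: "bessel N u \<Longrightarrow> bessel N (\<lambda>m. shift z (u m))"
  by (rule bessel_image[OF _ clin_shift norm_shift_le_1])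

lemma cinner_shift:
  "cinner (shift z F) G = (\<integral>t. chr (fst z * t) * rep_l2 F (t + snd z) * cnj (rep_l2 G t) \<partial>lborel)"
  using l2_abs_simps(4)[OF shift_fn_L2(1)[OF rep_l2_L2, of z F] rep_l2_L2[of G]] shift_abs[OF rep_l2_L2, of z F]
  by (simp add: ip_def shift_fn_def)

lemma rep_l2_measurable [measurable]: "rep_l2 F \<in> borel_measurable borel"
  by (rule L2_measurable) simp

lemma cinner_shift_measurable [measurable]:
  "(\<lambda>z. cinner (shift z F) G) \<in> borel_measurable borel"
  "(\<lambda>z. cinner G (shift z F)) \<in> borel_measurable borel"
proof -
  show 1: "(\<lambda>z. cinner (shift z F) G) \<in> borel_measurable borel"
    unfolding cinner_shift
  proof (rule lborel.borel_measurable_lebesgue_integral)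
    have "(\<lambda>(z, t). chr (fst z * t) * rep_l2 F (t + snd z) * cnj (rep_l2 G t))
        \<in> borel_measurable ((borel \<Otimes>\<^sub>M borel) \<Otimes>\<^sub>M borel)" by measurable
    also have "borel_measurable (((borel :: real measure) \<Otimes>\<^sub>M (borel :: real measure)) \<Otimes>\<^sub>M (borel :: real measure))
        = borel_measurable (borel \<Otimes>\<^sub>M lborel)"
      by (intro measurable_cong_sets sets_pair_measure_cong) (simp only: borel_prod | simp)+
    finally show "(\<lambda>(z, t). chr (fst z * t) * rep_l2 F (t + snd z) * cnj (rep_l2 G t))
        \<in> borel_measurable (borel \<Otimes>\<^sub>M lborel)" .
  qed
  show "(\<lambda>z. cinner G (shift z F)) \<in> borel_measurable borel"
    by (subst cinner_commute) (use 1 in measurable)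
qed

lemma ip_pt_act:
  assumes A: "represents A X" and s: "s \<in> L2" and g: "g \<in> L2"
  shows "ip (pt_act z X s) g = cinner (A (shift z (abs_l2 s))) (shift z (abs_l2 g))"
proof -
  obtain x y where z: "z = (x, y)" by fastforce
  define h where "h = X (shift_fn z s)"
  have e: "Mod x (Tr (- y) s) = shift_fn z s"
    by (intro ext) (simp only: Mod_def Tr_def shift_fn_def z chr_eq_exp fst_conv snd_conv diff_minus_eq_add)
  have "pt_act z X s t = chr (- (x * (t - y))) * h (t - y)" for t
  proof -
    have "pt_act z X s = Tr y (Mod (- x) (X (Mod x (Tr (- y) s))))" by (simp add: pt_act_def z)
    also have "\<dots> = Tr y (Mod (- x) h)" unfolding e h_def ..
    finally show ?thesis by (simp only: Tr_def Mod_def chr_eq_exp) simp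
  qed
  then have "ip (pt_act z X s) g = (\<integral>t. chr (- (x * (t - y))) * h (t - y) * cnj (g t) \<partial>lborel)"
    by (simp add: ip_def)
  also have "\<dots> = (\<integral>t. h t * cnj (shift_fn z g t) \<partial>lborel)"
    by (subst lborel_integral_real_affine[of 1 _ y])
       (auto simp: shift_fn_def z cnj_chr mult_ac add.commute intro!: Bochner_Integration.integral_cong)
  also have "\<dots> = ip h (shift_fn z g)" by (simp add: ip_def)
  also have "\<dots> = cinner (A (abs_l2 (shift_fn z s))) (abs_l2 (shift_fn z g))"
    unfolding h_def by (rule represents_ip[OF A]) (intro shift_fn_L2 s g)+
  finally show ?thesis by (simp add: shift_abs s g)
qed

text \<open>Both arguments of the form move with z. The nuclear expansion exhibits it as a pointwise
  limit of finite sums of products in which only one argument moves.\<close>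

lemma shifted_coefficient_measurable:
  assumes "nuclear A \<phi> \<psi>"
  shows "(\<lambda>z. cinner (A (shift z F)) (shift z G)) \<in> borel_measurable borel"
proof (rule borel_measurable_LIMSEQ_metric)
  show "(\<lambda>z. \<Sum>n<N. cinner (shift z F) (\<psi> n) * cinner (\<phi> n) (shift z G)) \<in> borel_measurable borel" for N
    by measurable
  show "(\<lambda>N. \<Sum>n<N. cinner (shift z F) (\<psi> n) * cinner (\<phi> n) (shift z G)) \<longlonglongrightarrow> cinner (A (shift z F)) (shift z G)" for z
    using assms by (simp add: nuclear_def sums_def)
qed

lemma shifted_coefficient_integrable:
  assumes "nuclear A \<phi> \<psi>" and q: "integrable lborel q"
  shows "integrable lborel (\<lambda>z. q z * cinner (A (shift z F)) (shift z G))"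
proof (rule Bochner_Integration.integrable_bound[where f="\<lambda>z. norm (q z) * (norm A * norm F * norm G)"])
  show "AE z in lborel. norm (q z * cinner (A (shift z F)) (shift z G)) \<le> norm (norm (q z) * (norm A * norm F * norm G))"
  proof (rule AE_I2)
    fix z
    have "cmod (cinner (A (shift z F)) (shift z G)) \<le> norm (A (shift z F)) * norm (shift z G)" by (rule norm_cinner_le)
    also have "\<dots> \<le> norm A * norm F * norm G"
      using norm_blinfun[of A "shift z F"] by (simp add: norm_shift mult_right_mono)
    finally show "norm (q z * cinner (A (shift z F)) (shift z G)) \<le> norm (norm (q z) * (norm A * norm F * norm G))"
      by (simp add: norm_mult mult_left_mono)
  qed
qed (use q shifted_coefficient_measurable[OF assms(1)] in \<open>auto intro!: borel_measurable_times\<close>)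

text \<open>The weak integral is a bounded sesquilinear form, so it comes from an operator, which
  justifies the choice in \<open>mod_act\<close>; whichever operator is chosen has these
  coefficients.\<close>

lemma mod_act_represented:
  assumes A: "represents A X" and nuc: "nuclear A \<phi> \<psi>" and q: "integrable lborel q"
  shows "\<exists>B. represents B (mod_act q X) \<and>
    (\<forall>F G. cinner (blinfun_apply B F) G = (\<integral>z. q z * cinner (A (shift z F)) (shift z G) \<partial>lborel))"
proof -
  define c where "c F G = (\<integral>z. q z * cinner (A (shift z F)) (shift z G) \<partial>lborel)" for F G
  note int = shifted_coefficient_integrable[OF nuc q]
  have clA: "A (cscale a F) = cscale a (A F)" for a F using A by (simp add: represents_def clin_def)
  have cadd: "c (F + F') G = c F G + c F' G" "c F (G + G') = c F G + c F G'" for F F' G G'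
    unfolding c_def by (simp_all add: blinfun.add_right cinner_add_left cinner_add_right distrib_left int)
  have cscale: "c (cscale a F) G = a * c F G" "c F (cscale a G) = cnj a * c F G" for a F G
    unfolding c_def by (simp_all add: shift_cscale clA cinner_cscale_left cinner_cscale_right mult.left_commute)
  have cbound: "cmod (c F G) \<le> norm F * norm G * ((\<integral>z. norm (q z) \<partial>lborel) * norm A)" for F G
  proof -
    have "cmod (c F G) \<le> (\<integral>z. norm (q z * cinner (A (shift z F)) (shift z G)) \<partial>lborel)"
      unfolding c_def by (rule integral_norm_bound)
    also have "\<dots> \<le> (\<integral>z. norm (q z) * (norm A * norm F * norm G) \<partial>lborel)"
    proof (rule integral_mono)
      show "norm (q z * cinner (A (shift z F)) (shift z G)) \<le> norm (q z) * (norm A * norm F * norm G)" for z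
      proof -
        have "cmod (cinner (A (shift z F)) (shift z G)) \<le> norm (A (shift z F)) * norm (shift z G)" by (rule norm_cinner_le)
        also have "\<dots> \<le> norm A * norm F * norm G"
          using norm_blinfun[of A "shift z F"] by (simp add: norm_shift mult_right_mono)
        finally show ?thesis by (simp add: norm_mult mult_left_mono)
      qed
    qed (use q int in auto)
    finally show ?thesis by (simp add: mult_ac)
  qed
  have "bounded_bilinear (\<lambda>F G. Re (c F G))"
  proof
    show "\<exists>K. \<forall>F G. norm (Re (c F G)) \<le> norm F * norm G * K"
      using cbound abs_Re_le_cmod order_trans by (metis real_norm_def)
  qed (simp_all add: cadd cscale scaleR_eq_cscale)
  then obtain B :: "l2 \<Rightarrow>\<^sub>L l2" where B: "\<And>F G. Re (c F G) = inner (blinfun_apply B F) G"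
    using riesz_bilinear by blast
  have Bc: "cinner (B F) G = c F G" for F G
    by (simp add: cinner_eq_inner B[symmetric] cscale complex_eq_iff)
  have "clin B" unfolding clin_def
    by (intro allI cinner_eqI) (simp add: Bc cinner_cscale_left cscale)
  then have rB: "represents B (op_of B)" by (rule represents_op_of)
  have act: "ip (pt_act z X s) g = cinner (A (shift z (abs_l2 s))) (shift z (abs_l2 g))" if "s \<in> L2" "g \<in> L2" for s g z
    by (rule ip_pt_act[OF A that])
  have "is_mod_act q X (op_of B)"
    unfolding is_mod_act_def
    using represents_bounded_op[OF rB] by (simp add: represents_ip[OF rB] Bc c_def act)
  then have M: "is_mod_act q X (mod_act q X)" unfolding mod_act_def by (rule someI[where P="is_mod_act q X"])
  then obtain C where C: "represents C (mod_act q X)"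
    using bounded_op_represented unfolding is_mod_act_def by blast
  have "cinner (C F) G = c F G" for F G
    using M represents_ip[OF C rep_l2_L2 rep_l2_L2, of F G] act[OF rep_l2_L2 rep_l2_L2]
    unfolding is_mod_act_def by (simp add: c_def)
  then show ?thesis by (intro exI[of _ C]) (simp add: C c_def)
qed

section \<open>The product kernel on phase space\<close>

lemma integrable_product_pair:
  fixes f g :: "real \<Rightarrow> 'a :: {real_normed_field, banach, second_countable_topology}"
  assumes f: "integrable lborel f" and g: "integrable lborel g"
  shows "integrable (lborel \<Otimes>\<^sub>M lborel) (\<lambda>(x, y). f x * g y)"
proof (rule lborel_pair.Fubini_integrable)
  have [measurable]: "f \<in> borel_measurable borel" "g \<in> borel_measurable borel" using f g by auto
  show "(\<lambda>(x, y). f x * g y) \<in> borel_measurable (lborel \<Otimes>\<^sub>M lborel)" by measurable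
  show "integrable lborel (\<lambda>x. \<integral>y. norm (case (x, y) of (x, y) \<Rightarrow> f x * g y) \<partial>lborel)"
    using f by (simp add: norm_mult)
qed (use g in simp)

lemma integral_product_pair:
  fixes f g :: "real \<Rightarrow> 'a :: {real_normed_field, banach, second_countable_topology}"
  assumes f: "integrable lborel f" and g: "integrable lborel g"
  shows "integrable (lborel :: (real \<times> real) measure) (\<lambda>z. f (fst z) * g (snd z))"
    and "(\<integral>z. f (fst z) * g (snd z) \<partial>lborel) = (\<integral>x. f x \<partial>lborel) * (\<integral>y. g y \<partial>lborel)"
proof -
  note i = integrable_product_pair[OF f g]
  show "integrable (lborel :: (real \<times> real) measure) (\<lambda>z. f (fst z) * g (snd z))"
    using i by (simp add: lborel_prod split_beta')
  show "(\<integral>z. f (fst z) * g (snd z) \<partial>lborel) = (\<integral>x. f x \<partial>lborel) * (\<integral>y. g y \<partial>lborel)"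
    using lborel_pair.integral_fst[OF i] by (simp add: lborel_prod split_beta')
qed

definition rho :: "nat \<Rightarrow> real \<times> real \<Rightarrow> complex" where
  "rho n z = of_real (vdil n (fst z)) * of_real (vdil n (snd z))"

definition vnorm :: real where "vnorm = (\<integral>t. \<bar>vker t\<bar> \<partial>lborel)"

lemma integrable_rho: "integrable lborel (rho n)"
  unfolding rho_def using integrable_vdil by (intro integral_product_pair) auto

lemma rho_L1: "(\<integral>z. norm (rho n z) \<partial>lborel) = vnorm\<^sup>2"
  unfolding rho_def norm_mult norm_of_real
  by (subst integral_product_pair) (use integrable_vdil vdil_L1 in \<open>auto simp: vnorm_def power2_eq_square\<close>)

lemma rho_fourier:
  assumes "\<bar>real (Suc n) * x\<bar> \<le> 1" "\<bar>real (Suc n) * y\<bar> \<le> 1"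
  shows "fourier2 (rho n) (x, y) = 1"
proof -
  let ?V = "\<lambda>s t. complex_of_real (vdil n t) * chr (s * t)"
  have i: "integrable lborel (?V s)" for s
    by (rule Bochner_Integration.integrable_bound[OF integrable_vdil]) (auto simp: norm_mult)
  have one: "(\<integral>t. ?V s t \<partial>lborel) = 1" if "\<bar>real (Suc n) * s\<bar> \<le> 1" for s
    unfolding vdil_fourier using that by (simp add: abs_if del: of_nat_Suc split: if_splits)
  have "fourier2 (rho n) (x, y) = (\<integral>z. ?V x (fst z) * ?V y (snd z) \<partial>lborel)"
    unfolding fourier2_def prod.case chr_eq_exp rho_def chr_add by (simp add: mult_ac)
  also have "\<dots> = 1"
    using integral_product_pair(2)[OF i[of x] i[of y]] one[OF assms(1)] one[OF assms(2)] by simp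
  finally show ?thesis .
qed

text \<open>Only the second coordinate is moved, the one in which \<open>shift\<close> translates
  functions; the first factor contributes just its L1 norm.\<close>

lemma rho_translation:
  "(\<lambda>n. \<integral>z. norm (rho n (z - (0, c)) - rho n z) \<partial>lborel) \<longlonglongrightarrow> 0"
proof -
  have "(\<integral>z. norm (rho n (z - (0, c)) - rho n z) \<partial>lborel) = vnorm * (\<integral>t. \<bar>vdil n (t + - c) - vdil n t\<bar> \<partial>lborel)" for n
  proof -
    have i: "integrable lborel (\<lambda>t. vdil n (- c + 1 * t))"
      by (intro lborel_integrable_real_affine integrable_vdil) simp
    have "norm (rho n (z - (0, c)) - rho n z) = \<bar>vdil n (fst z)\<bar> * \<bar>vdil n (snd z + - c) - vdil n (snd z)\<bar>" for z
      unfolding rho_def by (simp add: right_diff_distrib[symmetric] norm_mult flip: of_real_diff)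
    then have "(\<integral>z. norm (rho n (z - (0, c)) - rho n z) \<partial>lborel)
        = (\<integral>z. \<bar>vdil n (fst z)\<bar> * \<bar>vdil n (snd z + - c) - vdil n (snd z)\<bar> \<partial>lborel)" by simp
    also have "\<dots> = (\<integral>t. \<bar>vdil n t\<bar> \<partial>lborel) * (\<integral>t. \<bar>vdil n (t + - c) - vdil n t\<bar> \<partial>lborel)"
      by (rule integral_product_pair(2)) (use i integrable_vdil[of n] in \<open>auto simp: add.commute\<close>)
    finally show ?thesis by (simp add: vdil_L1 vnorm_def)
  qed
  then show ?thesis using tendsto_mult_right_zero[OF vdil_translation[of "- c"], of vnorm] by simp
qed

text \<open>Integrating out the modulation variable multiplies the kernel \<open>f t * g s\<close> by the Fourier transform
  of \<open>vdil n\<close> at \<open>t - s\<close>, which vanishes off a strip of width \<open>2 / Suc n\<close> around the diagonal.\<close>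
lemma band_limited_zero:
  fixes f g :: "real \<Rightarrow> complex"
  assumes f: "integrable lborel f" and g: "integrable lborel g"
    and sep: "\<And>t s. f t \<noteq> 0 \<Longrightarrow> g s \<noteq> 0 \<Longrightarrow> 2 \<le> real (Suc n) * \<bar>t - s\<bar>"
  shows "(\<integral>x. of_real (vdil n x) * ((\<integral>t. chr (x * t) * f t \<partial>lborel) * (\<integral>s. chr (- (x * s)) * g s \<partial>lborel)) \<partial>lborel) = 0"
proof -
  have [measurable]: "f \<in> borel_measurable borel" "g \<in> borel_measurable borel" using f g by auto
  have v: "integrable lborel (\<lambda>x. complex_of_real (vdil n x))" using integrable_vdil by auto
  define G where "G x = (\<integral>s. chr (- (x * s)) * g s \<partial>lborel)" for x
  have Gm [measurable]: "G \<in> borel_measurable borel"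
  proof -
    have "G \<in> borel_measurable lborel" unfolding G_def
      by (rule lborel.borel_measurable_lebesgue_integral) measurable
    then show ?thesis by simp
  qed
  have Gb: "cmod (G x) \<le> (\<integral>s. cmod (g s) \<partial>lborel)" for x
    unfolding G_def by (rule order_trans[OF integral_norm_bound]) (simp add: norm_mult)
  \<comment> \<open>A common majorant for the two applications of Fubini, one in (x, s) and one in
    (x, t).\<close>
  have bnd: "integrable (lborel \<Otimes>\<^sub>M lborel) (\<lambda>(x, t). k x t)"
    if h: "integrable lborel h" and km: "(\<lambda>(x, t). k x t) \<in> borel_measurable (lborel \<Otimes>\<^sub>M lborel)"
      and le: "\<And>x t. cmod (k x t) \<le> C * (cmod (of_real (vdil n x)) * cmod (h t))"
    for h :: "real \<Rightarrow> complex" and k :: "real \<Rightarrow> real \<Rightarrow> complex" and C :: real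
  proof (rule Bochner_Integration.integrable_bound[OF _ km])
    show "integrable (lborel \<Otimes>\<^sub>M lborel) (\<lambda>z. C * (case z of (x, t) \<Rightarrow> cmod (complex_of_real (vdil n x)) * cmod (h t)))"
      by (intro integrable_mult_right integrable_product_pair integrable_norm v h)
    show "AE z in lborel \<Otimes>\<^sub>M lborel. norm (case z of (x, t) \<Rightarrow> k x t)
        \<le> norm (C * (case z of (x, t) \<Rightarrow> cmod (complex_of_real (vdil n x)) * cmod (h t)))"
      by (rule AE_I2) (use order_trans[OF le abs_ge_self] in auto)
  qed
  \<comment> \<open>For t in the support of f, integrating over x first leaves the Fourier transform
    at t - s times g s. Handling s with t fixed avoids a triple integral.\<close>
  have inner: "f t * (\<integral>x. of_real (vdil n x) * (chr (x * t) * G x) \<partial>lborel) = 0" for t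
  proof (cases "f t = 0")
    case False
    have i: "integrable (lborel \<Otimes>\<^sub>M lborel) (\<lambda>(x, s). complex_of_real (vdil n x) * (chr (x * t) * (chr (- (x * s)) * g s)))"
      by (rule bnd[OF g, where C=1]) (measurable, simp add: norm_mult)
    have "(\<integral>x. of_real (vdil n x) * (chr (x * t) * G x) \<partial>lborel)
        = (\<integral>x. \<integral>s. of_real (vdil n x) * (chr (x * t) * (chr (- (x * s)) * g s)) \<partial>lborel \<partial>lborel)"
      unfolding G_def by simp
    also have "\<dots> = (\<integral>s. \<integral>x. of_real (vdil n x) * (chr (x * t) * (chr (- (x * s)) * g s)) \<partial>lborel \<partial>lborel)"
      by (simp only: lborel_pair.integral_fst[OF i] lborel_pair.integral_snd[OF i])
    also have "\<dots> = (\<integral>(s::real). 0 \<partial>lborel)"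
    proof (rule Bochner_Integration.integral_cong[OF refl])
      fix s
      have "chr (x * t) * chr (- (x * s)) = chr ((t - s) * x)" for x
        unfolding chr_add[symmetric] by (simp add: algebra_simps)
      then have "of_real (vdil n x) * (chr (x * t) * (chr (- (x * s)) * g s)) = of_real (vdil n x) * chr ((t - s) * x) * g s" for x
        by (simp add: mult.assoc[symmetric])
      then have "(\<integral>x. of_real (vdil n x) * (chr (x * t) * (chr (- (x * s)) * g s)) \<partial>lborel)
         = (\<integral>x. of_real (vdil n x) * chr ((t - s) * x) \<partial>lborel) * g s"
        by (simp only: integral_mult_left_zero)
      also have "\<dots> = 0"
      proof (cases "g s = 0")
        case g0: False
        have r: "2 \<le> \<bar>real (Suc n) * (t - s)\<bar>" using sep[OF False g0] by (simp add: abs_mult)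
        have "\<bar>2 + r\<bar> + \<bar>2 - r\<bar> - \<bar>1 + r\<bar> - \<bar>1 - r\<bar> = 0" if "2 \<le> \<bar>r\<bar>" for r :: real
          using that by linarith
        then have "(\<integral>x. of_real (vdil n x) * chr ((t - s) * x) \<partial>lborel) = 0"
          unfolding vdil_fourier by (simp only: r div_0 of_real_0)
        then show ?thesis by simp
      qed simp
      finally show "(\<integral>x. of_real (vdil n x) * (chr (x * t) * (chr (- (x * s)) * g s)) \<partial>lborel) = 0" .
    qed
    finally show ?thesis by simp
  qed simp
  have i: "integrable (lborel \<Otimes>\<^sub>M lborel) (\<lambda>(x, t). complex_of_real (vdil n x) * (chr (x * t) * f t * G x))"
  proof (rule bnd[OF f, where C="\<integral>s. cmod (g s) \<partial>lborel"])
    show "cmod (of_real (vdil n x) * (chr (x * t) * f t * G x))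
        \<le> (\<integral>s. cmod (g s) \<partial>lborel) * (cmod (of_real (vdil n x)) * cmod (f t))" for x t
      using mult_left_mono[OF Gb[of x], of "cmod (of_real (vdil n x)) * cmod (f t)"]
      by (simp add: norm_mult mult_ac)
  qed measurable
  have "(\<integral>x. of_real (vdil n x) * ((\<integral>t. chr (x * t) * f t \<partial>lborel) * G x) \<partial>lborel)
      = (\<integral>x. \<integral>t. of_real (vdil n x) * (chr (x * t) * f t * G x) \<partial>lborel \<partial>lborel)"
    by simp
  also have "\<dots> = (\<integral>t. \<integral>x. of_real (vdil n x) * (chr (x * t) * f t * G x) \<partial>lborel \<partial>lborel)"
    by (simp only: lborel_pair.integral_fst[OF i] lborel_pair.integral_snd[OF i])
  also have "\<dots> = (\<integral>t. f t * (\<integral>x. of_real (vdil n x) * (chr (x * t) * G x) \<partial>lborel) \<partial>lborel)"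
  proof (rule Bochner_Integration.integral_cong[OF refl])
    show "(\<integral>x. of_real (vdil n x) * (chr (x * t) * f t * G x) \<partial>lborel)
        = f t * (\<integral>x. of_real (vdil n x) * (chr (x * t) * G x) \<partial>lborel)" for t
      by (subst integral_mult_right_zero[symmetric]) (simp add: mult_ac)
  qed
  also have "\<dots> = 0" by (simp only: inner) simp
  finally show ?thesis unfolding G_def .
qed

subsection \<open>Averages of rank one operators\<close>

text \<open>\<open>avg n N u F G\<close> is \<open>\<Sum>m<N. \<langle>Y (basis m), u m\<rangle>\<close> for the average \<open>Y\<close> of the rank one operator
  \<open>H \<mapsto> \<langle>H, G\<rangle> F\<close> against \<open>rho n\<close>; \<open>coefsum\<close> is the integrand.\<close>
definition coefsum :: "nat \<Rightarrow> (nat \<Rightarrow> l2) \<Rightarrow> l2 \<Rightarrow> l2 \<Rightarrow> real \<times> real \<Rightarrow> complex" where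
  "coefsum N u F G z = (\<Sum>m<N. cinner (shift z (basis m)) G * cinner F (shift z (u m)))"

definition avg :: "nat \<Rightarrow> nat \<Rightarrow> (nat \<Rightarrow> l2) \<Rightarrow> l2 \<Rightarrow> l2 \<Rightarrow> complex" where
  "avg n N u F G = (\<integral>z. rho n z * coefsum N u F G z \<partial>lborel)"

lemma coefsum_measurable [measurable]: "coefsum N u F G \<in> borel_measurable borel"
  unfolding coefsum_def by measurable

lemma coefsum_bound: "bessel N u \<Longrightarrow> cmod (coefsum N u F G z) \<le> norm F * norm G"
  unfolding coefsum_def by (intro bessel_rank_one bessel_shift bessel_basis)

lemma integrable_times_coefficient:
  fixes q :: "real \<times> real \<Rightarrow> complex"
  assumes "integrable lborel q"
  shows "integrable lborel (\<lambda>z. q z * (cinner (shift z P) G * cinner F (shift z Q)))"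
proof (rule Bochner_Integration.integrable_bound[where f="\<lambda>z. norm (q z) * (norm P * norm G * (norm F * norm Q))"])
  show "AE z in lborel. norm (q z * (cinner (shift z P) G * cinner F (shift z Q))) \<le> norm (norm (q z) * (norm P * norm G * (norm F * norm Q)))"
  proof (rule AE_I2)
    fix z
    have "cmod (cinner (shift z P) G) * cmod (cinner F (shift z Q)) \<le> norm P * norm G * (norm F * norm Q)"
      using norm_cinner_le[of "shift z P" G] norm_cinner_le[of F "shift z Q"]
      by (intro mult_mono) (simp_all add: norm_shift)
    then show "norm (q z * (cinner (shift z P) G * cinner F (shift z Q))) \<le> norm (norm (q z) * (norm P * norm G * (norm F * norm Q)))"
      by (simp add: norm_mult mult_left_mono)
  qed
qed (use assms in \<open>auto intro!: borel_measurable_times\<close>)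

lemma integrable_times_coefsum:
  "integrable lborel q \<Longrightarrow> integrable lborel (\<lambda>z. q z * coefsum N u F G z)"
  unfolding coefsum_def sum_distrib_left by (intro Bochner_Integration.integrable_sum integrable_times_coefficient)

lemma integral_times_coefsum_bound:
  assumes q: "integrable lborel q" and u: "bessel N u"
  shows "cmod (\<integral>z. q z * coefsum N u F G z \<partial>lborel) \<le> (\<integral>z. norm (q z) \<partial>lborel) * (norm F * norm G)"
proof -
  have "cmod (\<integral>z. q z * coefsum N u F G z \<partial>lborel) \<le> (\<integral>z. norm (q z * coefsum N u F G z) \<partial>lborel)"
    by (rule integral_norm_bound)
  also have "\<dots> \<le> (\<integral>z. norm (q z) * (norm F * norm G) \<partial>lborel)"
  proof (rule integral_mono)
    show "integrable lborel (\<lambda>z. norm (q z * coefsum N u F G z))"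
      by (rule integrable_norm[OF integrable_times_coefsum[OF q]])
    show "norm (q z * coefsum N u F G z) \<le> norm (q z) * (norm F * norm G)" for z
      by (simp add: norm_mult mult_left_mono coefsum_bound[OF u])
  qed (use q in simp)
  finally show ?thesis by simp
qed

lemma avg_bound: "bessel N u \<Longrightarrow> cmod (avg n N u F G) \<le> vnorm\<^sup>2 * (norm F * norm G)"
  unfolding avg_def using integral_times_coefsum_bound[OF integrable_rho] by (simp add: rho_L1)

lemma avg_linear:
  "avg n N u (F + F') G = avg n N u F G + avg n N u F' G"
  "avg n N u F (G + G') = avg n N u F G + avg n N u F G'"
  "avg n N u (cscale a F) G = a * avg n N u F G"
  "avg n N u F (cscale a G) = cnj a * avg n N u F G"
proof -
  have "coefsum N u (F + F') G z = coefsum N u F G z + coefsum N u F' G z"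
    "coefsum N u F (G + G') z = coefsum N u F G z + coefsum N u F G' z"
    "coefsum N u (cscale a F) G z = a * coefsum N u F G z"
    "coefsum N u F (cscale a G) z = cnj a * coefsum N u F G z" for z
    unfolding coefsum_def
    by (simp_all add: cinner_add_left cinner_add_right cinner_cscale_left cinner_cscale_right
        algebra_simps sum.distrib sum_distrib_left)
  then show "avg n N u (F + F') G = avg n N u F G + avg n N u F' G"
    "avg n N u F (G + G') = avg n N u F G + avg n N u F G'"
    "avg n N u (cscale a F) G = a * avg n N u F G"
    "avg n N u F (cscale a G) = cnj a * avg n N u F G"
    unfolding avg_def
    by (simp_all add: distrib_left integrable_times_coefsum[OF integrable_rho] mult.left_commute)
qed

text \<open>Convergence to 0 in trace norm, expressed by duality: n0 must not depend on N or u,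
  since \<open>trace_norm_le\<close> needs one bound for all test families.\<close>

definition vanishes :: "(nat \<Rightarrow> nat \<Rightarrow> (nat \<Rightarrow> l2) \<Rightarrow> complex) \<Rightarrow> bool" where
  "vanishes H \<longleftrightarrow> (\<forall>e>0. \<exists>n0. \<forall>n\<ge>n0. \<forall>N u. bessel N u \<longrightarrow> cmod (H n N u) \<le> e)"

lemma vanishesD:
  assumes "vanishes H" "0 < e" shows "\<exists>n. \<forall>N u. bessel N u \<longrightarrow> cmod (H n N u) \<le> e"
proof -
  obtain n where "\<forall>m\<ge>n. \<forall>N u. bessel N u \<longrightarrow> cmod (H m N u) \<le> e"
    using assms unfolding vanishes_def by blast
  then have "\<forall>N u. bessel N u \<longrightarrow> cmod (H n N u) \<le> e" by simp
  then show ?thesis ..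
qed

lemma vanishes_limit:
  assumes "\<And>e. e > 0 \<Longrightarrow> \<exists>H'. vanishes H' \<and> (\<forall>n N u. bessel N u \<longrightarrow> cmod (H n N u - H' n N u) \<le> e)"
  shows "vanishes H"
  unfolding vanishes_def
proof (intro allI impI)
  fix e :: real assume "e > 0"
  then obtain H' where H': "vanishes H'" "\<And>n N u. bessel N u \<Longrightarrow> cmod (H n N u - H' n N u) \<le> e/2"
    using assms[of "e/2"] by auto
  then obtain n0 where n0: "\<And>n N u. n \<ge> n0 \<Longrightarrow> bessel N u \<Longrightarrow> cmod (H' n N u) \<le> e/2"
    using \<open>e > 0\<close> unfolding vanishes_def by (meson half_gt_zero)
  have "cmod (H n N u) \<le> e" if "n \<ge> n0" "bessel N u" for n N u
    using H'(2)[OF that(2), of n] n0[OF that] norm_triangle_ineq[of "H n N u - H' n N u" "H' n N u"] by simp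
  then show "\<exists>n0. \<forall>n\<ge>n0. \<forall>N u. bessel N u \<longrightarrow> cmod (H n N u) \<le> e" by blast
qed

lemma vanishes_add:
  assumes "vanishes H" "vanishes H'" shows "vanishes (\<lambda>n N u. H n N u + H' n N u)"
  unfolding vanishes_def
proof (intro allI impI)
  fix e :: real assume "e > 0"
  then obtain n0 n1 where n: "\<And>n N u. n \<ge> n0 \<Longrightarrow> bessel N u \<Longrightarrow> cmod (H n N u) \<le> e/2"
     "\<And>n N u. n \<ge> n1 \<Longrightarrow> bessel N u \<Longrightarrow> cmod (H' n N u) \<le> e/2"
    using assms unfolding vanishes_def by (meson half_gt_zero)
  have "cmod (H n N u + H' n N u) \<le> e" if "n \<ge> max n0 n1" "bessel N u" for n N u
    using n(1)[of n N u] n(2)[of n N u] that norm_triangle_ineq[of "H n N u" "H' n N u"] by simp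
  then show "\<exists>n0. \<forall>n\<ge>n0. \<forall>N u. bessel N u \<longrightarrow> cmod (H n N u + H' n N u) \<le> e" by blast
qed

lemma vanishes_mult:
  assumes "vanishes H" shows "vanishes (\<lambda>n N u. c * H n N u)"
  unfolding vanishes_def
proof (intro allI impI)
  fix e :: real assume "e > 0"
  then have "e / (cmod c + 1) > 0" by (simp add: add_nonneg_pos)
  then obtain n0 where n0: "\<And>n N u. n \<ge> n0 \<Longrightarrow> bessel N u \<Longrightarrow> cmod (H n N u) \<le> e / (cmod c + 1)"
    using assms unfolding vanishes_def by meson
  have "cmod (c * H n N u) \<le> e" if "n \<ge> n0" "bessel N u" for n N u
  proof -
    have "cmod (c * H n N u) \<le> (cmod c + 1) * (e / (cmod c + 1))"
      unfolding norm_mult by (intro mult_mono n0 that) auto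
    also have "\<dots> = e" using add_nonneg_pos[of "cmod c" 1] by simp
    finally show ?thesis .
  qed
  then show "\<exists>n0. \<forall>n\<ge>n0. \<forall>N u. bessel N u \<longrightarrow> cmod (c * H n N u) \<le> e" by blast
qed

lemma vanishes_zero: "vanishes (\<lambda>n N u. 0)"
  by (auto simp: vanishes_def)

lemma vanishes_diff: "vanishes H \<Longrightarrow> vanishes H' \<Longrightarrow> vanishes (\<lambda>n N u. H n N u - H' n N u)"
  using vanishes_add[of H "\<lambda>n N u. -1 * H' n N u"] vanishes_mult[of H' "-1"] by simp

lemma vanishes_sum: "(\<And>k. k < (K::nat) \<Longrightarrow> vanishes (H k)) \<Longrightarrow> vanishes (\<lambda>n N u. \<Sum>k<K. H k n N u)"
  by (induction K) (auto intro: vanishes_zero vanishes_add)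

subsection \<open>Separated step functions\<close>

lemma cinner_shift_step:
  "cinner (shift (x, y) P) (step a b) = (\<integral>t. chr (x * t) * (rep_l2 P (t + y) * indicator {a..<b} t) \<partial>lborel)"
proof -
  have "cinner (shift (x, y) P) (step a b) = ip (shift_fn (x, y) (rep_l2 P)) (indicator {a..<b})"
    unfolding step_def using shift_abs[OF rep_l2_L2, of "(x, y)" P]
    by (simp add: l2_abs_simps shift_fn_L2 indicator_L2)
  then show ?thesis by (simp add: ip_def shift_fn_def cnj_indicator mult.assoc)
qed

lemma integrable_shift_step: "integrable lborel (\<lambda>t. rep_l2 P (t + y) * indicator {a..<b} t)"
  using L2_mult_integrable[OF shift_fn_L2(1)[OF rep_l2_L2, of "(0, y)" P] indicator_L2, of a b]
  by (simp add: shift_fn_def cnj_indicator)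

text \<open>For fixed y the x-integrand is the kernel times two Fourier integrals, of functions
  supported in [c, d) and [a, b). Their distance is at least h, and 2 \<le> (n+1) h puts every
  difference t - s outside the support of the dilated trapezoid.\<close>

lemma avg_separated:
  assumes sep: "b + h \<le> c \<or> d + h \<le> a" and n: "2 \<le> real (Suc n) * h" and h: "h > 0"
  shows "avg n N u (step a b) (step c d) = 0"
proof -
  have zero: "(\<integral>z. rho n z * (cinner (shift z P) (step c d) * cinner (step a b) (shift z Q)) \<partial>lborel) = 0" for P Q
  proof -
    let ?k = "\<lambda>x y. rho n (x, y) * (cinner (shift (x, y) P) (step c d) * cinner (step a b) (shift (x, y) Q))"
    have i: "integrable (lborel \<Otimes>\<^sub>M lborel) (\<lambda>(x, y). ?k x y)"
      using integrable_times_coefficient[OF integrable_rho[of n], of P "step c d" "step a b" Q]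
      by (simp add: lborel_prod split_beta')
    have "(\<integral>x. ?k x y \<partial>lborel) = 0" for y
    proof -
      let ?f = "\<lambda>t. rep_l2 P (t + y) * indicator {c..<d} t"
      let ?g = "\<lambda>s. cnj (rep_l2 Q (s + y) * indicator {a..<b} s)"
      have g: "cinner (step a b) (shift (x, y) Q) = (\<integral>s. chr (- (x * s)) * ?g s \<partial>lborel)" for x
      proof -
        have "cinner (step a b) (shift (x, y) Q) = cnj (cinner (shift (x, y) Q) (step a b))" by (rule cinner_commute)
        also have "\<dots> = (\<integral>s. cnj (chr (x * s) * (rep_l2 Q (s + y) * indicator {a..<b} s)) \<partial>lborel)"
          unfolding cinner_shift_step by (rule Bochner_Integration.integral_cnj[symmetric])
        finally show ?thesis by (simp add: cnj_chr)
      qed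
      have "(\<integral>x. of_real (vdil n x) * ((\<integral>t. chr (x * t) * ?f t \<partial>lborel) * (\<integral>s. chr (- (x * s)) * ?g s \<partial>lborel)) \<partial>lborel) = 0"
      proof (rule band_limited_zero)
        show "integrable lborel ?f" by (rule integrable_shift_step)
        show "integrable lborel ?g" by (rule integrable_cnj[OF integrable_shift_step])
        fix t s assume "?f t \<noteq> 0" "?g s \<noteq> 0"
        then have "t \<in> {c..<d}" "s \<in> {a..<b}" by (auto simp: indicator_def split: if_splits)
        then have "h \<le> \<bar>t - s\<bar>" using sep by auto
        then have "real (Suc n) * h \<le> real (Suc n) * \<bar>t - s\<bar>" by (intro mult_left_mono) auto
        then show "2 \<le> real (Suc n) * \<bar>t - s\<bar>" using n by linarith
      qed
      then have "of_real (vdil n y) * (\<integral>x. of_real (vdil n x) * ((\<integral>t. chr (x * t) * ?f t \<partial>lborel) * (\<integral>s. chr (- (x * s)) * ?g s \<partial>lborel)) \<partial>lborel) = 0"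
        by simp
      then show ?thesis
        unfolding g cinner_shift_step rho_def integral_mult_right_zero[symmetric] by (simp only: fst_conv snd_conv mult_ac)
    qed
    then have "(\<integral>y. \<integral>x. ?k x y \<partial>lborel \<partial>lborel) = 0" by simp
    then have "(\<integral>(x, y). ?k x y \<partial>(lborel \<Otimes>\<^sub>M lborel)) = 0" using lborel_pair.integral_snd[OF i] by simp
    then show ?thesis by (simp add: lborel_prod split_beta')
  qed
  show ?thesis
    unfolding avg_def coefsum_def sum_distrib_left
    by (subst Bochner_Integration.integral_sum) (auto intro: integrable_times_coefficient integrable_rho simp: zero)
qed

lemma vanishes_separated:
  assumes "h > 0" "b + h \<le> c \<or> d + h \<le> a"
  shows "vanishes (\<lambda>n N u. avg n N u (step a b) (step c d))"
proof -
  obtain n0 where n0: "2 < real n0 * h" using reals_Archimedean3[OF assms(1)] by blast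
  have "avg n N u (step a b) (step c d) = 0" if "n \<ge> n0" for n N u
  proof (rule avg_separated[OF assms(2) _ assms(1)])
    have "real n0 * h \<le> real (Suc n) * h" using that assms(1) by (intro mult_right_mono) auto
    then show "2 \<le> real (Suc n) * h" using n0 by linarith
  qed
  then show ?thesis unfolding vanishes_def by (auto intro!: exI[of _ n0])
qed

text \<open>Touching intervals are the case that halving produces. Removing a short piece creates a
  gap at a cost proportional to the norm of the piece, uniformly in n by
  \<open>avg_bound\<close>.\<close>

lemma vanishes_disjoint:
  assumes "a \<le> b" "c \<le> d" and disj: "b \<le> c \<or> d \<le> a"
  shows "vanishes (\<lambda>n N u. avg n N u (step a b) (step c d))"
proof (cases "a < b")
  case False
  then have "step a b = cscale 0 (step a b)" using assms by (simp add: step_empty cscale_simps)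
  then have "avg n N u (step a b) (step c d) = 0" for n N u by (metis avg_linear(3) mult_zero_left)
  then show ?thesis by (simp add: vanishes_zero)
next
  case True
  show ?thesis
  proof (rule vanishes_limit)
    fix e :: real assume "e > 0"
    define C where "C = vnorm\<^sup>2 * norm (step c d)"
    have C: "C \<ge> 0" by (simp add: C_def)
    \<comment> \<open>Half the length keeps the remaining interval nonempty. The other bound ensures
      C sqrt h \<le> e, and C + 1 avoids dividing by zero.\<close>
    define h where "h = min ((b - a) / 2) ((e / (C + 1))\<^sup>2)"
    have h: "h > 0" "h < b - a" using True \<open>e > 0\<close> C by (auto simp: h_def min_def add_nonneg_pos)
    have hC: "C * sqrt h \<le> e"
    proof -
      have "sqrt h \<le> sqrt ((e / (C + 1))\<^sup>2)" by (rule real_sqrt_le_mono) (simp add: h_def)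
      also have "\<dots> = e / (C + 1)" using \<open>e > 0\<close> C by simp
      finally have "C * sqrt h \<le> C * (e / (C + 1))" using C by (rule mult_left_mono)
      also have "\<dots> \<le> e" using \<open>e > 0\<close> C by (simp add: field_simps)
      finally show ?thesis .
    qed
    \<comment> \<open>cut off a piece of length \<open>h\<close> from the first interval on the side facing the second one\<close>
    obtain a' b' S where s: "step a b = step a' b' + S" "norm S = sqrt h" "b' + h \<le> c \<or> d + h \<le> a'"
    proof (cases "b \<le> c")
      case True
      show ?thesis
      proof (rule that)
        show "step a b = step a (b - h) + step (b - h) b" using h by (subst step_add) auto
        show "norm (step (b - h) b) = sqrt h" using norm_step[of "b - h" b] h by (simp add: real_sqrt_unique)
        show "b - h + h \<le> c \<or> d + h \<le> a" using True by simp
      qed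
    next
      case False
      show ?thesis
      proof (rule that)
        show "step a b = step (a + h) b + step a (a + h)" using h step_add[of a "a + h" b] by (simp add: add.commute)
        show "norm (step a (a + h)) = sqrt h" using norm_step[of a "a + h"] h by (simp add: real_sqrt_unique)
        show "b + h \<le> c \<or> d + h \<le> a + h" using False disj by simp
      qed
    qed
    show "\<exists>H'. vanishes H' \<and> (\<forall>n N u. bessel N u \<longrightarrow> cmod (avg n N u (step a b) (step c d) - H' n N u) \<le> e)"
    proof (intro exI conjI allI impI)
      show "vanishes (\<lambda>n N u. avg n N u (step a' b') (step c d))" by (rule vanishes_separated[OF h(1) s(3)])
      fix n N u assume "bessel N u"
      then have "cmod (avg n N u S (step c d)) \<le> C * sqrt h"
        using avg_bound[of N u n S "step c d"] by (simp add: C_def s mult_ac)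
      then show "cmod (avg n N u (step a b) (step c d) - avg n N u (step a' b') (step c d)) \<le> e"
        using hC by (simp add: s avg_linear)
    qed
  qed
qed

subsection \<open>Translations\<close>

lemma shift_step: "shift (0, - c) (step a b) = step (a + c) (b + c)"
proof -
  have "shift_fn (0, - c) (indicator {a..<b}) = indicator {a + c..<b + c}"
    by (rule ext) (auto simp: shift_fn_def indicator_def)
  then show ?thesis unfolding step_def by (simp add: shift_abs indicator_L2)
qed

text \<open>The Weyl commutation relation: moving a translation past a modulation produces the phase
  \<open>chr (x * c)\<close>.\<close>

lemma cinner_shift_translate:
  "cinner (shift (x, y) P) (shift (0, - c) G) = chr (x * c) * cinner (shift (x, y + c) P) G"
proof -
  have "cinner (shift (x, y) P) (shift (0, - c) G) = ip (shift_fn (x, y) (rep_l2 P)) (shift_fn (0, - c) (rep_l2 G))"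
    using shift_abs[OF rep_l2_L2, of "(x, y)" P] shift_abs[OF rep_l2_L2, of "(0, - c)" G]
    by (simp add: l2_abs_simps shift_fn_L2)
  also have "\<dots> = (\<integral>t. chr (x * t) * rep_l2 P (t + y) * cnj (rep_l2 G (t - c)) \<partial>lborel)"
    by (simp add: ip_def shift_fn_def)
  also have "\<dots> = (\<integral>t. chr (x * c) * (chr (x * t) * rep_l2 P (t + (y + c)) * cnj (rep_l2 G t)) \<partial>lborel)"
    by (subst lborel_integral_real_affine[of 1 _ c], simp, simp only: abs_one scaleR_one mult_1,
        rule Bochner_Integration.integral_cong[OF refl]) (simp add: distrib_left chr_add add_ac mult.assoc)
  also have "\<dots> = chr (x * c) * cinner (shift (x, y + c) P) G"
    by (simp add: cinner_shift)
  finally show ?thesis .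
qed

text \<open>The Weyl phases of the two factors are conjugate and cancel. Translating F and G
  together thus only translates the integrand in phase space.\<close>

lemma coefsum_translate:
  "coefsum N u (shift (0, - c) F) (shift (0, - c) G) z = coefsum N u F G ((0, c) + z)"
proof -
  obtain x y where z: "z = (x, y)" by fastforce
  have r: "cinner (shift (0, - c) F) (shift (x, y) Q) = chr (- (x * c)) * cinner F (shift (x, y + c) Q)" for Q
    by (subst (1 2) cinner_commute) (simp add: cinner_shift_translate cnj_chr)
  have c: "chr (x * c) * chr (- (x * c)) = 1" by (simp add: chr_add[symmetric])
  have k: "chr (x * c) * p * (chr (- (x * c)) * q) = p * q" for p q
  proof -
    have "chr (x * c) * p * (chr (- (x * c)) * q) = chr (x * c) * chr (- (x * c)) * (p * q)" by (simp only: mult_ac)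
    then show ?thesis by (simp only: c mult_1)
  qed
  have "(0, c) + z = (x, y + c)" by (simp add: z add.commute)
  then show ?thesis unfolding coefsum_def by (simp only: z r cinner_shift_translate k)
qed

lemma integral_translate:
  fixes f :: "real \<times> real \<Rightarrow> complex"
  assumes [measurable]: "f \<in> borel_measurable borel"
  shows "(\<integral>z. f (w + z) \<partial>lborel) = (\<integral>z. f z \<partial>lborel)"
proof -
  have "(\<integral>z. f z \<partial>lborel) = (\<integral>z. f z \<partial>distr lborel borel ((+) w))" by (simp add: lborel_distr_plus)
  also have "\<dots> = (\<integral>z. f (w + z) \<partial>lborel)" by (rule integral_distr) simp_all
  finally show ?thesis by simp
qed

text \<open>A change of variables passes the translation from the vectors to \<open>rho n\<close>,
  so the difference is at most the L1 distance of \<open>rho n\<close> from its translate, times |F|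
  |G|.\<close>

lemma vanishes_translation:
  "vanishes (\<lambda>n N u. avg n N u (shift (0, - c) F) (shift (0, - c) G) - avg n N u F G)"
  unfolding vanishes_def
proof (intro allI impI)
  fix e :: real assume "e > 0"
  define C where "C = norm F * norm G + 1"
  have C: "C > 0" by (simp add: C_def add_nonneg_pos)
  obtain n0 where n0: "\<And>n. n \<ge> n0 \<Longrightarrow> norm ((\<integral>z. norm (rho n (z - (0, c)) - rho n z) \<partial>lborel) - 0) < e / C"
    using LIMSEQ_D[OF rho_translation, of "e / C" c] \<open>e > 0\<close> C by auto
  have "cmod (avg n N u (shift (0, - c) F) (shift (0, - c) G) - avg n N u F G) \<le> e" if n: "n \<ge> n0" and u: "bessel N u" for n N u
  proof -
    have i: "integrable lborel (\<lambda>z. rho n (z - (0, c)))"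
    proof -
      have v: "integrable lborel (\<lambda>t. complex_of_real (vdil n (- c + 1 * t)))"
        using lborel_integrable_real_affine[OF integrable_vdil[of n], of 1 "- c"] by auto
      have "integrable lborel (\<lambda>z :: real \<times> real. complex_of_real (vdil n (fst z)) * complex_of_real (vdil n (- c + 1 * snd z)))"
        by (rule integral_product_pair(1)[OF _ v]) (use integrable_vdil in auto)
      then show ?thesis by (simp add: rho_def)
    qed
    have [measurable]: "rho n \<in> borel_measurable borel" using integrable_rho[of n] by auto
    have "avg n N u (shift (0, - c) F) (shift (0, - c) G) = (\<integral>z. rho n (((0, c) + z) - (0, c)) * coefsum N u F G ((0, c) + z) \<partial>lborel)"
      unfolding avg_def coefsum_translate by simp
    also have "\<dots> = (\<integral>z. rho n (z - (0, c)) * coefsum N u F G z \<partial>lborel)"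
      by (rule integral_translate[where f="\<lambda>z. rho n (z - (0, c)) * coefsum N u F G z"]) (use i in \<open>auto intro!: borel_measurable_times\<close>)
    finally have "avg n N u (shift (0, - c) F) (shift (0, - c) G) - avg n N u F G
        = (\<integral>z. (rho n (z - (0, c)) - rho n z) * coefsum N u F G z \<partial>lborel)"
      unfolding avg_def by (simp add: left_diff_distrib integrable_times_coefsum i integrable_rho)
    also have "cmod \<dots> \<le> (\<integral>z. norm (rho n (z - (0, c)) - rho n z) \<partial>lborel) * (norm F * norm G)"
      by (rule integral_times_coefsum_bound[OF _ u]) (intro Bochner_Integration.integrable_diff i integrable_rho)
    also have "\<dots> \<le> (e / C) * C"
      using n0[OF n] by (intro mult_mono) (auto simp: C_def \<open>e > 0\<close> less_imp_le)
    finally show ?thesis using C by simp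
  qed
  then show "\<exists>n0. \<forall>n\<ge>n0. \<forall>N u. bessel N u \<longrightarrow>
      cmod (avg n N u (shift (0, - c) F) (shift (0, - c) G) - avg n N u F G) \<le> e" by blast
qed

subsection \<open>Averages only depend on the trace\<close>

text \<open>\<open>dyad 0 0\<close> is the indicator of [0, 1), a unit vector, so the reference
  operator has trace 1 and the factor \<open>cinner F G\<close> is the trace of the operator being
  averaged.\<close>

definition good :: "l2 \<Rightarrow> l2 \<Rightarrow> bool" where
  "good F G \<longleftrightarrow> vanishes (\<lambda>n N u. avg n N u F G - cinner F G * avg n N u (dyad 0 0) (dyad 0 0))"

lemma norm_dyad: "(norm (dyad k a))\<^sup>2 = 1 / 2^k"
  unfolding dyad_def by (subst norm_step) (simp_all add: divide_right_mono diff_divide_distrib[symmetric])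

lemma dyad_split: "dyad k a = dyad (Suc k) (2 * a) + dyad (Suc k) (2 * a + 1)"
proof -
  have e: "of_int a / (2::real)^k = of_int (2 * a) / 2^Suc k" "(of_int a + 1) / (2::real)^k = (of_int (2 * a + 1) + 1) / 2^Suc k"
    "(of_int (2 * a) + 1) / 2^Suc k = of_int (2 * a + 1) / (2::real)^Suc k"
    by (simp_all add: field_simps)
  show ?thesis unfolding dyad_def e
    by (rule step_add[symmetric]; intro divide_right_mono) auto
qed

lemma dyad_disjoint:
  assumes "a < b"
  shows "(of_int a + 1) / 2^k \<le> (of_int b :: real) / 2^k"
  using assms by (intro divide_right_mono) auto

lemma vanishes_dyad_disjoint:
  assumes "a \<noteq> b" shows "vanishes (\<lambda>n N u. avg n N u (dyad k a) (dyad k b))"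
  unfolding dyad_def
proof (rule vanishes_disjoint)
  show "(of_int a + 1) / 2^k \<le> (of_int b :: real) / 2^k \<or> (of_int b + 1) / 2^k \<le> (of_int a :: real) / 2^k"
    using assms dyad_disjoint[of a b k] dyad_disjoint[of b a k] by linarith
qed (auto simp: divide_right_mono)

lemma cinner_dyad: "cinner (dyad k a) (dyad k b) = (if a = b then of_real (1 / 2^k) else 0)"
proof (cases "a = b")
  case False
  then have "cinner (dyad k a) (dyad k b) = 0"
    unfolding dyad_def using dyad_disjoint[of a b k] dyad_disjoint[of b a k]
    by (intro cinner_step_disjoint) linarith
  then show ?thesis using False by simp
qed (simp add: cinner_self norm_dyad del: of_real_power)

lemma dyad_translate: "dyad k a = shift (0, - (of_int a / 2^k)) (dyad k 0)"
  unfolding dyad_def shift_step by (simp add: add_divide_distrib add.commute)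

lemma good_dyad_zero: "good (dyad k 0) (dyad k 0)"
proof (induction k)
  case 0
  show ?case by (simp add: good_def cinner_self norm_dyad vanishes_zero del: of_real_power)
next
  case (Suc k)
  let ?T = "\<lambda>a b n N u. avg n N u (dyad (Suc k) a) (dyad (Suc k) b)"
  let ?D = "\<lambda>n N u. avg n N u (dyad 0 0) (dyad 0 0)"
  have v0: "vanishes (\<lambda>n N u. avg n N u (dyad k 0) (dyad k 0) - of_real (1 / 2^k) * ?D n N u)"
    using Suc by (simp add: good_def cinner_dyad)
  have v01: "vanishes (?T 0 1)" and v10: "vanishes (?T 1 0)" by (auto intro: vanishes_dyad_disjoint)
  have v11: "vanishes (\<lambda>n N u. ?T 1 1 n N u - ?T 0 0 n N u)"
    by (subst (1 2) dyad_translate[of "Suc k" 1]) (rule vanishes_translation)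
  have "dyad k 0 = dyad (Suc k) 0 + dyad (Suc k) 1" using dyad_split[of k 0] by simp
  then have split: "avg n N u (dyad k 0) (dyad k 0) = ?T 0 0 n N u + ?T 0 1 n N u + ?T 1 0 n N u + ?T 1 1 n N u" for n N u
    by (simp add: avg_linear)
  \<comment> \<open>Up to vanishing terms, q = r = 0 and s = p for the cross terms and the two
    halves. Hence twice p is the parent average, and p inherits half of its factor.\<close>
  have alg: "1/2 * ((p + q + r + s - of_real (1 / 2^k) * d) - q - r - (s - p)) = p - of_real (1 / 2 ^ Suc k) * d"
    for p q r s d :: complex by (simp add: field_simps)
  have "vanishes (\<lambda>n N u. ?T 0 0 n N u - of_real (1 / 2 ^ Suc k) * ?D n N u)"
    using vanishes_mult[OF vanishes_diff[OF vanishes_diff[OF vanishes_diff[OF v0 v01] v10] v11], of "1/2"]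
    unfolding split alg .
  then show ?case by (simp add: good_def cinner_dyad)
qed

lemma good_dyad_same_scale: "good (dyad k a) (dyad k b)"
proof (cases "a = b")
  case True
  have "vanishes (\<lambda>n N u. (avg n N u (dyad k a) (dyad k a) - avg n N u (dyad k 0) (dyad k 0))
     + (avg n N u (dyad k 0) (dyad k 0) - cinner (dyad k 0) (dyad k 0) * avg n N u (dyad 0 0) (dyad 0 0)))"
    by (rule vanishes_add, subst (1 2) dyad_translate[of k a], rule vanishes_translation)
       (use good_dyad_zero in \<open>simp add: good_def\<close>)
  then show ?thesis using True by (simp add: good_def cinner_dyad)
next
  case False
  then show ?thesis by (simp add: good_def cinner_dyad vanishes_dyad_disjoint)
qed

lemma good_add_left:
  assumes "good F G" "good F' G" shows "good (F + F') G"
  using vanishes_add[OF assms[unfolded good_def]]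
  by (simp add: good_def avg_linear cinner_add_left algebra_simps)

lemma good_add_right:
  assumes "good F G" "good F G'" shows "good F (G + G')"
  using vanishes_add[OF assms[unfolded good_def]]
  by (simp add: good_def avg_linear cinner_add_right algebra_simps)

lemma good_cscale_left:
  assumes "good F G" shows "good (cscale a F) G"
  using vanishes_mult[OF assms[unfolded good_def], of a]
  by (simp add: good_def avg_linear cinner_cscale_left algebra_simps)

lemma good_cscale_right:
  assumes "good F G" shows "good F (cscale a G)"
  using vanishes_mult[OF assms[unfolded good_def], of "cnj a"]
  by (simp add: good_def avg_linear cinner_cscale_right algebra_simps)

text \<open>One share of vnorm^2 for each of the two terms. The bound is uniform in n, which is what
  lets \<open>good\<close> pass to limits in either argument.\<close>

lemma defect_bound:
  assumes "bessel N u"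
  shows "cmod (avg n N u F G - cinner F G * avg n N u (dyad 0 0) (dyad 0 0)) \<le> 2 * vnorm\<^sup>2 * (norm F * norm G)"
proof -
  have "norm (dyad 0 0) * norm (dyad 0 0) = 1" using norm_dyad[of 0 0] by (simp add: power2_eq_square)
  then have d: "cmod (avg n N u (dyad 0 0) (dyad 0 0)) \<le> vnorm\<^sup>2" using avg_bound[OF assms, of n "dyad 0 0" "dyad 0 0"] by simp
  have "cmod (cinner F G * avg n N u (dyad 0 0) (dyad 0 0)) \<le> (norm F * norm G) * vnorm\<^sup>2"
    unfolding norm_mult by (intro mult_mono norm_cinner_le d) auto
  then show ?thesis
    using norm_triangle_ineq4[of "avg n N u F G" "cinner F G * avg n N u (dyad 0 0) (dyad 0 0)"]
      avg_bound[OF assms, of n F G] by (simp add: mult.commute)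
qed

lemma good_closed:
  shows "closed {F. good F G}" and "closed {G. good F G}"
proof -
  let ?C = "2 * vnorm\<^sup>2"
  have lim: "\<exists>d>0. ?C * (d * norm H) \<le> e" if "e > 0" for e H
  proof (intro exI conjI)
    have p: "?C * norm H + 1 > 0" by (intro add_nonneg_pos mult_nonneg_nonneg) auto
    show "e / (?C * norm H + 1) > 0" using p that by simp
    have "?C * (e / (?C * norm H + 1) * norm H) = e * ((?C * norm H) / (?C * norm H + 1))" by simp
    also have "\<dots> \<le> e * 1" using p that by (intro mult_left_mono) auto
    finally show "?C * (e / (?C * norm H + 1) * norm H) \<le> e" by simp
  qed
  have diff: "good (F :: l2) G" if ex: "\<And>d. d > 0 \<Longrightarrow> \<exists>F'. good F' G \<and> norm (F - F') < d" for F G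
    unfolding good_def
  proof (rule vanishes_limit)
    fix e :: real assume "e > 0"
    then obtain d where d: "d > 0" "?C * (d * norm G) \<le> e" using lim by blast
    then obtain F' where F': "good F' G" "norm (F - F') < d" using ex by blast
    show "\<exists>H'. vanishes H' \<and> (\<forall>n N u. bessel N u \<longrightarrow>
       cmod (avg n N u F G - cinner F G * avg n N u (dyad 0 0) (dyad 0 0) - H' n N u) \<le> e)"
    proof (intro exI conjI allI impI)
      show "vanishes (\<lambda>n N u. avg n N u F' G - cinner F' G * avg n N u (dyad 0 0) (dyad 0 0))"
        using F'(1) by (simp add: good_def)
      fix n N u assume u: "bessel N u"
      have "avg n N u F G = avg n N u (F - F') G + avg n N u F' G" by (simp flip: avg_linear)
      then have "avg n N u F G - cinner F G * avg n N u (dyad 0 0) (dyad 0 0)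
          - (avg n N u F' G - cinner F' G * avg n N u (dyad 0 0) (dyad 0 0))
          = avg n N u (F - F') G - cinner (F - F') G * avg n N u (dyad 0 0) (dyad 0 0)"
        by (simp add: cinner.diff_left algebra_simps)
      also have "cmod \<dots> \<le> ?C * (norm (F - F') * norm G)" by (rule defect_bound[OF u])
      also have "\<dots> \<le> ?C * (d * norm G)" using F'(2) by (intro mult_left_mono mult_right_mono) auto
      finally show "cmod (avg n N u F G - cinner F G * avg n N u (dyad 0 0) (dyad 0 0)
          - (avg n N u F' G - cinner F' G * avg n N u (dyad 0 0) (dyad 0 0))) \<le> e" using d(2) by linarith
    qed
  qed
  have diff': "good (F :: l2) G" if ex: "\<And>d. d > 0 \<Longrightarrow> \<exists>G'. good F G' \<and> norm (G - G') < d" for F G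
    unfolding good_def
  proof (rule vanishes_limit)
    fix e :: real assume "e > 0"
    then obtain d where d: "d > 0" "?C * (d * norm F) \<le> e" using lim by blast
    then obtain G' where G': "good F G'" "norm (G - G') < d" using ex by blast
    show "\<exists>H'. vanishes H' \<and> (\<forall>n N u. bessel N u \<longrightarrow>
       cmod (avg n N u F G - cinner F G * avg n N u (dyad 0 0) (dyad 0 0) - H' n N u) \<le> e)"
    proof (intro exI conjI allI impI)
      show "vanishes (\<lambda>n N u. avg n N u F G' - cinner F G' * avg n N u (dyad 0 0) (dyad 0 0))"
        using G'(1) by (simp add: good_def)
      fix n N u assume u: "bessel N u"
      have "avg n N u F G = avg n N u F (G - G') + avg n N u F G'" by (simp flip: avg_linear)
      then have "avg n N u F G - cinner F G * avg n N u (dyad 0 0) (dyad 0 0)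
          - (avg n N u F G' - cinner F G' * avg n N u (dyad 0 0) (dyad 0 0))
          = avg n N u F (G - G') - cinner F (G - G') * avg n N u (dyad 0 0) (dyad 0 0)"
        by (simp add: cinner.diff_right algebra_simps)
      also have "cmod \<dots> \<le> ?C * (norm F * norm (G - G'))" by (rule defect_bound[OF u])
      also have "\<dots> \<le> ?C * (norm F * d)" using G'(2) by (intro mult_left_mono) auto
      finally show "cmod (avg n N u F G - cinner F G * avg n N u (dyad 0 0) (dyad 0 0)
          - (avg n N u F G' - cinner F G' * avg n N u (dyad 0 0) (dyad 0 0))) \<le> e" using d(2) by (simp add: mult.commute)
    qed
  qed
  have cl: "closed S" if S: "\<And>x. (\<And>d. d > 0 \<Longrightarrow> \<exists>y. y \<in> S \<and> norm (x - y) < d) \<Longrightarrow> x \<in> S" for S :: "l2 set"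
  proof (rule closure_subset_eq[THEN iffD1], rule subsetI)
    fix x assume "x \<in> closure S"
    then have x: "\<forall>e>0. \<exists>y\<in>S. dist y x < e" by (simp add: closure_approachable)
    show "x \<in> S"
    proof (rule S)
      fix d :: real assume "d > 0"
      then obtain y where y: "y \<in> S" "dist y x < d" using x by metis
      then have "norm (x - y) < d" by (simp only: dist_norm norm_minus_commute[of x y])
      then show "\<exists>y. y \<in> S \<and> norm (x - y) < d" using y(1) by (intro exI[of _ y] conjI)
    qed
  qed
  show "closed {F. good F G}" by (rule cl) (use diff in simp)
  show "closed {G. good F G}" by (rule cl) (use diff' in simp)
qed

text \<open>The residual of the real projection onto V is orthogonal to every
  \<open>dyad k a\<close> and, V being closed under multiplication by i, to its multiple by i.
  Together these give complex orthogonality, so totality applies.\<close>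

lemma closed_subspace_dyad_total:
  assumes V: "subspace V" "closed V" "\<And>a F. F \<in> V \<Longrightarrow> cscale a F \<in> V" "\<And>k a. dyad k a \<in> V"
  shows "F \<in> V"
proof -
  obtain p where p: "p \<in> V" "\<And>v. v \<in> V \<Longrightarrow> inner (F - p) v = 0"
    using closed_subspace_projection[OF V(1,2)] by blast
  have "cinner (F - p) (dyad k a) = 0" for k a
    unfolding cinner_eq_inner using p(2) V(3,4) by (simp add: complex_eq_iff)
  then have "F - p = 0" by (rule dyad_total)
  then show ?thesis using p(1) by simp
qed

lemma dyad_in_if_finer:
  assumes V: "subspace V" "\<And>b. dyad (k + j) b \<in> V"
  shows "dyad k a \<in> V"
  using V(2)
proof (induction j arbitrary: a k)
  case (Suc j)
  have "dyad (Suc k) b \<in> V" for b by (rule Suc.IH) (use Suc.prems in simp)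
  then show ?case unfolding dyad_split[of k a] using V(1) by (simp add: subspace_add)
qed simp

lemma subspace_good: "subspace {F. good F G}" "subspace {G. good F G}"
proof -
  have "avg n N u 0 G = 0" "avg n N u F 0 = 0" for n N u F G
    using avg_linear(3)[of n N u 0 0 G] avg_linear(4)[of n N u F 0 0] by (simp_all add: cscale_simps)
  then have "good 0 G" "good F 0" for F G
    by (simp_all add: good_def cinner.zero_left cinner.zero_right vanishes_zero)
  then show "subspace {F. good F G}" "subspace {G. good F G}"
    unfolding subspace_def
    by (auto simp: scaleR_eq_cscale intro: good_add_left good_add_right good_cscale_left good_cscale_right)
qed

lemma good_all: "good F G"
proof -
  \<comment> \<open>Both intervals are refined to the common scale k + l, where same-scale pairs are
    known to be good.\<close>
  have dd: "good (dyad k a) (dyad l b)" for k l a b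
  proof -
    have "dyad l b \<in> {G. good (dyad (k + l) a') G}" for a'
      by (rule dyad_in_if_finer[OF subspace_good(2), where j=k]) (simp add: good_dyad_same_scale add.commute)
    then have "dyad k a \<in> {F. good F (dyad l b)}"
      using dyad_in_if_finer[OF subspace_good(1), of k l "dyad l b" a] by simp
    then show ?thesis by simp
  qed
  have left: "good F (dyad l b)" for F l b
  proof -
    have "F \<in> {F. good F (dyad l b)}"
      by (rule closed_subspace_dyad_total[OF subspace_good(1) good_closed(1)]) (auto intro: dd good_cscale_left)
    then show ?thesis by simp
  qed
  have "G \<in> {G. good F G}"
    by (rule closed_subspace_dyad_total[OF subspace_good(2) good_closed(2)]) (auto intro: left good_cscale_right)
  then show ?thesis by simp
qed

section \<open>Passage from rank one operators to X\<close>

lemma sum_coefficients_eq_integral: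
  assumes nuc: "nuclear A \<phi> \<psi>" and q: "integrable lborel q"
    and B: "\<And>F G. cinner (blinfun_apply B F) G = (\<integral>z. q z * cinner (A (shift z F)) (shift z G) \<partial>lborel)"
  shows "integrable lborel (\<lambda>z. q z * (\<Sum>m<N. cinner (A (shift z (basis m))) (shift z (u m))))"
    and "(\<Sum>m<N. cinner (B (basis m)) (u m)) = (\<integral>z. q z * (\<Sum>m<N. cinner (A (shift z (basis m))) (shift z (u m))) \<partial>lborel)"
  unfolding sum_distrib_left
  by (auto simp: B shifted_coefficient_integrable[OF nuc q] intro!: Bochner_Integration.integrable_sum)

text \<open>At each z the truncation error is at most the nuclear tail, because shifts preserve
  Bessel families. Integration multiplies it by vnorm^2, so K can be fixed before n.\<close>

lemma mod_act_trace_bound: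
  assumes nuc: "nuclear A \<phi> \<psi>" and u: "bessel N u"
    and B: "\<And>F G. cinner (blinfun_apply B F) G = (\<integral>z. rho n z * cinner (A (shift z F)) (shift z G) \<partial>lborel)"
  shows "cmod ((\<Sum>m<N. cinner (B (basis m)) (u m)) - (\<Sum>k<K. avg n N u (\<phi> k) (\<psi> k)))
    \<le> vnorm\<^sup>2 * (\<Sum>k. norm (\<phi> (k + K)) * norm (\<psi> (k + K)))"
proof -
  let ?S = "\<lambda>z. \<Sum>m<N. cinner (A (shift z (basis m))) (shift z (u m))"
  let ?T = "\<lambda>z. \<Sum>k<K. coefsum N u (\<phi> k) (\<psi> k) z"
  let ?t = "\<Sum>k. norm (\<phi> (k + K)) * norm (\<psi> (k + K))"
  note S = sum_coefficients_eq_integral[OF nuc integrable_rho B]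
  have iT: "integrable lborel (\<lambda>z. rho n z * ?T z)"
    unfolding sum_distrib_left by (intro Bochner_Integration.integrable_sum integrable_times_coefsum integrable_rho)
  have T: "(\<Sum>k<K. avg n N u (\<phi> k) (\<psi> k)) = (\<integral>z. rho n z * ?T z \<partial>lborel)"
    unfolding avg_def sum_distrib_left
    by (subst Bochner_Integration.integral_sum) (auto intro: integrable_times_coefsum integrable_rho)
  have le: "cmod (?S z - ?T z) \<le> ?t" for z
    unfolding coefsum_def
    by (rule nuclear_truncation[OF nuc bessel_shift[OF bessel_basis] bessel_shift[OF u]])
  have i: "integrable lborel (\<lambda>z. rho n z * (?S z - ?T z))"
    using Bochner_Integration.integrable_diff[OF S(1) iT] by (simp add: right_diff_distrib)
  have "(\<Sum>m<N. cinner (B (basis m)) (u m)) - (\<Sum>k<K. avg n N u (\<phi> k) (\<psi> k)) = (\<integral>z. rho n z * (?S z - ?T z) \<partial>lborel)"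
    unfolding S(2) T by (subst Bochner_Integration.integral_diff[symmetric, OF S(1) iT]) (simp add: right_diff_distrib)
  also have "cmod \<dots> \<le> (\<integral>z. norm (rho n z * (?S z - ?T z)) \<partial>lborel)" by (rule integral_norm_bound)
  also have "\<dots> \<le> (\<integral>z. norm (rho n z) * ?t \<partial>lborel)"
  proof (rule integral_mono)
    show "integrable lborel (\<lambda>z. norm (rho n z * (?S z - ?T z)))" by (rule integrable_norm[OF i])
    show "integrable lborel (\<lambda>z. norm (rho n z) * ?t)" using integrable_norm[OF integrable_rho[of n]] by simp
    show "norm (rho n z * (?S z - ?T z)) \<le> norm (rho n z) * ?t" for z
      unfolding norm_mult by (rule mult_left_mono[OF le norm_ge_zero])
  qed
  also have "\<dots> = vnorm\<^sup>2 * ?t" by (simp add: rho_L1)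
  finally show ?thesis .
qed

theorem mainTheorem1:
  fixes X :: op and \<epsilon> :: real
  assumes "X \<in> S1" and "trace X = 0" and "\<epsilon> > 0"
  shows "\<exists>\<rho> :: (real \<times> real) \<Rightarrow> complex. integrable lborel \<rho> \<and>
           (\<exists>U. open U \<and> (0, 0) \<in> U \<and> (\<forall>w\<in>U. fourier2 \<rho> w = 1)) \<and>
           trace_norm (mod_act \<rho> X) < ennreal \<epsilon>"
proof -
  obtain A where A: "represents A X"
    using bounded_op_represented assms(1) unfolding S1_def by blast
  obtain \<phi> \<psi> where nuc: "nuclear A \<phi> \<psi>" using nuclear_exists[OF assms(1) A] by blast
  define r where "r k = norm (\<phi> k) * norm (\<psi> k)" for k
  have summ: "summable r" using nuc unfolding nuclear_def r_def by blast
  define L where "L = vnorm\<^sup>2 + 1"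
  have L: "L > 0" by (simp add: L_def add_nonneg_pos)
  \<comment> \<open>Three errors share \<epsilon>/2 equally: the nuclear tail and the partial trace
    c, each multiplied by at most vnorm^2, and the comparison of the first K averages with the
    reference. The summand 1 in L makes the division safe.\<close>
  define e where "e = \<epsilon> / (6 * L)"
  have e: "e > 0" using L assms(3) by (simp add: e_def)
  have eL: "vnorm\<^sup>2 * e \<le> \<epsilon> / 6"
  proof -
    have "vnorm\<^sup>2 * e \<le> L * e" using e by (intro mult_right_mono) (auto simp: L_def)
    then show ?thesis using L by (simp add: e_def)
  qed
  have "(\<lambda>k. cinner (\<phi> k) (\<psi> k)) sums 0" using trace_nuclear[OF A nuc] assms(2) by simp
  then have "(\<lambda>K. \<Sum>k<K. cinner (\<phi> k) (\<psi> k)) \<longlonglongrightarrow> 0" by (simp add: sums_def)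
  then obtain K1 where K1: "\<And>K. K \<ge> K1 \<Longrightarrow> norm ((\<Sum>k<K. cinner (\<phi> k) (\<psi> k)) - 0) < e"
    using LIMSEQ_D[OF _ e] by blast
  obtain K2 where K2: "\<And>K. K \<ge> K2 \<Longrightarrow> norm (\<Sum>k. r (k + K)) < e"
    using suminf_exist_split[OF e summ] by blast
  define K where "K = max K1 K2"
  define c where "c = (\<Sum>k<K. cinner (\<phi> k) (\<psi> k))"
  have c: "cmod c \<le> e" using K1[of K] by (simp add: K_def c_def less_imp_le)
  have t: "(\<Sum>k. norm (\<phi> (k + K)) * norm (\<psi> (k + K))) \<le> e"
    using K2[of K] by (simp add: K_def r_def)
  have "vanishes (\<lambda>n N u. \<Sum>k<K. avg n N u (\<phi> k) (\<psi> k) - cinner (\<phi> k) (\<psi> k) * avg n N u (dyad 0 0) (dyad 0 0))"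
    by (rule vanishes_sum) (rule good_all[unfolded good_def])
  moreover have "0 < \<epsilon> / 6" using assms(3) by simp
  ultimately have "\<exists>n. \<forall>N u. bessel N u \<longrightarrow>
      cmod (\<Sum>k<K. avg n N u (\<phi> k) (\<psi> k) - cinner (\<phi> k) (\<psi> k) * avg n N u (dyad 0 0) (dyad 0 0)) \<le> \<epsilon> / 6"
    by (rule vanishesD)
  then obtain n where "\<forall>N u. bessel N u \<longrightarrow>
      cmod (\<Sum>k<K. avg n N u (\<phi> k) (\<psi> k) - cinner (\<phi> k) (\<psi> k) * avg n N u (dyad 0 0) (dyad 0 0)) \<le> \<epsilon> / 6" ..
  then have n: "cmod ((\<Sum>k<K. avg n N u (\<phi> k) (\<psi> k)) - c * avg n N u (dyad 0 0) (dyad 0 0)) \<le> \<epsilon> / 6"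
    if "bessel N u" for N u
    using that by (simp add: sum_subtractf c_def sum_distrib_right)
  obtain B where B: "represents B (mod_act (rho n) X)"
    "\<And>F G. cinner (blinfun_apply B F) G = (\<integral>z. rho n z * cinner (A (shift z F)) (shift z G) \<partial>lborel)"
    using mod_act_represented[OF A nuc integrable_rho] by blast
  \<comment> \<open>\<epsilon>/2 leaves room for the strict inequality, as duality only gives a weak
    one.\<close>
  have "trace_norm (mod_act (rho n) X) \<le> ennreal (\<epsilon> / 2)"
  proof (rule trace_norm_le[OF B(1)])
    fix N u assume u: "bessel N u"
    let ?P = "\<Sum>m<N. cinner (B (basis m)) (u m)" and ?Q = "\<Sum>k<K. avg n N u (\<phi> k) (\<psi> k)"
      and ?D = "avg n N u (dyad 0 0) (dyad 0 0)"
    have "cmod (?P - ?Q) \<le> vnorm\<^sup>2 * e"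
      by (rule order_trans[OF mod_act_trace_bound[OF nuc u B(2)]]) (use t in \<open>simp add: mult_left_mono\<close>)
    moreover have "cmod (c * ?D) \<le> e * vnorm\<^sup>2"
    proof -
      have "norm (dyad 0 0) * norm (dyad 0 0) = 1" using norm_dyad[of 0 0] by (simp add: power2_eq_square)
      then have "cmod ?D \<le> vnorm\<^sup>2" using avg_bound[OF u, of n "dyad 0 0" "dyad 0 0"] by simp
      then show ?thesis unfolding norm_mult using c e by (intro mult_mono) auto
    qed
    moreover have "cmod ?P \<le> cmod (?P - ?Q) + cmod (?Q - c * ?D) + cmod (c * ?D)"
      using norm_triangle_ineq[of "?P - ?Q" "?Q"] norm_triangle_ineq[of "?Q - c * ?D" "c * ?D"] by simp
    ultimately show "cmod ?P \<le> \<epsilon> / 2" using n[OF u] eL by (simp add: mult.commute)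
  qed
  also have "\<dots> < ennreal \<epsilon>" using assms(3) by (simp add: ennreal_lessI)
  finally have small: "trace_norm (mod_act (rho n) X) < ennreal \<epsilon>" .
  \<comment> \<open>On this open square both coordinates lie in the plateau of the dilated
    trapezoid.\<close>
  define U where "U = {w :: real \<times> real. \<bar>real (Suc n) * fst w\<bar> < 1} \<inter> {w. \<bar>real (Suc n) * snd w\<bar> < 1}"
  have "open U" unfolding U_def by (intro open_Int open_Collect_less continuous_intros)
  moreover have "(0, 0) \<in> U" by (simp add: U_def)
  moreover have "fourier2 (rho n) w = 1" if "w \<in> U" for w
    using that rho_fourier[of n "fst w" "snd w"] by (simp add: U_def del: of_nat_Suc)
  ultimately show ?thesis using small integrable_rho by blast
qed



end
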